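(* Let $G=N\rtimes H$, $M$, $\mathcal U$, $D$, $D_0$, $\alpha$ and $D_0\rtimes_\alpha G$ be as in the context, with $\mathcal U$ having finite quotients and $H$ acting effectively on $M$. Assume that the regular representation of $D\rtimes_\alpha G$ onto $D\rtimes_{\alpha,r}G$ is an isomorphism. Then the $*$-algebra $D_0\rtimes_\alpha G$ has a unique $C^*$-norm.
   Context: $G=N\rtimes H$ is a discrete group which is a semidirect product with normal subgroup $N$ and quotient group $H$ (regarded as a subgroup of $G$, acting on $N$ by conjugation), and $M\neq\{e\}$ is a normal subgroup of $N$. Put $\mathcal U=\{aMa^{-1}:a\in H\}$. Standing assumptions: (filter base) for all $U,V\in\mathcal U$ there is $W\in\mathcal U$ with $W\subseteq U\cap V$; (separating) $\bigcap_{U\in\mathcal U}U=\{e\}$; (finite quotients) $|U/V|<\infty$ whenever $V\subseteq U$ in $\mathcal U$; (effective) for each $a\ne e$ in $H$ there is $s\in M$ with $asa^{-1}\neq s$. For $g=xa\in G$ with $x\in N$, $a\in H$, let $\beta_g:N\to N$, $\beta_g(y)=xaya^{-1}$, and let $\alpha_g(f)=f\circ\beta_{g^{-1}}$ for $f\in\ell^\infty(N)$. Let $\mathcal P=\{\chi_{xU}:x\in N,U\in\mathcal U\}\subseteq\ell^\infty(N)$, let $D=C^*(\mathcal P)\subseteq\ell^\infty(N)$, and let $D_0=\operatorname{span}\mathcal P$, a dense $\alpha$-invariant $*$-subalgebra of $D$. $\alpha$ restricts to an action of $G$ on $D$. $D\rtimes_\alpha G$ and $D\rtimes_{\alpha,r}G$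 are the full and reduced $C^*$-crossed products; $i_D:D\to M(D\rtimes_\alpha G)$ and $i_G:G\to UM(D\rtimes_\alpha G)$ are the canonical maps. The algebraic crossed product is the $*$-subalgebra $D_0\rtimes_\alpha G:=\operatorname{span} i_G(G)i_D(D_0)$ of $D\rtimes_\alpha G$. *)

theory Defs
  imports "HOL-Algebra.Coset" "HOL-Analysis.Analysis"
begin

section \<open>Star-algebras and C*-algebras on explicit carriers\<close>

text \<open>Complex star-algebras need not be unital, so the ring records of HOL-Algebra do not apply.\<close>

record 'a star_alg = "'a partial_object" +
  sadd :: "'a \<Rightarrow> 'a \<Rightarrow> 'a"
  sscale :: "complex \<Rightarrow> 'a \<Rightarrow> 'a"
  smult :: "'a \<Rightarrow> 'a \<Rightarrow> 'a"
  sstar :: "'a \<Rightarrow> 'a"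

record 'a cstar_alg = "'a star_alg" +
  snorm :: "'a \<Rightarrow> real"

definition sdiff :: "('a, 'm) star_alg_scheme \<Rightarrow> 'a \<Rightarrow> 'a \<Rightarrow> 'a" where
  "sdiff A x y = sadd A x (sscale A (-1) y)"

definition cstar_seminorm :: "('a, 'm) star_alg_scheme \<Rightarrow> ('a \<Rightarrow> real) \<Rightarrow> bool" where
  "cstar_seminorm A p \<longleftrightarrow>
     (\<forall>x\<in>carrier A. 0 \<le> p x) \<and>
     (\<forall>x\<in>carrier A. \<forall>y\<in>carrier A. p (sadd A x y) \<le> p x + p y) \<and>
     (\<forall>c. \<forall>x\<in>carrier A. p (sscale A c x) = cmod c * p x) \<and>
     (\<forall>x\<in>carrier A. \<forall>y\<in>carrier A. p (smult A x y) \<le> p x * p y) \<and>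
     (\<forall>x\<in>carrier A. p (sstar A x) = p x) \<and>
     (\<forall>x\<in>carrier A. p (smult A (sstar A x) x) = (p x)\<^sup>2)"

text \<open>No completeness is required of a C*-norm on a star-algebra.\<close>

definition cstar_norm :: "('a, 'm) star_alg_scheme \<Rightarrow> ('a \<Rightarrow> real) \<Rightarrow> bool" where
  "cstar_norm A p \<longleftrightarrow>
     cstar_seminorm A p \<and> (\<forall>x\<in>carrier A. p x = 0 \<longrightarrow> x = sscale A 0 x)"

inductive_set cspan :: "('a, 'm) star_alg_scheme \<Rightarrow> 'a set \<Rightarrow> 'a set"
  for A :: "('a, 'm) star_alg_scheme" and S :: "'a set" where
  base: "x \<in> S \<Longrightarrow> x \<in> cspan A S"
| add: "x \<in> cspan A S \<Longrightarrow> y \<in> cspan A S \<Longrightarrow> sadd A x y \<in> cspan A S"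
| scale: "x \<in> cspan A S \<Longrightarrow> sscale A c x \<in> cspan A S"

definition cstar_subalgebra :: "('a, 'm) cstar_alg_scheme \<Rightarrow> 'a set \<Rightarrow> bool" where
  "cstar_subalgebra B C \<longleftrightarrow>
     C \<noteq> {} \<and> C \<subseteq> carrier B \<and>
     (\<forall>x\<in>C. \<forall>y\<in>C. sadd B x y \<in> C) \<and>
     (\<forall>c. \<forall>x\<in>C. sscale B c x \<in> C) \<and>
     (\<forall>x\<in>C. \<forall>y\<in>C. smult B x y \<in> C) \<and>
     (\<forall>x\<in>C. sstar B x \<in> C) \<and>
     (\<forall>x\<in>carrier B. (\<forall>e>0. \<exists>y\<in>C. snorm B (sdiff B x y) < e) \<longrightarrow> x \<in> C)"

definition cstar_generated :: "('a, 'm) cstar_alg_scheme \<Rightarrow> 'a set \<Rightarrow> 'a set" where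
  "cstar_generated B S = \<Inter>{C. cstar_subalgebra B C \<and> S \<subseteq> C}"

definition star_iso ::
    "('a, 'm) star_alg_scheme \<Rightarrow> ('b, 'n) star_alg_scheme \<Rightarrow> ('a \<Rightarrow> 'b) \<Rightarrow> bool" where
  "star_iso A B h \<longleftrightarrow>
     bij_betw h (carrier A) (carrier B) \<and>
     (\<forall>x\<in>carrier A. \<forall>y\<in>carrier A. h (sadd A x y) = sadd B (h x) (h y)) \<and>
     (\<forall>c. \<forall>x\<in>carrier A. h (sscale A c x) = sscale B c (h x)) \<and>
     (\<forall>x\<in>carrier A. \<forall>y\<in>carrier A. h (smult A x y) = smult B (h x) (h y)) \<and>
     (\<forall>x\<in>carrier A. h (sstar A x) = sstar B (h x))"


subsection \<open>Hausdorff completion in a C*-seminorm\<close>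

definition cauchy_seqs :: "('a, 'm) star_alg_scheme \<Rightarrow> ('a \<Rightarrow> real) \<Rightarrow> (nat \<Rightarrow> 'a) set" where
  "cauchy_seqs A p = {s. (\<forall>n. s n \<in> carrier A) \<and>
     (\<forall>e>0. \<exists>K. \<forall>m\<ge>K. \<forall>n\<ge>K. p (sdiff A (s m) (s n)) < e)}"

definition cauchy_rel ::
    "('a, 'm) star_alg_scheme \<Rightarrow> ('a \<Rightarrow> real) \<Rightarrow> ((nat \<Rightarrow> 'a) \<times> (nat \<Rightarrow> 'a)) set" where
  "cauchy_rel A p = {(s, t). s \<in> cauchy_seqs A p \<and> t \<in> cauchy_seqs A p \<and>
     (\<lambda>n. p (sdiff A (s n) (t n))) \<longlonglongrightarrow> 0}"

definition cauchy_class ::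
    "('a, 'm) star_alg_scheme \<Rightarrow> ('a \<Rightarrow> real) \<Rightarrow> (nat \<Rightarrow> 'a) \<Rightarrow> (nat \<Rightarrow> 'a) set" where
  "cauchy_class A p s = cauchy_rel A p `` {s}"

text \<open>As usual for quotients, each union below is over sets that all coincide.\<close>

definition completion ::
    "('a, 'm) star_alg_scheme \<Rightarrow> ('a \<Rightarrow> real) \<Rightarrow> (nat \<Rightarrow> 'a) set cstar_alg" where
  "completion A p =
     \<lparr> carrier = cauchy_seqs A p // cauchy_rel A p,
       sadd = (\<lambda>X Y. \<Union>s\<in>X. \<Union>t\<in>Y. cauchy_class A p (\<lambda>n. sadd A (s n) (t n))),
       sscale = (\<lambda>c X. \<Union>s\<in>X. cauchy_class A p (\<lambda>n. sscale A c (s n))),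
       smult = (\<lambda>X Y. \<Union>s\<in>X. \<Union>t\<in>Y. cauchy_class A p (\<lambda>n. smult A (s n) (t n))),
       sstar = (\<lambda>X. \<Union>s\<in>X. cauchy_class A p (\<lambda>n. sstar A (s n))),
       snorm = (\<lambda>X. THE r. \<forall>s\<in>X. (\<lambda>n. p (s n)) \<longlonglongrightarrow> r) \<rparr>"


subsection \<open>Multiplier algebra\<close>

text \<open>The multiplier algebra of a C*-algebra \<open>A\<close>, realised as the algebra of adjointable operators
  on the Hilbert module \<open>A\<close> over itself, with inner product \<open>\<langle>a, b\<rangle> = a* b\<close>. An adjointable operator is
  automatically linear and bounded, and \<open>A\<close> sits inside as left multiplications. Only the star-algebra
  structure is recorded.\<close>

definition adjoint_on :: "('a, 'm) star_alg_scheme \<Rightarrow> ('a \<Rightarrow> 'a) \<Rightarrow> ('a \<Rightarrow> 'a) \<Rightarrow> bool" where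
  "adjoint_on A T S \<longleftrightarrow>
     (\<forall>a\<in>carrier A. \<forall>b\<in>carrier A. smult A (sstar A (T a)) b = smult A (sstar A a) (S b))"

definition multiplier_alg :: "('a, 'm) star_alg_scheme \<Rightarrow> ('a \<Rightarrow> 'a) star_alg" where
  "multiplier_alg A =
     \<lparr> carrier = {T \<in> carrier A \<rightarrow>\<^sub>E carrier A. \<exists>S \<in> carrier A \<rightarrow>\<^sub>E carrier A. adjoint_on A T S},
       sadd = (\<lambda>T S. \<lambda>a\<in>carrier A. sadd A (T a) (S a)),
       sscale = (\<lambda>c T. \<lambda>a\<in>carrier A. sscale A c (T a)),
       smult = (\<lambda>T S. \<lambda>a\<in>carrier A. T (S a)),
       sstar = (\<lambda>T. THE S. S \<in> carrier A \<rightarrow>\<^sub>E carrier A \<and> adjoint_on A T S) \<rparr>"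


section \<open>Concrete C*-algebras\<close>

text \<open>Functions on a set \<open>X\<close> are represented by functions on the ambient type that vanish
  outside \<open>X\<close>.\<close>

definition linf :: "'x set \<Rightarrow> ('x \<Rightarrow> complex) cstar_alg" where
  "linf X =
     \<lparr> carrier = {f. (\<forall>y. y \<notin> X \<longrightarrow> f y = 0) \<and> bounded (f ` X)},
       sadd = (\<lambda>f g y. f y + g y),
       sscale = (\<lambda>c f y. c * f y),
       smult = (\<lambda>f g y. f y * g y),
       sstar = (\<lambda>f y. cnj (f y)),
       snorm = (\<lambda>f. SUP y\<in>X. cmod (f y)) \<rparr>"

definition ell2 :: "'i set \<Rightarrow> ('i \<Rightarrow> complex) set" where
  "ell2 I = {\<xi>. (\<forall>i. i \<notin> I \<longrightarrow> \<xi> i = 0) \<and> (\<lambda>i. (cmod (\<xi> i))\<^sup>2) summable_on I}"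

definition ell2_inner :: "'i set \<Rightarrow> ('i \<Rightarrow> complex) \<Rightarrow> ('i \<Rightarrow> complex) \<Rightarrow> complex" where
  "ell2_inner I \<xi> \<eta> = (\<Sum>\<^sub>\<infinity>i\<in>I. cnj (\<xi> i) * \<eta> i)"

definition ell2_norm :: "'i set \<Rightarrow> ('i \<Rightarrow> complex) \<Rightarrow> real" where
  "ell2_norm I \<xi> = sqrt (\<Sum>\<^sub>\<infinity>i\<in>I. (cmod (\<xi> i))\<^sup>2)"

definition bounded_operators :: "'i set \<Rightarrow> (('i \<Rightarrow> complex) \<Rightarrow> ('i \<Rightarrow> complex)) set" where
  "bounded_operators I = {T \<in> ell2 I \<rightarrow>\<^sub>E ell2 I.
     (\<forall>\<xi>\<in>ell2 I. \<forall>\<eta>\<in>ell2 I. T (\<lambda>i. \<xi> i + \<eta> i) = (\<lambda>i. T \<xi> i + T \<eta> i)) \<and>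
     (\<forall>c. \<forall>\<xi>\<in>ell2 I. T (\<lambda>i. c * \<xi> i) = (\<lambda>i. c * T \<xi> i)) \<and>
     (\<exists>K. \<forall>\<xi>\<in>ell2 I. ell2_norm I (T \<xi>) \<le> K * ell2_norm I \<xi>)}"

definition operator_alg :: "'i set \<Rightarrow> (('i \<Rightarrow> complex) \<Rightarrow> ('i \<Rightarrow> complex)) cstar_alg" where
  "operator_alg I =
     \<lparr> carrier = bounded_operators I,
       sadd = (\<lambda>T S. \<lambda>\<xi>\<in>ell2 I. \<lambda>i. T \<xi> i + S \<xi> i),
       sscale = (\<lambda>c T. \<lambda>\<xi>\<in>ell2 I. \<lambda>i. c * T \<xi> i),
       smult = (\<lambda>T S. \<lambda>\<xi>\<in>ell2 I. T (S \<xi>)),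
       sstar = (\<lambda>T. THE S. S \<in> bounded_operators I \<and>
         (\<forall>\<xi>\<in>ell2 I. \<forall>\<eta>\<in>ell2 I. ell2_inner I (T \<xi>) \<eta> = ell2_inner I \<xi> (S \<eta>))),
       snorm = (\<lambda>T. SUP \<xi>\<in>{\<xi>\<in>ell2 I. ell2_norm I \<xi> \<le> 1}. ell2_norm I (T \<xi>)) \<rparr>"


section \<open>Crossed products by a discrete group\<close>

text \<open>Throughout, the discrete group \<open>G\<close> acts by \<open>\<alpha>\<close> on a C*-subalgebra \<open>D\<close> of \<open>linf X\<close>.

  \<open>cc_alg G D \<alpha>\<close> is the convolution star-algebra of finitely supported functions from \<open>G\<close> to \<open>D\<close>;
  the function \<open>f\<close> stands for the formal sum of the \<open>f t \<cdot> \<delta>\<^sub>t\<close>, where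
  \<open>\<delta>\<^sub>t d = \<alpha>\<^sub>t(d) \<delta>\<^sub>t\<close> and \<open>\<delta>\<^sub>t\<close> is unitary.\<close>

definition cc_alg :: "('g, 'm) monoid_scheme \<Rightarrow> ('x \<Rightarrow> complex) set
    \<Rightarrow> ('g \<Rightarrow> ('x \<Rightarrow> complex) \<Rightarrow> ('x \<Rightarrow> complex)) \<Rightarrow> ('g \<Rightarrow> 'x \<Rightarrow> complex) star_alg" where
  "cc_alg G D \<alpha> =
     \<lparr> carrier = {f. (\<forall>s\<in>carrier G. f s \<in> D) \<and> (\<forall>s. s \<notin> carrier G \<longrightarrow> f s = (\<lambda>_. 0)) \<and>
         finite {s. f s \<noteq> (\<lambda>_. 0)}},
       sadd = (\<lambda>f g s y. f s y + g s y),
       sscale = (\<lambda>c f s y. c * f s y),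
       smult = (\<lambda>f g s. if s \<in> carrier G
         then (\<lambda>y. \<Sum>t\<in>{t\<in>carrier G. f t \<noteq> (\<lambda>_. 0)}.
                f t y * \<alpha> t (g (inv\<^bsub>G\<^esub> t \<otimes>\<^bsub>G\<^esub> s)) y)
         else (\<lambda>_. 0)),
       sstar = (\<lambda>f s. if s \<in> carrier G
         then \<alpha> s (\<lambda>y. cnj (f (inv\<^bsub>G\<^esub> s) y)) else (\<lambda>_. 0)) \<rparr>"

text \<open>The norm of the full crossed product: the largest C*-seminorm on \<open>cc_alg G D \<alpha>\<close>. The supremum
  is over a set bounded by the \<open>\<ell>\<^sup>1\<close>-norm. As \<open>G\<close> is discrete, the C*-seminorms on \<open>cc_alg G D \<alpha>\<close> are
  exactly the functions \<open>f \<mapsto> \<parallel>\<Sum>\<^sub>t \<pi>(f t) U\<^sub>t\<parallel>\<close> for covariant pairs \<open>(\<pi>, U)\<close>, so this is the usual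
  universal norm.\<close>

definition full_norm :: "('g, 'm) monoid_scheme \<Rightarrow> ('x \<Rightarrow> complex) set
    \<Rightarrow> ('g \<Rightarrow> ('x \<Rightarrow> complex) \<Rightarrow> ('x \<Rightarrow> complex)) \<Rightarrow> ('g \<Rightarrow> 'x \<Rightarrow> complex) \<Rightarrow> real" where
  "full_norm G D \<alpha> f = Sup {p f | p. cstar_seminorm (cc_alg G D \<alpha>) p}"

definition full_crossed_product :: "('g, 'm) monoid_scheme \<Rightarrow> ('x \<Rightarrow> complex) set
    \<Rightarrow> ('g \<Rightarrow> ('x \<Rightarrow> complex) \<Rightarrow> ('x \<Rightarrow> complex))
    \<Rightarrow> (nat \<Rightarrow> 'g \<Rightarrow> 'x \<Rightarrow> complex) set cstar_alg" where
  "full_crossed_product G D \<alpha> = completion (cc_alg G D \<alpha>) (full_norm G D \<alpha>)"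

text \<open>The canonical maps \<open>i\<^sub>D\<close> and \<open>i\<^sub>G\<close> into the multiplier algebra of the full crossed product:
  left multiplication by (the class of) \<open>d \<delta>\<^sub>e\<close>, and the continuous extension of left translation
  \<open>f \<mapsto> \<delta>\<^sub>s f\<close>, that is \<open>(\<delta>\<^sub>s f)(t) = \<alpha>\<^sub>s (f (s\<^sup>-\<^sup>1 t))\<close>.\<close>

definition iD :: "('g, 'm) monoid_scheme \<Rightarrow> ('x \<Rightarrow> complex) set
    \<Rightarrow> ('g \<Rightarrow> ('x \<Rightarrow> complex) \<Rightarrow> ('x \<Rightarrow> complex)) \<Rightarrow> ('x \<Rightarrow> complex)
    \<Rightarrow> (nat \<Rightarrow> 'g \<Rightarrow> 'x \<Rightarrow> complex) set \<Rightarrow> (nat \<Rightarrow> 'g \<Rightarrow> 'x \<Rightarrow> complex) set" where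
  "iD G D \<alpha> d = (\<lambda>a\<in>carrier (full_crossed_product G D \<alpha>).
     smult (full_crossed_product G D \<alpha>)
       (cauchy_class (cc_alg G D \<alpha>) (full_norm G D \<alpha>)
         (\<lambda>n t. if t = \<one>\<^bsub>G\<^esub> then d else (\<lambda>_. 0))) a)"

definition iG :: "('g, 'm) monoid_scheme \<Rightarrow> ('x \<Rightarrow> complex) set
    \<Rightarrow> ('g \<Rightarrow> ('x \<Rightarrow> complex) \<Rightarrow> ('x \<Rightarrow> complex)) \<Rightarrow> 'g
    \<Rightarrow> (nat \<Rightarrow> 'g \<Rightarrow> 'x \<Rightarrow> complex) set \<Rightarrow> (nat \<Rightarrow> 'g \<Rightarrow> 'x \<Rightarrow> complex) set" where
  "iG G D \<alpha> s = (\<lambda>a\<in>carrier (full_crossed_product G D \<alpha>).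
     \<Union>f\<in>a. cauchy_class (cc_alg G D \<alpha>) (full_norm G D \<alpha>)
       (\<lambda>n t. if t \<in> carrier G then \<alpha> s (f n (inv\<^bsub>G\<^esub> s \<otimes>\<^bsub>G\<^esub> t)) else (\<lambda>_. 0)))"

definition algebraic_crossed_product :: "('g, 'm) monoid_scheme \<Rightarrow> ('x \<Rightarrow> complex) set
    \<Rightarrow> ('x \<Rightarrow> complex) set \<Rightarrow> ('g \<Rightarrow> ('x \<Rightarrow> complex) \<Rightarrow> ('x \<Rightarrow> complex))
    \<Rightarrow> ((nat \<Rightarrow> 'g \<Rightarrow> 'x \<Rightarrow> complex) set \<Rightarrow> (nat \<Rightarrow> 'g \<Rightarrow> 'x \<Rightarrow> complex) set) star_alg" where
  "algebraic_crossed_product G D D0 \<alpha> =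
     (let M = multiplier_alg (full_crossed_product G D \<alpha>) in
      M \<lparr> carrier := cspan M {smult M (iG G D \<alpha> s) (iD G D \<alpha> d) | s d. s \<in> carrier G \<and> d \<in> D0} \<rparr>)"

text \<open>The regular representation is induced from the faithful representation of \<open>D\<close> on \<open>\<ell>\<^sup>2(X)\<close> by
  multiplication operators; it acts on \<open>\<ell>\<^sup>2(G \<times> X) = \<ell>\<^sup>2(G, \<ell>\<^sup>2(X))\<close> by
  \<open>(d \<xi>)(s) = \<alpha>\<^sub>s\<^sup>-\<^sup>1(d) \<xi>(s)\<close> and \<open>(\<delta>\<^sub>t \<xi>)(s) = \<xi>(t\<^sup>-\<^sup>1 s)\<close>.\<close>

definition regular_rep_cc :: "('g, 'm) monoid_scheme \<Rightarrow> 'x set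
    \<Rightarrow> ('g \<Rightarrow> ('x \<Rightarrow> complex) \<Rightarrow> ('x \<Rightarrow> complex)) \<Rightarrow> ('g \<Rightarrow> 'x \<Rightarrow> complex)
    \<Rightarrow> ('g \<times> 'x \<Rightarrow> complex) \<Rightarrow> ('g \<times> 'x \<Rightarrow> complex)" where
  "regular_rep_cc G X \<alpha> f = (\<lambda>\<xi>\<in>ell2 (carrier G \<times> X). \<lambda>(s, y).
     if s \<in> carrier G \<and> y \<in> X
     then \<Sum>t\<in>{t\<in>carrier G. f t \<noteq> (\<lambda>_. 0)}.
            \<alpha> (inv\<^bsub>G\<^esub> s) (f t) y * \<xi> (inv\<^bsub>G\<^esub> t \<otimes>\<^bsub>G\<^esub> s, y)
     else 0)"

definition reduced_crossed_product :: "('g, 'm) monoid_scheme \<Rightarrow> 'x set \<Rightarrow> ('x \<Rightarrow> complex) set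
    \<Rightarrow> ('g \<Rightarrow> ('x \<Rightarrow> complex) \<Rightarrow> ('x \<Rightarrow> complex))
    \<Rightarrow> (('g \<times> 'x \<Rightarrow> complex) \<Rightarrow> ('g \<times> 'x \<Rightarrow> complex)) cstar_alg" where
  "reduced_crossed_product G X D \<alpha> =
     (let B = operator_alg (carrier G \<times> X) in
      B \<lparr> carrier := {T \<in> carrier B. \<forall>e>0. \<exists>f\<in>carrier (cc_alg G D \<alpha>).
            snorm B (sdiff B T (regular_rep_cc G X \<alpha> f)) < e} \<rparr>)"

text \<open>The continuous extension of \<open>regular_rep_cc\<close> to the full crossed product.\<close>

definition regular_rep :: "('g, 'm) monoid_scheme \<Rightarrow> 'x set
    \<Rightarrow> ('g \<Rightarrow> ('x \<Rightarrow> complex) \<Rightarrow> ('x \<Rightarrow> complex)) \<Rightarrow> (nat \<Rightarrow> 'g \<Rightarrow> 'x \<Rightarrow> complex) set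
    \<Rightarrow> ('g \<times> 'x \<Rightarrow> complex) \<Rightarrow> ('g \<times> 'x \<Rightarrow> complex)" where
  "regular_rep G X \<alpha> a =
     (let B = operator_alg (carrier G \<times> X) in
      THE T. T \<in> carrier B \<and>
        (\<forall>f\<in>a. (\<lambda>n. snorm B (sdiff B (regular_rep_cc G X \<alpha> (f n)) T)) \<longlonglongrightarrow> 0))"


section \<open>The action attached to a semidirect product\<close>

definition conj_family :: "('g, 'm) monoid_scheme \<Rightarrow> 'g set \<Rightarrow> 'g set \<Rightarrow> 'g set set" where
  "conj_family G H M = {(a <#\<^bsub>G\<^esub> M) #>\<^bsub>G\<^esub> inv\<^bsub>G\<^esub> a | a. a \<in> H}"

definition beta :: "('g, 'm) monoid_scheme \<Rightarrow> 'g set \<Rightarrow> 'g set \<Rightarrow> 'g \<Rightarrow> 'g \<Rightarrow> 'g" where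
  "beta G N H g y = (THE z. \<exists>x\<in>N. \<exists>a\<in>H. g = x \<otimes>\<^bsub>G\<^esub> a \<and>
     z = x \<otimes>\<^bsub>G\<^esub> a \<otimes>\<^bsub>G\<^esub> y \<otimes>\<^bsub>G\<^esub> inv\<^bsub>G\<^esub> a)"

definition alpha :: "('g, 'm) monoid_scheme \<Rightarrow> 'g set \<Rightarrow> 'g set \<Rightarrow> 'g
    \<Rightarrow> ('g \<Rightarrow> complex) \<Rightarrow> ('g \<Rightarrow> complex)" where
  "alpha G N H g f = (\<lambda>y. if y \<in> N then f (beta G N H (inv\<^bsub>G\<^esub> g) y) else 0)"

definition coset_indicators :: "('g, 'm) monoid_scheme \<Rightarrow> 'g set \<Rightarrow> 'g set set
    \<Rightarrow> ('g \<Rightarrow> complex) set" where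
  "coset_indicators G N \<U> = {indicator (x <#\<^bsub>G\<^esub> U) | x U. x \<in> N \<and> U \<in> \<U>}"

definition D_alg :: "('g, 'm) monoid_scheme \<Rightarrow> 'g set \<Rightarrow> 'g set set \<Rightarrow> ('g \<Rightarrow> complex) set" where
  "D_alg G N \<U> = cstar_generated (linf N) (coset_indicators G N \<U>)"

definition D0_alg :: "('g, 'm) monoid_scheme \<Rightarrow> 'g set \<Rightarrow> 'g set set \<Rightarrow> ('g \<Rightarrow> complex) set" where
  "D0_alg G N \<U> = cspan (linf N) (coset_indicators G N \<U>)"

end

theory Submission
  imports Defs
begin

text \<open>Let \<open>A\<close> be the convolution algebra of finitely supported functions from \<open>G\<close> to \<open>D\<close>, and \<open>A0\<close> the
  subalgebra of those with values in \<open>D0\<close>. Sending \<open>f\<close> to left multiplication by \<open>f\<close> on the completion of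
  \<open>A\<close> identifies \<open>A0\<close> with the algebraic crossed product (\<open>star_iso_algebraic_crossed_product\<close>), so the
  question is which C*-norms \<open>p\<close> exist on \<open>A0\<close>. The full norm is one of them, because it dominates the
  reduced norm, which vanishes only at \<open>0\<close>. For an arbitrary \<open>p\<close> the proof establishes
  \<open>reduced_norm \<le> p \<le> full \<le> reduced_norm\<close> on \<open>A0\<close>.

  \<^item> \<open>p \<le> full\<close>. A real function \<open>h\<close> with \<open>\<bar>h\<bar> \<le> 1\<close> is the real part of the unitary
    \<open>h + \<i> \<surd>(1 - h\<^sup>2)\<close>, which multiplies \<open>D0\<close> and \<open>D\<close> into themselves. Hence any C*-seminorm on a
    convolution algebra over \<open>D0\<close> or \<open>D\<close> is at most the \<open>\<ell>\<^sup>1\<close>-norm (\<open>seminorm_le_l1\<close>). So \<open>p\<close> extends by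
    uniform approximation from \<open>A0\<close> to a C*-seminorm on \<open>A\<close> (\<open>cstar_seminorm_extend\<close>), and the full
    norm is the largest of these.

  \<^item> \<open>reduced_norm \<le> p\<close>. As \<open>H\<close> acts effectively on \<open>M\<close> and the conjugates of \<open>M\<close> separate points, every
    coset \<open>xU\<close> contains a coset \<open>yW\<close> that is disjoint from its images under finitely many prescribed
    elements \<open>t \<noteq> \<one>\<close> (\<open>moved_coset_finite\<close>). If \<open>f \<one>\<close> is constant on \<open>xU\<close> and the \<open>t\<close> exhaust the rest
    of the support of \<open>f\<close>, then the projection \<open>q = \<chi>\<^bsub>yW\<^esub>\<close> satisfies \<open>q f q = f \<one> y \<cdot> q\<close>, and \<open>p q = 1\<close>
    gives \<open>\<bar>f \<one> y\<bar> \<le> p f\<close> (\<open>cstar_norm_dominates_expectation\<close>). So \<open>p\<close> dominates the conditional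
    expectation \<open>f \<mapsto> f \<one>\<close>; applied to the powers of \<open>f* f\<close> this bounds the regular representation by
    \<open>p\<close> (\<open>reduced_norm_le_of_expectation\<close>).

  \<^item> \<open>full \<le> reduced_norm\<close>. This is where the hypothesis on the regular representation enters. It says
    that a map is bijective, not that it is isometric. But the operators on \<open>\<ell>\<^sup>2\<close> form a complete space,
    so a Baire category argument makes the inverse bounded, and two C*-seminorms that are bounded by
    multiples of each other coincide (\<open>seminorms_eq\<close>, \<open>full_eq_reduced\<close>).\<close>

section \<open>Star-algebras and C*-seminorms\<close>

text \<open>The record of a star-algebra has no zero; the zero vector appears as \<open>0 \<cdot> y\<close> for an arbitrary \<open>y\<close>.\<close>

locale star_algebra =
  fixes A :: "('a, 'm) star_alg_scheme"
  assumes carrier_nonempty: "carrier A \<noteq> {}"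
    and add_closed [simp]: "x \<in> carrier A \<Longrightarrow> y \<in> carrier A \<Longrightarrow> sadd A x y \<in> carrier A"
    and scale_closed [simp]: "x \<in> carrier A \<Longrightarrow> sscale A c x \<in> carrier A"
    and mult_closed [simp]: "x \<in> carrier A \<Longrightarrow> y \<in> carrier A \<Longrightarrow> smult A x y \<in> carrier A"
    and star_closed [simp]: "x \<in> carrier A \<Longrightarrow> sstar A x \<in> carrier A"
    and add_assoc: "x \<in> carrier A \<Longrightarrow> y \<in> carrier A \<Longrightarrow> z \<in> carrier A \<Longrightarrow>
        sadd A (sadd A x y) z = sadd A x (sadd A y z)"
    and add_comm: "x \<in> carrier A \<Longrightarrow> y \<in> carrier A \<Longrightarrow> sadd A x y = sadd A y x"
    and add_zero: "x \<in> carrier A \<Longrightarrow> y \<in> carrier A \<Longrightarrow> sadd A x (sscale A 0 y) = x"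
    and scale_one: "x \<in> carrier A \<Longrightarrow> sscale A 1 x = x"
    and scale_scale: "x \<in> carrier A \<Longrightarrow> sscale A a (sscale A b x) = sscale A (a * b) x"
    and scale_add_left: "x \<in> carrier A \<Longrightarrow> sscale A (a + b) x = sadd A (sscale A a x) (sscale A b x)"
    and scale_add_right: "x \<in> carrier A \<Longrightarrow> y \<in> carrier A \<Longrightarrow>
        sscale A a (sadd A x y) = sadd A (sscale A a x) (sscale A a y)"
    and mult_assoc: "x \<in> carrier A \<Longrightarrow> y \<in> carrier A \<Longrightarrow> z \<in> carrier A \<Longrightarrow>
        smult A (smult A x y) z = smult A x (smult A y z)"
    and mult_add_left: "x \<in> carrier A \<Longrightarrow> y \<in> carrier A \<Longrightarrow> z \<in> carrier A \<Longrightarrow>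
        smult A (sadd A x y) z = sadd A (smult A x z) (smult A y z)"
    and mult_add_right: "x \<in> carrier A \<Longrightarrow> y \<in> carrier A \<Longrightarrow> z \<in> carrier A \<Longrightarrow>
        smult A x (sadd A y z) = sadd A (smult A x y) (smult A x z)"
    and mult_scale_left: "x \<in> carrier A \<Longrightarrow> y \<in> carrier A \<Longrightarrow>
        smult A (sscale A c x) y = sscale A c (smult A x y)"
    and mult_scale_right: "x \<in> carrier A \<Longrightarrow> y \<in> carrier A \<Longrightarrow>
        smult A x (sscale A c y) = sscale A c (smult A x y)"
    and star_add: "x \<in> carrier A \<Longrightarrow> y \<in> carrier A \<Longrightarrow>
        sstar A (sadd A x y) = sadd A (sstar A x) (sstar A y)"
    and star_scale: "x \<in> carrier A \<Longrightarrow> sstar A (sscale A c x) = sscale A (cnj c) (sstar A x)"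
    and star_mult: "x \<in> carrier A \<Longrightarrow> y \<in> carrier A \<Longrightarrow>
        sstar A (smult A x y) = smult A (sstar A y) (sstar A x)"
    and star_star: "x \<in> carrier A \<Longrightarrow> sstar A (sstar A x) = x"
begin

lemma add_left_comm:
  "x \<in> carrier A \<Longrightarrow> y \<in> carrier A \<Longrightarrow> z \<in> carrier A \<Longrightarrow>
     sadd A x (sadd A y z) = sadd A y (sadd A x z)"
  by (metis add_assoc add_comm)

lemmas add_ac = add_assoc add_comm add_left_comm

lemma add_neg: "x \<in> carrier A \<Longrightarrow> sadd A x (sscale A (-1) x) = sscale A 0 x"
  using scale_add_left[of x 1 "-1"] scale_one[of x] by simp

lemma diff_closed [simp]: "x \<in> carrier A \<Longrightarrow> y \<in> carrier A \<Longrightarrow> sdiff A x y \<in> carrier A"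
  by (simp add: sdiff_def)

lemma diff_add_cancel: "x \<in> carrier A \<Longrightarrow> y \<in> carrier A \<Longrightarrow> sadd A (sdiff A x y) y = x"
  by (metis add_assoc add_comm add_neg add_zero scale_closed sdiff_def)

lemma add_diff_cancel: "x \<in> carrier A \<Longrightarrow> y \<in> carrier A \<Longrightarrow> sdiff A (sadd A x y) y = x"
  by (metis add_assoc add_neg add_zero scale_closed sdiff_def)

lemma diff_self: "x \<in> carrier A \<Longrightarrow> sdiff A x x = sscale A 0 x"
  by (simp add: sdiff_def add_neg)

lemma diff_trans:
  "x \<in> carrier A \<Longrightarrow> y \<in> carrier A \<Longrightarrow> z \<in> carrier A \<Longrightarrow>
     sdiff A x z = sadd A (sdiff A x y) (sdiff A y z)"
  by (metis add_assoc diff_add_cancel diff_closed scale_closed sdiff_def)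

lemma diff_add_add:
  "x \<in> carrier A \<Longrightarrow> y \<in> carrier A \<Longrightarrow> z \<in> carrier A \<Longrightarrow> w \<in> carrier A \<Longrightarrow>
     sdiff A (sadd A x y) (sadd A z w) = sadd A (sdiff A x z) (sdiff A y w)"
  by (simp add: sdiff_def scale_add_right add_ac)

lemma diff_add_add_cancel:
  "x \<in> carrier A \<Longrightarrow> y \<in> carrier A \<Longrightarrow> z \<in> carrier A \<Longrightarrow>
     sdiff A (sadd A x y) (sadd A z y) = sdiff A x z"
  by (simp add: diff_add_add diff_self add_zero)

lemma diff_diff_cancel: "x \<in> carrier A \<Longrightarrow> y \<in> carrier A \<Longrightarrow> sdiff A x (sdiff A x y) = y"
  by (metis add_comm add_diff_cancel diff_add_cancel diff_closed)

lemma diff_scale: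
  "x \<in> carrier A \<Longrightarrow> y \<in> carrier A \<Longrightarrow>
     sdiff A (sscale A c x) (sscale A c y) = sscale A c (sdiff A x y)"
  by (simp add: sdiff_def scale_add_right scale_scale mult.commute)

lemma diff_mult_left:
  "x \<in> carrier A \<Longrightarrow> y \<in> carrier A \<Longrightarrow> z \<in> carrier A \<Longrightarrow>
     smult A (sdiff A x y) z = sdiff A (smult A x z) (smult A y z)"
  by (simp add: sdiff_def mult_add_left mult_scale_left)

lemma diff_mult_right:
  "x \<in> carrier A \<Longrightarrow> y \<in> carrier A \<Longrightarrow> z \<in> carrier A \<Longrightarrow>
     smult A x (sdiff A y z) = sdiff A (smult A x y) (smult A x z)"
  by (simp add: sdiff_def mult_add_right mult_scale_right)

lemma diff_star:
  "x \<in> carrier A \<Longrightarrow> y \<in> carrier A \<Longrightarrow> sstar A (sdiff A x y) = sdiff A (sstar A x) (sstar A y)"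
  by (simp add: sdiff_def star_add star_scale)

lemma diff_swap:
  "x \<in> carrier A \<Longrightarrow> y \<in> carrier A \<Longrightarrow> sdiff A y x = sscale A (-1) (sdiff A x y)"
  by (simp add: sdiff_def scale_add_right scale_scale scale_one add_ac)

end

lemma (in star_algebra) star_subalgebra:
  assumes "S \<subseteq> carrier A" "S \<noteq> {}"
    and "\<And>x y. x \<in> S \<Longrightarrow> y \<in> S \<Longrightarrow> sadd A x y \<in> S"
    and "\<And>c x. x \<in> S \<Longrightarrow> sscale A c x \<in> S"
    and "\<And>x y. x \<in> S \<Longrightarrow> y \<in> S \<Longrightarrow> smult A x y \<in> S"
    and "\<And>x. x \<in> S \<Longrightarrow> sstar A x \<in> S"
  shows "star_algebra (A\<lparr>carrier := S\<rparr>)"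
proof -
  have S: "\<And>x. x \<in> S \<Longrightarrow> x \<in> carrier A" using assms(1) by blast
  show ?thesis
    by unfold_locales
      (simp_all add: S assms(2-) add_assoc add_zero scale_one scale_scale scale_add_left
        scale_add_right mult_assoc mult_add_left mult_add_right mult_scale_left mult_scale_right
        star_add star_scale star_mult star_star, simp add: S add_comm)
qed

lemma
  assumes "cstar_seminorm A p"
  shows cstar_seminorm_nonneg: "x \<in> carrier A \<Longrightarrow> 0 \<le> p x"
    and cstar_seminorm_add: "x \<in> carrier A \<Longrightarrow> y \<in> carrier A \<Longrightarrow> p (sadd A x y) \<le> p x + p y"
    and cstar_seminorm_scale: "x \<in> carrier A \<Longrightarrow> p (sscale A c x) = cmod c * p x"
    and cstar_seminorm_mult: "x \<in> carrier A \<Longrightarrow> y \<in> carrier A \<Longrightarrow> p (smult A x y) \<le> p x * p y"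
    and cstar_seminorm_star: "x \<in> carrier A \<Longrightarrow> p (sstar A x) = p x"
    and cstar_seminorm_star_mult: "x \<in> carrier A \<Longrightarrow> p (smult A (sstar A x) x) = (p x)\<^sup>2"
  using assms by (auto simp: cstar_seminorm_def)

text \<open>The C*-inequality \<open>(p x)\<^sup>2 \<le> p (x* x)\<close> already forces the star to be isometric, since
  \<open>(p x)\<^sup>2 \<le> p (x*) p x\<close> gives \<open>p x \<le> p (x*)\<close>, and then the same for \<open>x*\<close>.\<close>

lemma (in star_algebra) cstar_seminormI:
  assumes nonneg: "\<And>x. x \<in> carrier A \<Longrightarrow> 0 \<le> p x"
    and add: "\<And>x y. x \<in> carrier A \<Longrightarrow> y \<in> carrier A \<Longrightarrow> p (sadd A x y) \<le> p x + p y"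
    and scale: "\<And>c x. x \<in> carrier A \<Longrightarrow> p (sscale A c x) \<le> cmod c * p x"
    and mult: "\<And>x y. x \<in> carrier A \<Longrightarrow> y \<in> carrier A \<Longrightarrow> p (smult A x y) \<le> p x * p y"
    and sq: "\<And>x. x \<in> carrier A \<Longrightarrow> (p x)\<^sup>2 \<le> p (smult A (sstar A x) x)"
  shows "cstar_seminorm A p"
proof -
  have le: "p x \<le> p (sstar A x)" if x: "x \<in> carrier A" for x
  proof -
    have "p x * p x \<le> p (sstar A x) * p x"
      using order_trans[OF sq[OF x] mult[OF star_closed[OF x] x]] by (simp only: power2_eq_square)
    then show ?thesis
      using nonneg[OF x] nonneg[OF star_closed[OF x]]
      by (cases "p x = 0") (auto simp: mult_le_cancel_right less_le)
  qed
  have star: "p (sstar A x) = p x" if x: "x \<in> carrier A" for x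
    using le[OF x] le[OF star_closed[OF x]] unfolding star_star[OF x] by (rule antisym[rotated])
  have "p (sscale A c x) = cmod c * p x" if x: "x \<in> carrier A" for c x
  proof (rule antisym[OF scale[OF x]])
    show "cmod c * p x \<le> p (sscale A c x)"
    proof (cases "c = 0")
      case True
      then show ?thesis using nonneg[OF scale_closed[OF x], of c] by simp
    next
      case False
      then have "sscale A (1 / c) (sscale A c x) = x" using x by (simp add: scale_scale scale_one)
      then have "p x \<le> cmod (1 / c) * p (sscale A c x)"
        using scale[OF scale_closed[OF x], of "1 / c" c] by (simp only:)
      then show ?thesis using False by (simp add: norm_divide field_simps)
    qed
  qed
  moreover have "p (smult A (sstar A x) x) = (p x)\<^sup>2" if x: "x \<in> carrier A" for x
    using sq[OF x] mult[OF star_closed[OF x] x] unfolding star[OF x] power2_eq_square by (rule antisym[rotated])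
  ultimately show ?thesis
    unfolding cstar_seminorm_def by (intro conjI ballI allI nonneg add mult star)
qed

locale seminormed_star_algebra = star_algebra +
  fixes p
  assumes seminorm: "cstar_seminorm A p"
begin

lemmas p_nonneg [simp] = cstar_seminorm_nonneg[OF seminorm]
lemmas p_add = cstar_seminorm_add[OF seminorm]
lemmas p_scale = cstar_seminorm_scale[OF seminorm]
lemmas p_mult = cstar_seminorm_mult[OF seminorm]
lemmas p_star = cstar_seminorm_star[OF seminorm]
lemmas p_star_mult = cstar_seminorm_star_mult[OF seminorm]

lemma p_diff_self [simp]: "x \<in> carrier A \<Longrightarrow> p (sdiff A x x) = 0"
  by (simp add: diff_self p_scale)

lemma p_diff_commute: "x \<in> carrier A \<Longrightarrow> y \<in> carrier A \<Longrightarrow> p (sdiff A x y) = p (sdiff A y x)"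
  by (simp add: diff_swap[of x y] p_scale)

lemma p_diff_triangle:
  "x \<in> carrier A \<Longrightarrow> y \<in> carrier A \<Longrightarrow> z \<in> carrier A \<Longrightarrow>
     p (sdiff A x z) \<le> p (sdiff A x y) + p (sdiff A y z)"
  by (metis diff_trans diff_closed p_add)

lemma p_diff_le: "x \<in> carrier A \<Longrightarrow> y \<in> carrier A \<Longrightarrow> p (sdiff A x y) \<le> p x + p y"
  using p_add[of x "sscale A (-1) y"] by (simp add: sdiff_def p_scale)

lemma p_abs_diff: "x \<in> carrier A \<Longrightarrow> y \<in> carrier A \<Longrightarrow> \<bar>p x - p y\<bar> \<le> p (sdiff A x y)"
  using p_add[of "sdiff A x y" y] p_add[of "sdiff A y x" x]
  by (simp add: diff_add_cancel p_diff_commute[of y x] abs_le_iff)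

lemma p_diff_add:
  "x \<in> carrier A \<Longrightarrow> y \<in> carrier A \<Longrightarrow> z \<in> carrier A \<Longrightarrow> w \<in> carrier A \<Longrightarrow>
     p (sdiff A (sadd A x y) (sadd A z w)) \<le> p (sdiff A x z) + p (sdiff A y w)"
  by (simp add: diff_add_add p_add)

lemma p_diff_mult:
  assumes "x \<in> carrier A" "y \<in> carrier A" "z \<in> carrier A" "w \<in> carrier A"
  shows "p (sdiff A (smult A x y) (smult A z w)) \<le> p (sdiff A x z) * p y + p z * p (sdiff A y w)"
proof -
  have "sdiff A (smult A x y) (smult A z w) =
      sadd A (smult A (sdiff A x z) y) (smult A z (sdiff A y w))"
    using assms by (simp add: diff_mult_left diff_mult_right diff_trans[symmetric])
  then show ?thesis
    using assms p_add[of "smult A (sdiff A x z) y" "smult A z (sdiff A y w)"]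
      p_mult[of "sdiff A x z" y] p_mult[of z "sdiff A y w"] by simp
qed

lemma p_diff_star:
  "x \<in> carrier A \<Longrightarrow> y \<in> carrier A \<Longrightarrow> p (sdiff A (sstar A x) (sstar A y)) = p (sdiff A x y)"
  by (simp add: diff_star[symmetric] p_star)

lemma cauchy_seq_bounded:
  assumes "f \<in> cauchy_seqs A p"
  shows "\<exists>m::nat. \<forall>n. p (f n) \<le> m"
proof -
  have f: "\<And>n. f n \<in> carrier A" using assms by (auto simp: cauchy_seqs_def)
  obtain K where K: "\<forall>m\<ge>K. \<forall>n\<ge>K. p (sdiff A (f m) (f n)) < 1"
    using assms unfolding cauchy_seqs_def by (auto dest: spec[of _ 1])
  define B where "B = p (f K) + 1 + (\<Sum>i<K. p (f i))"
  have "p (f n) \<le> B" for n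
  proof (cases "n < K")
    case True
    then have "p (f n) \<le> (\<Sum>i<K. p (f i))"
      by (intro member_le_sum) (auto simp: f)
    then show ?thesis using p_nonneg[OF f[of K]] unfolding B_def by linarith
  next
    case False
    then have "p (sdiff A (f n) (f K)) < 1" using K by simp
    then show ?thesis
      using p_abs_diff[OF f[of n] f[of K]] sum_nonneg[of "{..<K}" "\<lambda>i. p (f i)"] f
      unfolding B_def by simp
  qed
  moreover obtain m :: nat where "B \<le> m" using real_arch_simple by blast
  ultimately show ?thesis by (meson order_trans)
qed

end

lemma null_seq_le:
  fixes f g :: "nat \<Rightarrow> real"
  assumes "f \<longlonglongrightarrow> 0" "\<And>n. 0 \<le> g n" "\<And>n. g n \<le> f n"
  shows "g \<longlonglongrightarrow> 0"
  by (rule tendsto_sandwich[of "\<lambda>_. 0" g _ f]) (use assms in auto)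

subsection \<open>Domination of C*-seminorms\<close>

text \<open>If \<open>a > b\<close>, then \<open>(a / b)\<close> raised to the powers \<open>2 ^ k\<close> would outgrow \<open>C\<close>.\<close>

lemma le_of_le_const_mult_powers:
  fixes a b C :: real
  assumes "0 \<le> a" "0 \<le> b" and le: "\<And>k. a ^ (2 ^ k) \<le> C * b ^ (2 ^ k)"
  shows "a \<le> b"
proof (rule ccontr)
  assume "\<not> a \<le> b"
  then have ab: "b < a" by simp
  show False
  proof (cases "b = 0")
    case True
    then show False using le[of 0] ab by simp
  next
    case False
    then have b: "0 < b" using assms by simp
    then have "1 < a / b" using ab by simp
    then obtain n where n: "C < (a / b) ^ n" using real_arch_pow by blast
    have "(a / b) ^ n \<le> (a / b) ^ (2 ^ n)"
      using \<open>1 < a / b\<close> by (intro power_increasing) (auto intro: less_imp_le)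
    also have "\<dots> \<le> C"
      using le[of n] b by (simp add: power_divide divide_le_eq)
    finally show False using n by simp
  qed
qed

context star_algebra
begin

lemma iterated_square:
  assumes "x \<in> carrier A" "sstar A x = x"
  shows "((\<lambda>y. smult A y y) ^^ k) x \<in> carrier A"
    and "sstar A (((\<lambda>y. smult A y y) ^^ k) x) = ((\<lambda>y. smult A y y) ^^ k) x"
    and "cstar_seminorm A p \<Longrightarrow> p (((\<lambda>y. smult A y y) ^^ k) x) = p x ^ (2 ^ k)"
proof -
  have *: "((\<lambda>y. smult A y y) ^^ k) x \<in> carrier A \<and>
     sstar A (((\<lambda>y. smult A y y) ^^ k) x) = ((\<lambda>y. smult A y y) ^^ k) x" for k
    by (induction k) (auto simp: assms star_mult)
  then show "((\<lambda>y. smult A y y) ^^ k) x \<in> carrier A"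
    and "sstar A (((\<lambda>y. smult A y y) ^^ k) x) = ((\<lambda>y. smult A y y) ^^ k) x" by auto
  assume p: "cstar_seminorm A p"
  show "p (((\<lambda>y. smult A y y) ^^ k) x) = p x ^ (2 ^ k)"
  proof (induction k)
    case (Suc k)
    then show ?case
      using cstar_seminorm_star_mult[OF p, of "((\<lambda>y. smult A y y) ^^ k) x"] *[of k]
      by (simp add: power_mult[symmetric] mult.commute)
  qed simp
qed

text \<open>On a self-adjoint element a C*-seminorm is determined by the growth of its values on powers,
  which a constant factor does not affect.\<close>

lemma cstar_seminorm_le_of_bounded:
  assumes q: "cstar_seminorm A q" and p: "cstar_seminorm A p"
    and le: "\<And>x. x \<in> carrier A \<Longrightarrow> q x \<le> K * p x"
    and x: "x \<in> carrier A"
  shows "q x \<le> p x"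
proof -
  define y where "y = smult A (sstar A x) x"
  have y: "y \<in> carrier A" "sstar A y = y"
    using x by (auto simp: y_def star_mult star_star)
  have "q y \<le> p y"
  proof (rule le_of_le_const_mult_powers)
    show "q y ^ (2 ^ k) \<le> K * p y ^ (2 ^ k)" for k
      using le[OF iterated_square(1)[OF y, of k]] iterated_square(3)[OF y, of _ k] p q by simp
  qed (use y p q in \<open>auto intro: cstar_seminorm_nonneg\<close>)
  then have "(q x)\<^sup>2 \<le> (p x)\<^sup>2"
    using x p q by (simp add: y_def cstar_seminorm_star_mult)
  then show ?thesis
    using cstar_seminorm_nonneg[OF p x] by (rule power2_le_imp_le)
qed

end

subsection \<open>A bounded inverse theorem\<close>

text \<open>The Hausdorff completions of a star-algebra in two C*-seminorms \<open>p \<le> q\<close> are related by a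
  map from the \<open>q\<close>-completion to the \<open>p\<close>-completion; the next two definitions say, in terms of
  Cauchy sequences, that this map is injective and surjective.\<close>

definition completion_map_inj ::
    "('a, 'm) star_alg_scheme \<Rightarrow> ('a \<Rightarrow> real) \<Rightarrow> ('a \<Rightarrow> real) \<Rightarrow> bool" where
  "completion_map_inj A q p \<longleftrightarrow>
     (\<forall>f\<in>cauchy_seqs A q. (\<lambda>n. p (f n)) \<longlonglongrightarrow> 0 \<longrightarrow> (\<lambda>n. q (f n)) \<longlonglongrightarrow> 0)"

definition completion_map_surj ::
    "('a, 'm) star_alg_scheme \<Rightarrow> ('a \<Rightarrow> real) \<Rightarrow> ('a \<Rightarrow> real) \<Rightarrow> bool" where
  "completion_map_surj A q p \<longleftrightarrow>
     (\<forall>g\<in>cauchy_seqs A p. \<exists>f\<in>cauchy_seqs A q. (\<lambda>n. p (sdiff A (f n) (g n))) \<longlonglongrightarrow> 0)"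

locale two_seminorms = star_algebra +
  fixes q p
  assumes q_seminorm: "cstar_seminorm A q" and p_seminorm: "cstar_seminorm A p"
    and p_le_q: "x \<in> carrier A \<Longrightarrow> p x \<le> q x"
begin

sublocale q: seminormed_star_algebra A q by unfold_locales (rule q_seminorm)
sublocale p: seminormed_star_algebra A p by unfold_locales (rule p_seminorm)

text \<open>Baire's argument: if no \<open>p\<close>-ball lay in the \<open>p\<close>-closure of a \<open>q\<close>-bounded set, then nested
  \<open>p\<close>-balls, the \<open>n\<close>-th of which avoids the \<open>q\<close>-ball of radius \<open>n\<close>, would produce a point of the
  \<open>p\<close>-completion outside the image of the \<open>q\<close>-completion.\<close>

lemma ball_in_closure_of_bounded:
  assumes surj: "completion_map_surj A q p"
  shows "\<exists>(n::nat) g \<epsilon>. 0 < \<epsilon> \<and> g \<in> carrier A \<and>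
    (\<forall>f\<in>carrier A. p (sdiff A f g) < \<epsilon> \<longrightarrow>
       (\<forall>\<eta>>0. \<exists>h\<in>carrier A. q h \<le> n \<and> p (sdiff A f h) < \<eta>))"
proof (rule ccontr)
  assume neg: "\<not> ?thesis"
  \<comment> \<open>a state is the centre and the radius of a ball\<close>
  define P where "P n s \<longleftrightarrow> fst s \<in> carrier A \<and> 0 < snd s \<and> snd s \<le> (1/2::real) ^ n \<and>
    (\<forall>h\<in>carrier A. q h \<le> real n - 1 \<longrightarrow> snd s \<le> p (sdiff A (fst s) h))" for n s
  define Q where "Q (n::nat) s s' \<longleftrightarrow> p (sdiff A (fst s') (fst s)) + snd s' < snd s" for n s s'
  have "\<exists>s. \<forall>n. P n (s n) \<and> Q n (s n) (s (Suc n))"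
  proof (rule dependent_nat_choice)
    obtain x where "x \<in> carrier A" using carrier_nonempty by blast
    then have "P 0 (x, 1)"
      unfolding P_def by (fastforce dest: q.p_nonneg)
    then show "\<exists>s. P 0 s" by blast
  next
    fix s n assume s: "P n s"
    then have "fst s \<in> carrier A" "0 < snd s / 2" by (auto simp: P_def)
    with neg have "\<not> (\<forall>f\<in>carrier A. p (sdiff A f (fst s)) < snd s / 2 \<longrightarrow>
       (\<forall>\<eta>>0. \<exists>h\<in>carrier A. q h \<le> n \<and> p (sdiff A f h) < \<eta>))"
      by blast
    then obtain f \<eta> where f: "f \<in> carrier A" "p (sdiff A f (fst s)) < snd s / 2" "0 < \<eta>"
      and away: "\<And>h. h \<in> carrier A \<Longrightarrow> q h \<le> n \<Longrightarrow> \<eta> \<le> p (sdiff A f h)"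
      unfolding not_less[symmetric] by blast
    \<comment> \<open>the radius is small enough both for the ball to avoid \<open>q \<le> n\<close> and for it to be nested\<close>
    define r where "r = min (\<eta>) (snd s / 2)"
    have "P (Suc n) (f, r)"
      using f s away by (auto simp: P_def r_def min_le_iff_disj min.coboundedI1)
    moreover have "Q n s (f, r)"
      using f by (auto simp: Q_def r_def min_def)
    ultimately show "\<exists>s'. P (Suc n) s' \<and> Q n s s'" by blast
  qed
  then obtain s where s: "\<And>n. P n (s n)" "\<And>n. Q n (s n) (s (Suc n))" by blast
  define g where "g n = fst (s n)" for n
  have g: "g n \<in> carrier A" for n using s(1)[of n] by (auto simp: P_def g_def)
  have nest: "p (sdiff A (g (n + k)) (g n)) + snd (s (n + k)) \<le> snd (s n)" for n k
  proof (induction k)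
    case 0
    then show ?case using g by simp
  next
    case (Suc k)
    have "p (sdiff A (g (n + Suc k)) (g n)) \<le>
        p (sdiff A (g (Suc (n + k))) (g (n + k))) + p (sdiff A (g (n + k)) (g n))"
      using p.p_diff_triangle g by simp
    then show ?case using Suc s(2)[of "n + k"] by (simp add: Q_def g_def)
  qed
  have small: "p (sdiff A (g m) (g n)) < snd (s n)" if "n \<le> m" for m n
    using nest[of n "m - n"] s(1)[of m] that by (simp add: P_def)
  have "g \<in> cauchy_seqs A p"
    unfolding cauchy_seqs_def
  proof (intro CollectI conjI allI impI g)
    fix e :: real assume "0 < e"
    then obtain K where K: "(1/2::real) ^ K < e / 2"
      using real_arch_pow_inv[of "e/2" "1/2"] by auto
    have "p (sdiff A (g m) (g n)) < e" if "m \<ge> K" "n \<ge> K" for m n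
    proof -
      have "p (sdiff A (g m) (g n)) \<le> p (sdiff A (g m) (g K)) + p (sdiff A (g n) (g K))"
        using p.p_diff_triangle[OF g[of m] g[of K] g[of n]] p.p_diff_commute[OF g[of K] g[of n]]
        by simp
      also have "\<dots> < 2 * snd (s K)"
        using small[OF that(1)] small[OF that(2)] by simp
      also have "\<dots> \<le> 2 * (1/2) ^ K" using s(1)[of K] by (simp add: P_def)
      finally show ?thesis using K by simp
    qed
    then show "\<exists>K. \<forall>m\<ge>K. \<forall>n\<ge>K. p (sdiff A (g m) (g n)) < e" by blast
  qed
  with surj obtain f where f: "f \<in> cauchy_seqs A q" "(\<lambda>n. p (sdiff A (f n) (g n))) \<longlonglongrightarrow> 0"
    unfolding completion_map_surj_def by blast
  have fc: "f n \<in> carrier A" for n using f(1) by (auto simp: cauchy_seqs_def)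
  obtain m :: nat where m: "\<And>n. q (f n) \<le> m" using q.cauchy_seq_bounded[OF f(1)] by blast
  define n0 where "n0 = Suc m"
  \<comment> \<open>strictness in the nesting leaves room to replace the centres by the lifted sequence \<open>f\<close>\<close>
  define gap where "gap = snd (s n0) - p (sdiff A (g (Suc n0)) (g n0)) - snd (s (Suc n0))"
  have "0 < gap" using s(2)[of n0] by (simp add: Q_def gap_def g_def)
  with order_tendstoD(2)[OF f(2)] have "eventually (\<lambda>n. p (sdiff A (f n) (g n)) < gap) sequentially"
    by blast
  then obtain K where K: "\<And>n. n \<ge> K \<Longrightarrow> p (sdiff A (f n) (g n)) < gap"
    by (auto simp: eventually_sequentially)
  define k where "k = max K (Suc n0)"
  have "snd (s n0) \<le> p (sdiff A (g n0) (f k))"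
    using s(1)[of n0] fc[of k] m[of k] by (simp add: P_def g_def n0_def)
  also have "\<dots> \<le> p (sdiff A (g (Suc n0)) (g n0)) + p (sdiff A (g (Suc n0)) (f k))"
    using p.p_diff_triangle[OF g[of n0] g[of "Suc n0"] fc[of k]]
      p.p_diff_commute[OF g[of n0] g[of "Suc n0"]] by simp
  also have "p (sdiff A (g (Suc n0)) (f k)) \<le>
      p (sdiff A (g k) (g (Suc n0))) + p (sdiff A (f k) (g k))"
    using p.p_diff_triangle[OF g[of "Suc n0"] g[of k] fc[of k]]
      p.p_diff_commute[OF g[of "Suc n0"] g[of k]] p.p_diff_commute[OF g[of k] fc[of k]] by simp
  also have "\<dots> < snd (s (Suc n0)) + gap"
    using small[of "Suc n0" k] K[of k] by (auto simp: k_def intro: add_strict_mono)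
  finally show False by (simp add: gap_def)
qed

text \<open>Balls about an arbitrary centre, as produced by Baire's argument, are replaced by balls about the
  origin and rescaled, so that the \<open>q\<close>-bound becomes proportional to the radius.\<close>

lemma approximate_lift:
  assumes surj: "completion_map_surj A q p"
  shows "\<exists>K>0. \<forall>f\<in>carrier A. \<forall>\<rho>>0. p f \<le> \<rho> \<longrightarrow>
    (\<forall>\<eta>>0. \<exists>h\<in>carrier A. q h \<le> K * \<rho> \<and> p (sdiff A f h) < \<eta>)"
proof -
  obtain n :: nat and g \<epsilon> where \<epsilon>: "0 < \<epsilon>" and g: "g \<in> carrier A"
    and near: "\<And>f \<eta>. f \<in> carrier A \<Longrightarrow> p (sdiff A f g) < \<epsilon> \<Longrightarrow> 0 < \<eta> \<Longrightarrow>
       \<exists>h\<in>carrier A. q h \<le> n \<and> p (sdiff A f h) < \<eta>"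
    using ball_in_closure_of_bounded[OF surj] by blast
  \<comment> \<open>a ball about \<open>g\<close> translates to the origin at the cost of doubling the \<open>q\<close>-bound\<close>
  have near0: "\<exists>h\<in>carrier A. q h \<le> 2 * real n \<and> p (sdiff A f h) < \<eta>"
    if f: "f \<in> carrier A" "p f < \<epsilon>" and "0 < \<eta>" for f \<eta>
  proof -
    have "\<exists>h\<in>carrier A. q h \<le> n \<and> p (sdiff A (sadd A f g) h) < \<eta> / 2"
      using near[of "sadd A f g" "\<eta>/2"] that g by (simp add: add_diff_cancel)
    then obtain h where h: "h \<in> carrier A" "q h \<le> n" "p (sdiff A (sadd A f g) h) < \<eta> / 2" by blast
    have "\<exists>h'\<in>carrier A. q h' \<le> n \<and> p (sdiff A g h') < \<eta> / 2"
      using near[of g "\<eta>/2"] that g \<epsilon> by simp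
    then obtain h' where h': "h' \<in> carrier A" "q h' \<le> n" "p (sdiff A g h') < \<eta> / 2" by blast
    have eq: "sdiff A f (sdiff A h h') = sdiff A (sdiff A (sadd A f g) h) (sdiff A g h')"
      using f g h h' diff_add_add_cancel[of "sdiff A f h" g "sscale A (-1) h'"]
      by (simp add: sdiff_def scale_add_right scale_scale scale_one add_ac)
    have "p (sdiff A f (sdiff A h h')) < \<eta>"
      unfolding eq using p.p_diff_le[of "sdiff A (sadd A f g) h" "sdiff A g h'"] f g h h' by simp
    moreover have "q (sdiff A h h') \<le> 2 * real n"
      using q.p_diff_le[of h h'] h h' by simp
    ultimately show ?thesis using h h' by (intro bexI[of _ "sdiff A h h'"]) auto
  qed
  define K where "K = (2 * real n + 1) * (2 / \<epsilon>)"
  have "0 < K" using \<epsilon> by (simp add: K_def add_nonneg_pos)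
  moreover have "\<exists>h\<in>carrier A. q h \<le> K * \<rho> \<and> p (sdiff A f h) < \<eta>"
    if f: "f \<in> carrier A" "p f \<le> \<rho>" "0 < \<rho>" "0 < \<eta>" for f \<rho> \<eta>
  proof -
    define c where "c = \<epsilon> / (2 * \<rho>)"
    have c: "0 < c" using \<epsilon> f by (simp add: c_def)
    have "c * p f \<le> c * \<rho>" using f c by (intro mult_left_mono) auto
    also have "\<dots> < \<epsilon>" using f \<epsilon> by (simp add: c_def)
    finally have "p (sscale A (of_real c) f) < \<epsilon>"
      using f c by (simp add: p.p_scale)
    then obtain h where h: "h \<in> carrier A" "q h \<le> 2 * real n"
        "p (sdiff A (sscale A (of_real c) f) h) < \<eta> * c"
      using near0[of "sscale A (of_real c) f" "\<eta> * c"] f c by auto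
    define h' where "h' = sscale A (of_real (1 / c)) h"
    have h': "h' \<in> carrier A" using h by (simp add: h'_def)
    have "sdiff A (sscale A (of_real c) f) h = sscale A (of_real c) (sdiff A f h')"
      using h f c by (simp add: h'_def diff_scale[symmetric] scale_scale scale_one)
    then have "c * p (sdiff A f h') < c * \<eta>"
      using h c f h' by (simp add: p.p_scale mult.commute)
    then have "p (sdiff A f h') < \<eta>" using c by simp
    moreover have "q h' \<le> K * \<rho>"
    proof -
      have "q h' = (1 / c) * q h" using h c by (simp add: h'_def q.p_scale norm_divide)
      also have "\<dots> \<le> (1 / c) * (2 * real n + 1)"
        using h c by (intro mult_left_mono) auto
      also have "\<dots> = K * \<rho>" using \<epsilon> by (simp add: K_def c_def field_simps)
      finally show ?thesis .
    qed
    ultimately show ?thesis using h' by blast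
  qed
  ultimately show ?thesis by blast
qed

text \<open>Summing successive approximate lifts of what is left of \<open>x\<close> gives a \<open>q\<close>-convergent series
  whose sum must be \<open>x\<close> by injectivity. So the two seminorms are equivalent, and C*-seminorms that
  are equivalent are equal.\<close>

theorem seminorms_eq:
  assumes inj: "completion_map_inj A q p" and surj: "completion_map_surj A q p"
    and x: "x \<in> carrier A"
  shows "q x = p x"
proof -
  obtain K where K: "0 < K" and lift: "\<And>f \<rho> \<eta>. f \<in> carrier A \<Longrightarrow> 0 < \<rho> \<Longrightarrow> p f \<le> \<rho> \<Longrightarrow> 0 < \<eta> \<Longrightarrow>
      \<exists>h\<in>carrier A. q h \<le> K * \<rho> \<and> p (sdiff A f h) < \<eta>"
    using approximate_lift[OF surj] by blast
  have bound: "q f \<le> 2 * K * \<rho>" if f: "f \<in> carrier A" and \<rho>: "0 < \<rho>" "p f \<le> \<rho>" for f \<rho>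
  proof -
    \<comment> \<open>\<open>r n\<close> is the remainder after \<open>n\<close> steps\<close>
    define P where "P n r \<longleftrightarrow> r \<in> carrier A \<and> p r \<le> \<rho> * (1/2) ^ n \<and> (n = 0 \<longrightarrow> r = f)" for n r
    define Q where "Q n r r' \<longleftrightarrow> q (sdiff A r r') \<le> K * \<rho> * (1/2) ^ n" for n r r'
    have "\<exists>r. \<forall>n. P n (r n) \<and> Q n (r n) (r (Suc n))"
    proof (rule dependent_nat_choice)
      show "\<exists>r. P 0 r" using f \<rho> by (auto simp: P_def)
    next
      fix r n assume r: "P n r"
      then obtain h where h: "h \<in> carrier A" "q h \<le> K * (\<rho> * (1/2) ^ n)"
          "p (sdiff A r h) < \<rho> * (1/2) ^ Suc n"
        using lift[of r "\<rho> * (1/2) ^ n" "\<rho> * (1/2) ^ Suc n"] \<rho> by (auto simp: P_def)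
      have "sdiff A r (sdiff A r h) = h"
        using r h by (simp add: P_def diff_diff_cancel)
      then show "\<exists>r'. P (Suc n) r' \<and> Q n r r'"
        using r h by (intro exI[of _ "sdiff A r h"]) (auto simp: P_def Q_def mult.assoc)
    qed
    then obtain r where r: "\<And>n. P n (r n)" "\<And>n. Q n (r n) (r (Suc n))" by blast
    have rc: "r n \<in> carrier A" for n using r(1)[of n] by (simp add: P_def)
    have step: "q (sdiff A (r n) (r (n + k))) \<le> 2 * K * \<rho> * (1/2) ^ n - 2 * K * \<rho> * (1/2) ^ (n + k)" for n k
    proof (induction k)
      case 0
      then show ?case using rc by simp
    next
      case (Suc k)
      have "q (sdiff A (r n) (r (n + Suc k))) \<le>
          q (sdiff A (r n) (r (n + k))) + q (sdiff A (r (n + k)) (r (Suc (n + k))))"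
        using q.p_diff_triangle[OF rc rc rc] by simp
      then show ?case using Suc r(2)[of "n + k"] by (simp add: Q_def)
    qed
    have step': "q (sdiff A (r n) (r m)) \<le> 2 * K * \<rho> * (1/2) ^ n" if "n \<le> m" for n m
    proof -
      have "0 \<le> 2 * K * \<rho> * (1/2) ^ m" using K \<rho> by simp
      then show ?thesis using step[of n "m - n"] that by simp
    qed
    have "r \<in> cauchy_seqs A q"
      unfolding cauchy_seqs_def
    proof (intro CollectI conjI allI impI rc)
      fix e :: real assume "0 < e"
      then obtain k where k: "(1/2::real) ^ k < e / (2 * K * \<rho>)"
        using real_arch_pow_inv[of "e / (2 * K * \<rho>)" "1/2"] K \<rho> by auto
      have "q (sdiff A (r m) (r n)) < e" if "m \<ge> k" "n \<ge> k" for m n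
      proof -
        have *: "2 * K * \<rho> * (1/2) ^ min m n \<le> 2 * K * \<rho> * (1/2) ^ k"
          using K \<rho> that by (intro mult_left_mono power_decreasing) auto
        have "q (sdiff A (r m) (r n)) \<le> 2 * K * \<rho> * (1/2) ^ min m n"
          using step'[of m n] step'[of n m] q.p_diff_commute[OF rc[of m] rc[of n]]
          by (cases "m \<le> n") (auto simp: min_def)
        also note *
        also have "2 * K * \<rho> * (1/2) ^ k < e" using k K \<rho> by (simp add: field_simps)
        finally show ?thesis .
      qed
      then show "\<exists>k. \<forall>m\<ge>k. \<forall>n\<ge>k. q (sdiff A (r m) (r n)) < e" by blast
    qed
    moreover have "(\<lambda>n. p (r n)) \<longlonglongrightarrow> 0"
    proof (rule tendsto_sandwich[of "\<lambda>_. 0"])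
      show "(\<lambda>n. \<rho> * (1/2) ^ n) \<longlonglongrightarrow> 0"
        by (intro tendsto_mult_right_zero LIMSEQ_power_zero) simp
    qed (use r(1) rc in \<open>auto simp: P_def intro!: always_eventually\<close>)
    ultimately have lim: "(\<lambda>n. q (r n)) \<longlonglongrightarrow> 0"
      using inj unfolding completion_map_inj_def by blast
    have "q f \<le> q (r n) + 2 * K * \<rho>" for n
      using step'[of 0 n] r(1)[of 0] q.p_abs_diff[OF rc[of 0] rc[of n]] by (simp add: P_def)
    moreover have "(\<lambda>n. q (r n) + 2 * K * \<rho>) \<longlonglongrightarrow> 0 + 2 * K * \<rho>"
      by (intro tendsto_intros lim)
    ultimately show ?thesis by (intro LIMSEQ_le_const) auto
  qed
  have "q y \<le> 2 * K * p y" if y: "y \<in> carrier A" for y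
  proof (rule field_le_epsilon)
    fix e :: real assume e: "0 < e"
    have "q y \<le> 2 * K * (p y + e / (2 * K))"
      using e K y by (intro bound) (auto intro: add_nonneg_pos)
    also have "\<dots> = 2 * K * p y + e" using K by (simp add: field_simps)
    finally show "q y \<le> 2 * K * p y + e" .
  qed
  then have "q x \<le> p x"
    using cstar_seminorm_le_of_bounded[OF q_seminorm p_seminorm _ x] by blast
  then show ?thesis using p_le_q[OF x] by simp
qed

end

section \<open>Completions and their multipliers\<close>

context seminormed_star_algebra
begin

abbreviation "CS \<equiv> cauchy_seqs A p"
abbreviation "cls \<equiv> cauchy_class A p"
abbreviation "Comp \<equiv> completion A p"

lemma cauchy_seqs_carrier: "s \<in> CS \<Longrightarrow> s n \<in> carrier A"
  by (simp add: cauchy_seqs_def)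

lemma cauchy_seqsD:
  "s \<in> CS \<Longrightarrow> 0 < e \<Longrightarrow> \<exists>K. \<forall>m\<ge>K. \<forall>n\<ge>K. p (sdiff A (s m) (s n)) < e"
  by (simp add: cauchy_seqs_def)

lemma const_in_cauchy_seqs: "x \<in> carrier A \<Longrightarrow> (\<lambda>_. x) \<in> CS"
  by (auto simp: cauchy_seqs_def)

text \<open>Every operation of the algebra takes Cauchy sequences to Cauchy sequences because, on bounded sets,
  differences of its results are controlled linearly by the differences of its arguments.\<close>

lemma cauchy_seqsI2:
  assumes s: "s \<in> CS" and t: "t \<in> CS" and u: "\<And>n. u n \<in> carrier A"
    and a: "0 \<le> a" and le: "\<And>m n. p (sdiff A (u m) (u n)) \<le> a * (p (sdiff A (s m) (s n)) + p (sdiff A (t m) (t n)))"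
  shows "u \<in> CS"
  unfolding cauchy_seqs_def
proof (intro CollectI conjI allI impI u)
  fix e :: real assume e: "0 < e"
  define d where "d = e / (2 * (a + 1))"
  have d: "0 < d" using e a by (simp add: d_def)
  obtain K1 where K1: "\<forall>m\<ge>K1. \<forall>n\<ge>K1. p (sdiff A (s m) (s n)) < d" using cauchy_seqsD[OF s d] by blast
  obtain K2 where K2: "\<forall>m\<ge>K2. \<forall>n\<ge>K2. p (sdiff A (t m) (t n)) < d" using cauchy_seqsD[OF t d] by blast
  have "p (sdiff A (u m) (u n)) < e" if "m \<ge> max K1 K2" "n \<ge> max K1 K2" for m n
  proof -
    have "p (sdiff A (s m) (s n)) + p (sdiff A (t m) (t n)) \<le> 2 * d"
      using K1 K2 that by (smt (verit, best) max.bounded_iff)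
    then have "a * (p (sdiff A (s m) (s n)) + p (sdiff A (t m) (t n))) \<le> a * (2 * d)"
      using a by (rule mult_left_mono)
    also have "\<dots> < (a + 1) * (2 * d)" using d by simp
    also have "\<dots> = e" using a by (simp add: d_def field_simps)
    finally show ?thesis using le[of m n] by simp
  qed
  then show "\<exists>K. \<forall>m\<ge>K. \<forall>n\<ge>K. p (sdiff A (u m) (u n)) < e" by blast
qed

lemma cauchy_seqs_add:
  assumes "s \<in> CS" "t \<in> CS"
  shows "(\<lambda>n. sadd A (s n) (t n)) \<in> CS"
  by (rule cauchy_seqsI2[OF assms, of _ 1])
    (use assms in \<open>auto simp: cauchy_seqs_carrier intro!: p_diff_add\<close>)

lemma cauchy_seqs_scale:
  assumes "s \<in> CS"
  shows "(\<lambda>n. sscale A c (s n)) \<in> CS"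
  by (rule cauchy_seqsI2[OF assms assms, of _ "cmod c"])
    (use assms in \<open>auto simp: cauchy_seqs_carrier diff_scale p_scale intro!: mult_left_mono\<close>)

lemma cauchy_seqs_star:
  assumes "s \<in> CS"
  shows "(\<lambda>n. sstar A (s n)) \<in> CS"
  by (rule cauchy_seqsI2[OF assms assms, of _ 1])
    (use assms in \<open>auto simp: cauchy_seqs_carrier p_diff_star\<close>)

lemma cauchy_seqs_mult:
  assumes s: "s \<in> CS" and t: "t \<in> CS"
  shows "(\<lambda>n. smult A (s n) (t n)) \<in> CS"
proof -
  obtain a b :: nat where a: "\<And>n. p (s n) \<le> a" and b: "\<And>n. p (t n) \<le> b"
    using cauchy_seq_bounded[OF s] cauchy_seq_bounded[OF t] by blast
  show ?thesis
  proof (rule cauchy_seqsI2[OF s t, of _ "real (a + b)"])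
    fix m n
    have "p (sdiff A (smult A (s m) (t m)) (smult A (s n) (t n)))
        \<le> p (sdiff A (s m) (s n)) * p (t m) + p (s n) * p (sdiff A (t m) (t n))"
      using s t by (intro p_diff_mult) (auto simp: cauchy_seqs_carrier)
    also have "\<dots> \<le> p (sdiff A (s m) (s n)) * (real (a + b)) + real (a + b) * p (sdiff A (t m) (t n))"
      using a[of n] b[of m] s t
      by (intro add_mono mult_left_mono mult_right_mono) (auto simp: cauchy_seqs_carrier)
    finally show "p (sdiff A (smult A (s m) (t m)) (smult A (s n) (t n)))
        \<le> real (a + b) * (p (sdiff A (s m) (s n)) + p (sdiff A (t m) (t n)))"
      by (simp add: algebra_simps)
  qed (use s t in \<open>auto simp: cauchy_seqs_carrier\<close>)
qed

lemma equiv_cauchy_rel: "equiv CS (cauchy_rel A p)"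
proof (rule equivI)
  show "cauchy_rel A p \<subseteq> CS \<times> CS" by (auto simp: cauchy_rel_def)
  show "refl_on CS (cauchy_rel A p)"
    by (auto simp: refl_on_def cauchy_rel_def cauchy_seqs_carrier)
  show "sym (cauchy_rel A p)"
  proof (rule symI)
    fix s t assume "(s, t) \<in> cauchy_rel A p"
    then have "s \<in> CS" "t \<in> CS" "(\<lambda>n. p (sdiff A (s n) (t n))) \<longlonglongrightarrow> 0"
      by (auto simp: cauchy_rel_def)
    moreover have "p (sdiff A (s n) (t n)) = p (sdiff A (t n) (s n))" for n
      using calculation by (intro p_diff_commute) (simp_all add: cauchy_seqs_carrier)
    ultimately show "(t, s) \<in> cauchy_rel A p" by (simp add: cauchy_rel_def)
  qed
  show "trans (cauchy_rel A p)"
  proof (rule transI)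
    fix s t u assume st: "(s, t) \<in> cauchy_rel A p" and tu: "(t, u) \<in> cauchy_rel A p"
    then have C: "s \<in> CS" "t \<in> CS" "u \<in> CS" by (auto simp: cauchy_rel_def)
    let ?b = "\<lambda>n. p (sdiff A (s n) (t n)) + p (sdiff A (t n) (u n))"
    have "?b \<longlonglongrightarrow> 0 + 0"
      using st tu by (intro tendsto_add) (simp_all add: cauchy_rel_def)
    then have "?b \<longlonglongrightarrow> 0" by simp
    moreover have "0 \<le> p (sdiff A (s n) (u n))" "p (sdiff A (s n) (u n)) \<le> ?b n" for n
      using C by (simp_all add: cauchy_seqs_carrier p_diff_triangle)
    ultimately have "(\<lambda>n. p (sdiff A (s n) (u n))) \<longlonglongrightarrow> 0"
      by (rule null_seq_le)
    then show "(s, u) \<in> cauchy_rel A p" using st tu by (auto simp: cauchy_rel_def)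
  qed
qed

lemma mem_cauchy_class:
  "s \<in> CS \<Longrightarrow> t \<in> cls s \<longleftrightarrow> t \<in> CS \<and> (\<lambda>n. p (sdiff A (s n) (t n))) \<longlonglongrightarrow> 0"
  by (auto simp: cauchy_class_def cauchy_rel_def)

lemma cauchy_class_eq_iff:
  "s \<in> CS \<Longrightarrow> t \<in> CS \<Longrightarrow> cls s = cls t \<longleftrightarrow> (\<lambda>n. p (sdiff A (s n) (t n))) \<longlonglongrightarrow> 0"
  unfolding cauchy_class_def
  by (subst eq_equiv_class_iff[OF equiv_cauchy_rel]) (auto simp: cauchy_rel_def)

lemma cauchy_class_closed: "s \<in> CS \<Longrightarrow> cls s \<in> carrier Comp"
  by (auto simp: completion_def cauchy_class_def intro: quotientI)

lemma completion_cases: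
  assumes "X \<in> carrier Comp"
  obtains s where "s \<in> CS" "X = cls s"
  using assms by (auto simp: completion_def cauchy_class_def elim: quotientE)

lemma completion_add:
  assumes "s \<in> CS" "t \<in> CS"
  shows "sadd Comp (cls s) (cls t) = cls (\<lambda>n. sadd A (s n) (t n))"
proof -
  have "congruent2 (cauchy_rel A p) (cauchy_rel A p) (\<lambda>s t. cls (\<lambda>n. sadd A (s n) (t n)))"
  proof (rule congruent2I')
    fix s s' t t' assume *: "(s, s') \<in> cauchy_rel A p" "(t, t') \<in> cauchy_rel A p"
    then have "(\<lambda>n. p (sdiff A (s n) (s' n)) + p (sdiff A (t n) (t' n))) \<longlonglongrightarrow> 0 + 0"
      by (intro tendsto_add) (auto simp: cauchy_rel_def)
    then show "cls (\<lambda>n. sadd A (s n) (t n)) = cls (\<lambda>n. sadd A (s' n) (t' n))"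
      using * by (subst cauchy_class_eq_iff)
        (auto simp: cauchy_rel_def cauchy_seqs_add cauchy_seqs_carrier p_diff_add
          intro: null_seq_le[of "\<lambda>n. p (sdiff A (s n) (s' n)) + p (sdiff A (t n) (t' n))"])
  qed
  from UN_equiv_class2[OF equiv_cauchy_rel equiv_cauchy_rel this assms] show ?thesis
    by (simp add: completion_def cauchy_class_def)
qed

lemma completion_mult:
  assumes "s \<in> CS" "t \<in> CS"
  shows "smult Comp (cls s) (cls t) = cls (\<lambda>n. smult A (s n) (t n))"
proof -
  have "congruent2 (cauchy_rel A p) (cauchy_rel A p) (\<lambda>s t. cls (\<lambda>n. smult A (s n) (t n)))"
  proof (rule congruent2I')
    fix s s' t t' assume *: "(s, s') \<in> cauchy_rel A p" "(t, t') \<in> cauchy_rel A p"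
    then have C: "s \<in> CS" "s' \<in> CS" "t \<in> CS" "t' \<in> CS" by (auto simp: cauchy_rel_def)
    obtain a b :: nat where a: "\<And>n. p (s' n) \<le> a" and b: "\<And>n. p (t n) \<le> b"
      using cauchy_seq_bounded[OF C(2)] cauchy_seq_bounded[OF C(3)] by blast
    let ?b = "\<lambda>n. p (sdiff A (s n) (s' n)) * real b + real a * p (sdiff A (t n) (t' n))"
    have lim: "?b \<longlonglongrightarrow> 0 * real b + real a * 0"
      using * by (intro tendsto_intros) (auto simp: cauchy_rel_def)
    have le: "p (sdiff A (smult A (s n) (t n)) (smult A (s' n) (t' n))) \<le> ?b n" for n
    proof -
      have "p (sdiff A (smult A (s n) (t n)) (smult A (s' n) (t' n)))
        \<le> p (sdiff A (s n) (s' n)) * p (t n) + p (s' n) * p (sdiff A (t n) (t' n))"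
        using C by (intro p_diff_mult) (auto simp: cauchy_seqs_carrier)
      also have "\<dots> \<le> ?b n"
        using a[of n] b[of n] C
        by (intro add_mono mult_left_mono mult_right_mono) (auto simp: cauchy_seqs_carrier)
      finally show ?thesis .
    qed
    have "(\<lambda>n. p (sdiff A (smult A (s n) (t n)) (smult A (s' n) (t' n)))) \<longlonglongrightarrow> 0"
      by (rule null_seq_le[of ?b]) (use lim le C in \<open>auto simp: cauchy_seqs_carrier\<close>)
    then show "cls (\<lambda>n. smult A (s n) (t n)) = cls (\<lambda>n. smult A (s' n) (t' n))"
      using C by (subst cauchy_class_eq_iff) (auto simp: cauchy_seqs_mult)
  qed
  from UN_equiv_class2[OF equiv_cauchy_rel equiv_cauchy_rel this assms] show ?thesis
    by (simp add: completion_def cauchy_class_def)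
qed

lemma completion_scale:
  assumes "s \<in> CS"
  shows "sscale Comp c (cls s) = cls (\<lambda>n. sscale A c (s n))"
proof -
  have "congruent (cauchy_rel A p) (\<lambda>s. cls (\<lambda>n. sscale A c (s n)))"
  proof (rule congruentI)
    fix s s' assume *: "(s, s') \<in> cauchy_rel A p"
    then have C: "s \<in> CS" "s' \<in> CS" and "(\<lambda>n. cmod c * p (sdiff A (s n) (s' n))) \<longlonglongrightarrow> 0"
      by (auto simp: cauchy_rel_def intro: tendsto_mult_right_zero)
    then show "cls (\<lambda>n. sscale A c (s n)) = cls (\<lambda>n. sscale A c (s' n))"
      by (subst cauchy_class_eq_iff)
        (auto simp: cauchy_seqs_scale cauchy_seqs_carrier diff_scale p_scale)
  qed
  from UN_equiv_class[OF equiv_cauchy_rel this assms] show ?thesis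
    by (simp add: completion_def cauchy_class_def)
qed

lemma completion_star:
  assumes "s \<in> CS"
  shows "sstar Comp (cls s) = cls (\<lambda>n. sstar A (s n))"
proof -
  have "congruent (cauchy_rel A p) (\<lambda>s. cls (\<lambda>n. sstar A (s n)))"
  proof (rule congruentI)
    fix s s' assume *: "(s, s') \<in> cauchy_rel A p"
    then show "cls (\<lambda>n. sstar A (s n)) = cls (\<lambda>n. sstar A (s' n))"
      by (subst cauchy_class_eq_iff)
        (auto simp: cauchy_rel_def cauchy_seqs_star cauchy_seqs_carrier p_diff_star)
  qed
  from UN_equiv_class[OF equiv_cauchy_rel this assms] show ?thesis
    by (simp add: completion_def cauchy_class_def)
qed

text \<open>The embedding of \<open>A\<close> into the multiplier algebra of its completion.\<close>

definition left_mult :: "'a \<Rightarrow> (nat \<Rightarrow> 'a) set \<Rightarrow> (nat \<Rightarrow> 'a) set" where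
  "left_mult x = (\<lambda>X\<in>carrier Comp. smult Comp (cls (\<lambda>_. x)) X)"

lemma left_mult_class:
  "x \<in> carrier A \<Longrightarrow> s \<in> CS \<Longrightarrow> left_mult x (cls s) = cls (\<lambda>n. smult A x (s n))"
  by (simp add: left_mult_def cauchy_class_closed completion_mult const_in_cauchy_seqs)

lemma cauchy_seqs_left_mult:
  "x \<in> carrier A \<Longrightarrow> s \<in> CS \<Longrightarrow> (\<lambda>n. smult A x (s n)) \<in> CS"
  using cauchy_seqs_mult[OF const_in_cauchy_seqs] .

lemma left_mult_funcset: "x \<in> carrier A \<Longrightarrow> left_mult x \<in> carrier Comp \<rightarrow>\<^sub>E carrier Comp"
proof (rule PiE_I)
  fix X assume x: "x \<in> carrier A" and "X \<in> carrier Comp"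
  then obtain s where "s \<in> CS" "X = cls s" by (rule_tac completion_cases)
  then show "left_mult x X \<in> carrier Comp"
    using x by (simp add: left_mult_class cauchy_seqs_left_mult cauchy_class_closed)
qed (simp add: left_mult_def)

lemma left_mult_ext:
  assumes "x \<in> carrier A" "T \<in> carrier Comp \<rightarrow>\<^sub>E carrier Comp"
    and "\<And>s. s \<in> CS \<Longrightarrow> T (cls s) = cls (\<lambda>n. smult A x (s n))"
  shows "T = left_mult x"
proof (rule PiE_ext[OF assms(2) left_mult_funcset[OF assms(1)]])
  fix X assume "X \<in> carrier Comp"
  then show "T X = left_mult x X"
    by (rule completion_cases) (use assms in \<open>auto simp: left_mult_class\<close>)
qed

lemma adjoint_left_mult:
  assumes "x \<in> carrier A"
  shows "adjoint_on Comp (left_mult x) (left_mult (sstar A x))"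
  unfolding adjoint_on_def
proof (intro ballI)
  fix X Y assume "X \<in> carrier Comp" "Y \<in> carrier Comp"
  then obtain s t where st: "s \<in> CS" "X = cls s" "t \<in> CS" "Y = cls t"
    by (meson completion_cases)
  then show "smult Comp (sstar Comp (left_mult x X)) Y
      = smult Comp (sstar Comp X) (left_mult (sstar A x) Y)"
    using assms
    by (simp add: left_mult_class completion_star completion_mult cauchy_seqs_left_mult
        cauchy_seqs_mult const_in_cauchy_seqs cauchy_seqs_star star_mult mult_assoc
        cauchy_seqs_carrier)
qed

text \<open>The inner product of the Hilbert module is definite, so adjoints are unique.\<close>

lemma adjoint_unique:
  assumes S: "S \<in> carrier Comp \<rightarrow>\<^sub>E carrier Comp" "adjoint_on Comp T S"
    and S': "S' \<in> carrier Comp \<rightarrow>\<^sub>E carrier Comp" "adjoint_on Comp T S'"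
  shows "S = S'"
proof (rule PiE_ext[OF S(1) S'(1)])
  fix X assume X: "X \<in> carrier Comp"
  obtain s where s: "s \<in> CS" "S X = cls s"
    using PiE_mem[OF S(1) X] by (rule completion_cases)
  obtain t where t: "t \<in> CS" "S' X = cls t"
    using PiE_mem[OF S'(1) X] by (rule completion_cases)
  define u where "u n = sdiff A (s n) (t n)" for n
  have uc: "u n \<in> carrier A" for n using s t by (simp add: u_def cauchy_seqs_carrier)
  have u: "u \<in> CS"
    using cauchy_seqs_add[OF s(1) cauchy_seqs_scale[OF t(1), of "-1"]]
    by (simp add: u_def[abs_def] sdiff_def)
  have "smult Comp (sstar Comp (cls u)) (S X) = smult Comp (sstar Comp (cls u)) (S' X)"
    using S(2) S'(2) X cauchy_class_closed[OF u] by (metis adjoint_on_def)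
  then have "cls (\<lambda>n. smult A (sstar A (u n)) (s n)) = cls (\<lambda>n. smult A (sstar A (u n)) (t n))"
    using s t u by (simp add: completion_star completion_mult cauchy_seqs_star)
  then have "(\<lambda>n. p (sdiff A (smult A (sstar A (u n)) (s n)) (smult A (sstar A (u n)) (t n)))) \<longlonglongrightarrow> 0"
    using s t u by (simp add: cauchy_class_eq_iff cauchy_seqs_mult cauchy_seqs_star)
  then have "(\<lambda>n. (p (u n))\<^sup>2) \<longlonglongrightarrow> 0"
    using s t uc by (simp add: diff_mult_right[symmetric] u_def[symmetric] p_star_mult cauchy_seqs_carrier)
  then have "(\<lambda>n. sqrt ((p (u n))\<^sup>2)) \<longlonglongrightarrow> sqrt 0"
    by (rule tendsto_real_sqrt)
  then have "(\<lambda>n. p (u n)) \<longlonglongrightarrow> 0" using uc by simp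
  then show "S X = S' X"
    using s t by (simp add: cauchy_class_eq_iff u_def)
qed

lemma multiplier_star_left_mult:
  assumes "x \<in> carrier A"
  shows "sstar (multiplier_alg Comp) (left_mult x) = left_mult (sstar A x)"
  unfolding multiplier_alg_def star_alg.simps
  by (rule the_equality)
    (use assms in \<open>auto simp: adjoint_left_mult left_mult_funcset simp del: PiE_iff
      intro: adjoint_unique[OF _ _ left_mult_funcset[OF star_closed] adjoint_left_mult]\<close>)

lemma multiplier_add_left_mult:
  assumes "x \<in> carrier A" "y \<in> carrier A"
  shows "sadd (multiplier_alg Comp) (left_mult x) (left_mult y) = left_mult (sadd A x y)"
proof (rule left_mult_ext)
  have eq: "sadd Comp (left_mult x (cls s)) (left_mult y (cls s)) = cls (\<lambda>n. smult A (sadd A x y) (s n))"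
    and mem: "(\<lambda>n. smult A (sadd A x y) (s n)) \<in> CS"
    if "s \<in> CS" for s
    using that assms
    by (simp_all add: left_mult_class completion_add cauchy_seqs_left_mult mult_add_left cauchy_seqs_carrier
          flip: mult_add_left)
  show "sadd (multiplier_alg Comp) (left_mult x) (left_mult y) (cls s) = cls (\<lambda>n. smult A (sadd A x y) (s n))"
    if "s \<in> CS" for s
    using that eq by (simp add: multiplier_alg_def cauchy_class_closed)
  show "sadd (multiplier_alg Comp) (left_mult x) (left_mult y) \<in> carrier Comp \<rightarrow>\<^sub>E carrier Comp"
    by (auto simp: multiplier_alg_def eq mem cauchy_class_closed elim: completion_cases)
qed (use assms in simp)

lemma multiplier_mult_left_mult:
  assumes "x \<in> carrier A" "y \<in> carrier A"
  shows "smult (multiplier_alg Comp) (left_mult x) (left_mult y) = left_mult (smult A x y)"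
proof (rule left_mult_ext)
  have eq: "left_mult x (left_mult y (cls s)) = cls (\<lambda>n. smult A (smult A x y) (s n))"
    and mem: "(\<lambda>n. smult A (smult A x y) (s n)) \<in> CS"
    if "s \<in> CS" for s
    using that assms
    by (simp_all add: left_mult_class cauchy_seqs_left_mult mult_assoc cauchy_seqs_carrier
        flip: mult_assoc)
  show "smult (multiplier_alg Comp) (left_mult x) (left_mult y) (cls s) = cls (\<lambda>n. smult A (smult A x y) (s n))"
    if "s \<in> CS" for s
    using that eq by (simp add: multiplier_alg_def cauchy_class_closed)
  show "smult (multiplier_alg Comp) (left_mult x) (left_mult y) \<in> carrier Comp \<rightarrow>\<^sub>E carrier Comp"
    by (auto simp: multiplier_alg_def eq mem cauchy_class_closed elim: completion_cases)
qed (use assms in simp)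

lemma multiplier_scale_left_mult:
  assumes "x \<in> carrier A"
  shows "sscale (multiplier_alg Comp) c (left_mult x) = left_mult (sscale A c x)"
proof (rule left_mult_ext)
  have eq: "sscale Comp c (left_mult x (cls s)) = cls (\<lambda>n. smult A (sscale A c x) (s n))"
    and mem: "(\<lambda>n. smult A (sscale A c x) (s n)) \<in> CS"
    if "s \<in> CS" for s
    using that assms
    by (simp_all add: left_mult_class completion_scale cauchy_seqs_left_mult mult_scale_left cauchy_seqs_carrier
        flip: mult_scale_left)
  show "sscale (multiplier_alg Comp) c (left_mult x) (cls s) = cls (\<lambda>n. smult A (sscale A c x) (s n))"
    if "s \<in> CS" for s
    using that eq by (simp add: multiplier_alg_def cauchy_class_closed)
  show "sscale (multiplier_alg Comp) c (left_mult x) \<in> carrier Comp \<rightarrow>\<^sub>E carrier Comp"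
    by (auto simp: multiplier_alg_def eq mem cauchy_class_closed elim: completion_cases)
qed (use assms in simp)

text \<open>Both multiplications agree on \<open>(x - y)*\<close>, so \<open>(x - y) (x - y)*\<close> has seminorm \<open>0\<close>.\<close>

lemma left_mult_eqD:
  assumes x: "x \<in> carrier A" and y: "y \<in> carrier A" and eq: "left_mult x = left_mult y"
  shows "p (sdiff A x y) = 0"
proof -
  define z where "z = sstar A (sdiff A x y)"
  have z: "z \<in> carrier A" using x y by (simp add: z_def)
  have "cls (\<lambda>_. smult A x z) = cls (\<lambda>_. smult A y z)"
    using left_mult_class[OF x const_in_cauchy_seqs[OF z]]
      left_mult_class[OF y const_in_cauchy_seqs[OF z]] eq by simp
  then have "(\<lambda>_::nat. p (sdiff A (smult A x z) (smult A y z))) \<longlonglongrightarrow> 0"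
    using x y z by (simp add: cauchy_class_eq_iff const_in_cauchy_seqs)
  then have "p (sdiff A (smult A x z) (smult A y z)) = 0"
    by (simp add: LIMSEQ_const_iff)
  then have "p (smult A (sstar A z) z) = 0"
    using x y by (simp add: z_def diff_mult_left[symmetric] star_star)
  then show ?thesis using z x y by (simp add: p_star_mult) (simp add: z_def p_star)
qed

lemma star_iso_left_mult:
  assumes S: "S \<subseteq> carrier A"
    and add: "\<And>x y. x \<in> S \<Longrightarrow> y \<in> S \<Longrightarrow> sadd A x y \<in> S"
    and scale: "\<And>c x. x \<in> S \<Longrightarrow> sscale A c x \<in> S"
    and faithful: "\<And>x. x \<in> S \<Longrightarrow> p x = 0 \<Longrightarrow> x = sscale A 0 x"
  shows "star_iso (A\<lparr>carrier := S\<rparr>) (multiplier_alg Comp \<lparr>carrier := left_mult ` S\<rparr>) left_mult"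
proof -
  have "inj_on left_mult S"
  proof (rule inj_onI)
    fix x y assume xy: "x \<in> S" "y \<in> S" "left_mult x = left_mult y"
    then have c: "x \<in> carrier A" "y \<in> carrier A" using S by auto
    have "sdiff A x y \<in> S" unfolding sdiff_def by (intro add scale xy)
    then have "sdiff A x y = sscale A 0 (sdiff A x y)"
      using left_mult_eqD[OF c xy(3)] faithful by blast
    then show "x = y"
      using c by (metis add_comm add_zero diff_add_cancel diff_closed scale_closed)
  qed
  then show ?thesis
    unfolding star_iso_def bij_betw_def
    using S by (auto simp: multiplier_star_left_mult multiplier_add_left_mult subset_iff
        multiplier_mult_left_mult multiplier_scale_left_mult)
qed

end

lemma cstar_norm_star_iso:
  assumes A: "star_algebra A" and h: "star_iso A B h"
  shows "cstar_norm B p \<longleftrightarrow> cstar_norm A (\<lambda>x. p (h x))"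
proof -
  interpret star_algebra A by (rule A)
  have B: "carrier B = h ` carrier A" and inj: "inj_on h (carrier A)"
    using h by (auto simp: star_iso_def bij_betw_def)
  have ops: "\<And>x y. x \<in> carrier A \<Longrightarrow> y \<in> carrier A \<Longrightarrow> h (sadd A x y) = sadd B (h x) (h y)"
    "\<And>x y. x \<in> carrier A \<Longrightarrow> y \<in> carrier A \<Longrightarrow> h (smult A x y) = smult B (h x) (h y)"
    "\<And>x c. x \<in> carrier A \<Longrightarrow> h (sscale A c x) = sscale B c (h x)"
    "\<And>x. x \<in> carrier A \<Longrightarrow> h (sstar A x) = sstar B (h x)"
    using h by (auto simp: star_iso_def)
  have "x = sscale A 0 x \<longleftrightarrow> h x = sscale B 0 (h x)" if "x \<in> carrier A" for x
    using inj_on_eq_iff[OF inj that scale_closed[OF that, of 0]] ops(3)[OF that, of 0] by simp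
  then show ?thesis
    unfolding cstar_norm_def cstar_seminorm_def B by (simp add: ops[symmetric])
qed

lemma cstar_norm_cong:
  assumes "star_algebra A" and eq: "\<And>x. x \<in> carrier A \<Longrightarrow> p x = p' x"
  shows "cstar_norm A p \<longleftrightarrow> cstar_norm A p'"
proof -
  interpret star_algebra A by (rule assms)
  show ?thesis unfolding cstar_norm_def cstar_seminorm_def by (simp add: eq)
qed

lemma ex1_cstar_norm_star_iso:
  assumes A: "star_algebra A" and h: "star_iso A B h"
    and ex: "cstar_norm A p0"
    and uniq: "\<And>p x. cstar_norm A p \<Longrightarrow> x \<in> carrier A \<Longrightarrow> p x = p0 x"
  shows "\<exists>!p. p \<in> extensional (carrier B) \<and> cstar_norm B p"
proof -
  have B: "carrier B = h ` carrier A" and inj: "inj_on h (carrier A)"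
    using h by (auto simp: star_iso_def bij_betw_def)
  define p1 where "p1 = restrict (\<lambda>y. p0 (inv_into (carrier A) h y)) (carrier B)"
  have p1: "p1 (h x) = p0 x" if "x \<in> carrier A" for x
    using that inj by (simp add: p1_def B)
  show ?thesis
  proof (rule ex1I[of _ p1])
    have "cstar_norm A (\<lambda>x. p1 (h x))"
      using ex cstar_norm_cong[OF A, of "\<lambda>x. p1 (h x)" p0] p1 by simp
    then show "p1 \<in> extensional (carrier B) \<and> cstar_norm B p1"
      using cstar_norm_star_iso[OF A h] by (simp add: p1_def)
  next
    fix p assume p: "p \<in> extensional (carrier B) \<and> cstar_norm B p"
    then have "cstar_norm A (\<lambda>x. p (h x))" using cstar_norm_star_iso[OF A h] by simp
    then have "p (h x) = p1 (h x)" if "x \<in> carrier A" for x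
      using uniq[of "\<lambda>x. p (h x)"] that p1 by simp
    then show "p = p1"
      using p by (intro extensionalityI[of _ "carrier B"]) (auto simp: p1_def B)
  qed
qed

section \<open>The Hilbert space \<open>\<ell>\<^sup>2\<close> and its bounded operators\<close>

text \<open>Membership in \<open>\<ell>\<^sup>2\<close> and norm estimates are reduced to finite sets of coordinates, where the
  inequalities for finite sums apply.\<close>

lemma ell2_boundI:
  assumes "\<And>i. i \<notin> I \<Longrightarrow> \<xi> i = 0"
    and le: "\<And>F. finite F \<Longrightarrow> F \<subseteq> I \<Longrightarrow> L2_set (\<lambda>i. cmod (\<xi> i)) F \<le> K"
  shows "\<xi> \<in> ell2 I" and "ell2_norm I \<xi> \<le> K"
proof -
  have K: "0 \<le> K" using le[of "{}"] by simp
  have sq: "(\<Sum>i\<in>F. (cmod (\<xi> i))\<^sup>2) \<le> K\<^sup>2" if "finite F" "F \<subseteq> I" for F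
    using le[OF that] sqrt_le_D[of "\<Sum>i\<in>F. (cmod (\<xi> i))\<^sup>2" K] by (simp add: L2_set_def)
  then have s: "(\<lambda>i. (cmod (\<xi> i))\<^sup>2) summable_on I"
    by (intro nonneg_bdd_above_summable_on bdd_aboveI2[of _ _ "K\<^sup>2"]) auto
  then show "\<xi> \<in> ell2 I" using assms by (simp add: ell2_def)
  have "(\<Sum>\<^sub>\<infinity>i\<in>I. (cmod (\<xi> i))\<^sup>2) \<le> K\<^sup>2"
    using s sq by (rule infsum_le_finite_sums)
  from real_sqrt_le_mono[OF this] show "ell2_norm I \<xi> \<le> K"
    using K by (simp add: ell2_norm_def)
qed

lemma L2_set_le_ell2_norm:
  assumes "\<xi> \<in> ell2 I" "finite F" "F \<subseteq> I"
  shows "L2_set (\<lambda>i. cmod (\<xi> i)) F \<le> ell2_norm I \<xi>"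
  using assms by (auto simp: ell2_def ell2_norm_def L2_set_def intro!: finite_sum_le_infsum)

lemma ell2_vanish: "\<xi> \<in> ell2 I \<Longrightarrow> i \<notin> I \<Longrightarrow> \<xi> i = 0"
  by (simp add: ell2_def)

lemma ell2_norm_nonneg [simp]: "0 \<le> ell2_norm I \<xi>"
  by (simp add: ell2_norm_def infsum_nonneg)

lemma cmod_le_ell2_norm: "\<xi> \<in> ell2 I \<Longrightarrow> cmod (\<xi> i) \<le> ell2_norm I \<xi>"
  using L2_set_le_ell2_norm[of \<xi> I "{i}"] ell2_vanish[of \<xi> I i] by (cases "i \<in> I") auto

lemma
  assumes "\<xi> \<in> ell2 I" "\<eta> \<in> ell2 I"
  shows ell2_add: "(\<lambda>i. \<xi> i + \<eta> i) \<in> ell2 I"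
    and ell2_norm_add: "ell2_norm I (\<lambda>i. \<xi> i + \<eta> i) \<le> ell2_norm I \<xi> + ell2_norm I \<eta>"
proof -
  have *: "L2_set (\<lambda>i. cmod (\<xi> i + \<eta> i)) F \<le> ell2_norm I \<xi> + ell2_norm I \<eta>"
    if "finite F" "F \<subseteq> I" for F
  proof -
    have "L2_set (\<lambda>i. cmod (\<xi> i + \<eta> i)) F \<le> L2_set (\<lambda>i. cmod (\<xi> i) + cmod (\<eta> i)) F"
      by (intro L2_set_mono norm_triangle_ineq) simp
    also have "\<dots> \<le> L2_set (\<lambda>i. cmod (\<xi> i)) F + L2_set (\<lambda>i. cmod (\<eta> i)) F"
      by (rule L2_set_triangle_ineq)
    also have "\<dots> \<le> ell2_norm I \<xi> + ell2_norm I \<eta>"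
      by (intro add_mono L2_set_le_ell2_norm assms that)
    finally show ?thesis .
  qed
  show "(\<lambda>i. \<xi> i + \<eta> i) \<in> ell2 I" "ell2_norm I (\<lambda>i. \<xi> i + \<eta> i) \<le> ell2_norm I \<xi> + ell2_norm I \<eta>"
    using ell2_boundI[of I "\<lambda>i. \<xi> i + \<eta> i", OF _ *] assms by (auto simp: ell2_vanish)
qed

lemma ell2_norm_scale: "ell2_norm I (\<lambda>i. c * \<xi> i) = cmod c * ell2_norm I \<xi>"
  unfolding ell2_norm_def norm_mult power_mult_distrib infsum_cmult_right' real_sqrt_mult by simp

lemma ell2_scale: "\<xi> \<in> ell2 I \<Longrightarrow> (\<lambda>i. c * \<xi> i) \<in> ell2 I"
  using summable_on_cmult_right[of "\<lambda>i. (cmod (\<xi> i))\<^sup>2" I "(cmod c)\<^sup>2"]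
  by (simp add: ell2_def norm_mult power_mult_distrib)

lemma ell2_sum:
  assumes "finite F" "\<And>t. t \<in> F \<Longrightarrow> \<xi> t \<in> ell2 I"
  shows "(\<lambda>i. \<Sum>t\<in>F. \<xi> t i) \<in> ell2 I \<and>
    ell2_norm I (\<lambda>i. \<Sum>t\<in>F. \<xi> t i) \<le> (\<Sum>t\<in>F. ell2_norm I (\<xi> t))"
  using assms
proof (induction F)
  case empty
  show ?case by (simp add: ell2_def ell2_norm_def)
next
  case (insert t F)
  then show ?case
    using ell2_add[of "\<xi> t" I "\<lambda>i. \<Sum>t\<in>F. \<xi> t i"] ell2_norm_add[of "\<xi> t" I "\<lambda>i. \<Sum>t\<in>F. \<xi> t i"]
    by simp
qed

lemma ell2_diff: "\<xi> \<in> ell2 I \<Longrightarrow> \<eta> \<in> ell2 I \<Longrightarrow> (\<lambda>i. \<xi> i - \<eta> i) \<in> ell2 I"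
  using ell2_add[OF _ ell2_scale[of \<eta> I "-1"]] by simp

subsection \<open>Finitely supported vectors\<close>

definition fin_supp :: "'i set \<Rightarrow> ('i \<Rightarrow> complex) set" where
  "fin_supp I = {\<xi>. (\<forall>i. i \<notin> I \<longrightarrow> \<xi> i = 0) \<and> finite {i. \<xi> i \<noteq> 0}}"

lemma fin_suppI:
  "finite F \<Longrightarrow> F \<subseteq> I \<Longrightarrow> (\<And>i. i \<notin> F \<Longrightarrow> \<xi> i = 0) \<Longrightarrow> \<xi> \<in> fin_supp I"
proof -
  assume F: "finite F" "F \<subseteq> I" "\<And>i. i \<notin> F \<Longrightarrow> \<xi> i = 0"
  then have "{i. \<xi> i \<noteq> 0} \<subseteq> F" by blast
  then have "finite {i. \<xi> i \<noteq> 0}" using F(1) by (rule finite_subset)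
  then show "\<xi> \<in> fin_supp I" using F by (auto simp: fin_supp_def)
qed

lemma fin_suppE:
  assumes "\<xi> \<in> fin_supp I"
  obtains F where "finite F" "F \<subseteq> I" "\<And>i. i \<notin> F \<Longrightarrow> \<xi> i = 0"
proof (rule that)
  show "finite {i. \<xi> i \<noteq> 0}" "{i. \<xi> i \<noteq> 0} \<subseteq> I" "\<And>i. i \<notin> {i. \<xi> i \<noteq> 0} \<Longrightarrow> \<xi> i = 0"
    using assms by (auto simp: fin_supp_def)
qed

lemma ell2_norm_finite:
  assumes "finite F" "F \<subseteq> I" "\<And>i. i \<notin> F \<Longrightarrow> \<xi> i = 0"
  shows "ell2_norm I \<xi> = L2_set (\<lambda>i. cmod (\<xi> i)) F"
proof -
  have "(\<Sum>\<^sub>\<infinity>i\<in>I. (cmod (\<xi> i))\<^sup>2) = (\<Sum>\<^sub>\<infinity>i\<in>F. (cmod (\<xi> i))\<^sup>2)"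
    by (rule infsum_cong_neutral) (use assms in auto)
  then show ?thesis using assms by (simp add: ell2_norm_def L2_set_def)
qed

lemma ell2_inner_finite:
  assumes "finite F" "F \<subseteq> I" "\<And>i. i \<notin> F \<Longrightarrow> \<xi> i = 0 \<or> \<eta> i = 0"
  shows "ell2_inner I \<xi> \<eta> = (\<Sum>i\<in>F. cnj (\<xi> i) * \<eta> i)"
proof -
  have "ell2_inner I \<xi> \<eta> = (\<Sum>\<^sub>\<infinity>i\<in>F. cnj (\<xi> i) * \<eta> i)"
    unfolding ell2_inner_def by (rule infsum_cong_neutral) (use assms in auto)
  then show ?thesis using assms by simp
qed

lemma fin_supp_ell2: "\<xi> \<in> fin_supp I \<Longrightarrow> \<xi> \<in> ell2 I"
proof (elim fin_suppE)
  fix F assume F: "finite F" "F \<subseteq> I" "\<And>i. i \<notin> F \<Longrightarrow> \<xi> i = 0"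
  have "(\<lambda>i. (cmod (\<xi> i))\<^sup>2) summable_on I \<longleftrightarrow> (\<lambda>i. (cmod (\<xi> i))\<^sup>2) summable_on F"
    by (rule summable_on_cong_neutral) (use F in auto)
  then have "(\<lambda>i. (cmod (\<xi> i))\<^sup>2) summable_on I" using summable_on_finite[OF F(1)] by blast
  moreover have "\<forall>i. i \<notin> I \<longrightarrow> \<xi> i = 0" using F by blast
  ultimately show "\<xi> \<in> ell2 I" unfolding ell2_def by (intro CollectI conjI)
qed

lemma ell2_norm_sq_fin_supp:
  assumes "\<xi> \<in> fin_supp I"
  shows "ell2_inner I \<xi> \<xi> = of_real ((ell2_norm I \<xi>)\<^sup>2)"
proof -
  obtain F where F: "finite F" "F \<subseteq> I" "\<And>i. i \<notin> F \<Longrightarrow> \<xi> i = 0"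
    using fin_suppE[OF assms] by metis
  have "cnj z * z = of_real ((cmod z)\<^sup>2)" for z
    by (subst mult.commute) (rule complex_norm_square[symmetric])
  then show ?thesis
    using F by (subst ell2_inner_finite[OF F(1,2)])
      (auto simp: ell2_norm_finite[OF F] L2_set_def sum_nonneg)
qed

lemma ell2_cauchy_schwarz:
  assumes "\<xi> \<in> fin_supp I" "\<eta> \<in> ell2 I"
  shows "cmod (ell2_inner I \<xi> \<eta>) \<le> ell2_norm I \<xi> * ell2_norm I \<eta>"
proof -
  obtain F where F: "finite F" "F \<subseteq> I" "\<And>i. i \<notin> F \<Longrightarrow> \<xi> i = 0"
    using fin_suppE[OF assms(1)] by metis
  have "cmod (ell2_inner I \<xi> \<eta>) \<le> (\<Sum>i\<in>F. \<bar>cmod (\<xi> i)\<bar> * \<bar>cmod (\<eta> i)\<bar>)"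
    using F by (subst ell2_inner_finite[OF F(1,2)]) (auto simp: norm_mult intro: sum_norm_le)
  also have "\<dots> \<le> L2_set (\<lambda>i. cmod (\<xi> i)) F * L2_set (\<lambda>i. cmod (\<eta> i)) F"
    by (rule L2_set_mult_ineq)
  also have "\<dots> \<le> ell2_norm I \<xi> * ell2_norm I \<eta>"
    using ell2_norm_finite[OF F] L2_set_le_ell2_norm[OF assms(2) F(1,2)]
    by (simp add: mult_left_mono)
  finally show ?thesis .
qed

lemma ell2_inner_sum_left:
  assumes "\<eta> \<in> fin_supp I"
  shows "ell2_inner I (\<lambda>i. \<Sum>t\<in>F. \<xi> t i) \<eta> = (\<Sum>t\<in>F. ell2_inner I (\<xi> t) \<eta>)"
proof -
  obtain B where B: "finite B" "B \<subseteq> I" "\<And>i. i \<notin> B \<Longrightarrow> \<eta> i = 0"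
    using fin_suppE[OF assms] by metis
  then have "ell2_inner I \<zeta> \<eta> = (\<Sum>i\<in>B. cnj (\<zeta> i) * \<eta> i)" for \<zeta>
    by (intro ell2_inner_finite) auto
  then show ?thesis
    by (simp add: sum_distrib_right cnj_sum) (rule sum.swap)
qed

lemma ell2_inner_sum_right:
  assumes "\<xi> \<in> fin_supp I"
  shows "ell2_inner I \<xi> (\<lambda>i. \<Sum>t\<in>F. \<eta> t i) = (\<Sum>t\<in>F. ell2_inner I \<xi> (\<eta> t))"
proof -
  obtain B where B: "finite B" "B \<subseteq> I" "\<And>i. i \<notin> B \<Longrightarrow> \<xi> i = 0"
    using fin_suppE[OF assms] by metis
  then have "ell2_inner I \<xi> \<zeta> = (\<Sum>i\<in>B. cnj (\<xi> i) * \<zeta> i)" for \<zeta>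
    by (intro ell2_inner_finite) auto
  then show ?thesis
    by (simp add: sum_distrib_left) (rule sum.swap)
qed

definition delta :: "'i \<Rightarrow> 'i \<Rightarrow> complex" where
  "delta j = (\<lambda>i. if i = j then 1 else 0)"

lemma delta_fin_supp: "j \<in> I \<Longrightarrow> delta j \<in> fin_supp I"
  by (rule fin_suppI[of "{j}"]) (auto simp: delta_def)

lemma ell2_inner_delta: "j \<in> I \<Longrightarrow> ell2_inner I (delta j) \<xi> = \<xi> j"
  by (subst ell2_inner_finite[of "{j}"]) (auto simp: delta_def)

subsection \<open>Bounded operators\<close>

lemma
  assumes "T \<in> bounded_operators I"
  shows bounded_operator_mem: "\<xi> \<in> ell2 I \<Longrightarrow> T \<xi> \<in> ell2 I"
    and bounded_operator_add: "\<xi> \<in> ell2 I \<Longrightarrow> \<eta> \<in> ell2 I \<Longrightarrow> T (\<lambda>i. \<xi> i + \<eta> i) = (\<lambda>i. T \<xi> i + T \<eta> i)"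
    and bounded_operator_scale: "\<xi> \<in> ell2 I \<Longrightarrow> T (\<lambda>i. c * \<xi> i) = (\<lambda>i. c * T \<xi> i)"
    and bounded_operator_bounded: "\<exists>K. \<forall>\<xi>\<in>ell2 I. ell2_norm I (T \<xi>) \<le> K * ell2_norm I \<xi>"
    and bounded_operator_extensional: "T \<in> extensional (ell2 I)"
proof -
  note T = assms[unfolded bounded_operators_def mem_Collect_eq]
  have PiE: "T \<in> ell2 I \<rightarrow>\<^sub>E ell2 I" using T by (rule conjunct1)
  then show "\<xi> \<in> ell2 I \<Longrightarrow> T \<xi> \<in> ell2 I" by (rule PiE_mem)
  show "T \<in> extensional (ell2 I)" using PiE by (simp add: PiE_def)
  show "T (\<lambda>i. \<xi> i + \<eta> i) = (\<lambda>i. T \<xi> i + T \<eta> i)" if "\<xi> \<in> ell2 I" "\<eta> \<in> ell2 I"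
    using bspec[OF bspec[OF conjunct1[OF conjunct2[OF T]] that(1)] that(2)] .
  show "T (\<lambda>i. c * \<xi> i) = (\<lambda>i. c * T \<xi> i)" if "\<xi> \<in> ell2 I"
    using bspec[OF spec[OF conjunct1[OF conjunct2[OF conjunct2[OF T]]]] that] .
  show "\<exists>K. \<forall>\<xi>\<in>ell2 I. ell2_norm I (T \<xi>) \<le> K * ell2_norm I \<xi>"
    using conjunct2[OF conjunct2[OF conjunct2[OF T]]] .
qed

lemma zero_ell2: "(\<lambda>_. 0) \<in> ell2 I" and ell2_norm_zero: "ell2_norm I (\<lambda>_. 0) = 0"
  by (simp_all add: ell2_def ell2_norm_def)

lemma operator_values_bdd:
  assumes "T \<in> bounded_operators I"
  shows "bdd_above ((\<lambda>\<xi>. ell2_norm I (T \<xi>)) ` {\<xi>\<in>ell2 I. ell2_norm I \<xi> \<le> 1})"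
proof -
  obtain K where K: "\<And>\<xi>. \<xi> \<in> ell2 I \<Longrightarrow> ell2_norm I (T \<xi>) \<le> K * ell2_norm I \<xi>"
    using bounded_operator_bounded[OF assms] by blast
  show ?thesis
  proof (rule bdd_aboveI2)
    fix \<xi> assume \<xi>: "\<xi> \<in> {\<xi>\<in>ell2 I. ell2_norm I \<xi> \<le> 1}"
    have "ell2_norm I (T \<xi>) \<le> K * ell2_norm I \<xi>" using K \<xi> by simp
    also have "\<dots> \<le> \<bar>K\<bar> * 1" using \<xi> by (intro mult_mono) auto
    finally show "ell2_norm I (T \<xi>) \<le> \<bar>K\<bar>" by simp
  qed
qed

lemma operator_norm_bound:
  assumes T: "T \<in> bounded_operators I" and \<xi>: "\<xi> \<in> ell2 I"
  shows "ell2_norm I (T \<xi>) \<le> snorm (operator_alg I) T * ell2_norm I \<xi>"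
proof -
  let ?B = "{\<xi>\<in>ell2 I. ell2_norm I \<xi> \<le> 1}"
  obtain K where K: "\<And>\<xi>. \<xi> \<in> ell2 I \<Longrightarrow> ell2_norm I (T \<xi>) \<le> K * ell2_norm I \<xi>"
    using bounded_operator_bounded[OF T] by blast
  have unit: "ell2_norm I (T \<xi>) \<le> snorm (operator_alg I) T" if "\<xi> \<in> ?B" for \<xi>
    using cSUP_upper[OF that operator_values_bdd[OF T]] by (simp add: operator_alg_def)
  show ?thesis
  proof (cases "ell2_norm I \<xi> = 0")
    case True
    then show ?thesis using K[OF \<xi>] by simp
  next
    case False
    define c where "c = ell2_norm I \<xi>"
    have c: "0 < c" using False by (simp add: c_def less_le)
    have "ell2_norm I (T (\<lambda>i. of_real (1 / c) * \<xi> i)) \<le> snorm (operator_alg I) T"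
      using c ell2_scale[OF \<xi>, of "of_real (1 / c)"] ell2_norm_scale[of I "of_real (1 / c)" \<xi>]
      by (intro unit) (simp add: norm_divide c_def)
    then have "(1 / c) * ell2_norm I (T \<xi>) \<le> snorm (operator_alg I) T"
      using c by (simp only: bounded_operator_scale[OF T \<xi>] ell2_norm_scale norm_of_real)
        (simp add: abs_of_pos)
    then show ?thesis using c by (simp add: c_def field_simps)
  qed
qed

lemma operator_norm_le:
  assumes "0 \<le> K" "\<And>\<xi>. \<xi> \<in> ell2 I \<Longrightarrow> ell2_norm I (T \<xi>) \<le> K * ell2_norm I \<xi>"
  shows "snorm (operator_alg I) T \<le> K"
proof -
  let ?B = "{\<xi>\<in>ell2 I. ell2_norm I \<xi> \<le> 1}"
  have "(SUP \<xi>\<in>?B. ell2_norm I (T \<xi>)) \<le> K"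
  proof (rule cSUP_least)
    show "?B \<noteq> {}" using zero_ell2[of I] ell2_norm_zero[of I] by fastforce
    fix \<xi> assume \<xi>: "\<xi> \<in> ?B"
    then have "ell2_norm I (T \<xi>) \<le> K * ell2_norm I \<xi>" using assms by simp
    also have "\<dots> \<le> K * 1" using \<xi> assms by (intro mult_left_mono) auto
    finally show "ell2_norm I (T \<xi>) \<le> K" by simp
  qed
  then show ?thesis by (simp add: operator_alg_def)
qed

lemma operator_norm_nonneg:
  assumes "T \<in> bounded_operators I"
  shows "0 \<le> snorm (operator_alg I) T"
proof -
  have "ell2_norm I (T (\<lambda>_. 0)) \<le> (SUP \<xi>\<in>{\<xi>\<in>ell2 I. ell2_norm I \<xi> \<le> 1}. ell2_norm I (T \<xi>))"
    by (rule cSUP_upper[OF _ operator_values_bdd[OF assms]]) (simp add: zero_ell2 ell2_norm_zero)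
  then show ?thesis using order_trans[OF ell2_norm_nonneg] by (simp add: operator_alg_def)
qed

lemma operator_diff_apply:
  "\<xi> \<in> ell2 I \<Longrightarrow> sdiff (operator_alg I) T S \<xi> = (\<lambda>i. T \<xi> i - S \<xi> i)"
  by (simp add: sdiff_def operator_alg_def)

lemma operator_diff_closed:
  assumes T: "T \<in> bounded_operators I" and S: "S \<in> bounded_operators I"
  shows "sdiff (operator_alg I) T S \<in> bounded_operators I"
proof -
  let ?R = "sdiff (operator_alg I) T S"
  have ext: "?R \<in> extensional (ell2 I)" by (simp add: sdiff_def operator_alg_def)
  have "ell2_norm I (?R \<xi>) \<le> (snorm (operator_alg I) T + snorm (operator_alg I) S) * ell2_norm I \<xi>"
    if \<xi>: "\<xi> \<in> ell2 I" for \<xi>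
  proof -
    have "ell2_norm I (?R \<xi>) \<le> ell2_norm I (T \<xi>) + ell2_norm I (\<lambda>i. (-1) * S \<xi> i)"
      using ell2_norm_add[of "T \<xi>" I "\<lambda>i. (-1) * S \<xi> i"] \<xi> T S
      by (simp add: operator_diff_apply bounded_operator_mem ell2_scale[of _ _ "-1", simplified])
    also have "\<dots> = ell2_norm I (T \<xi>) + ell2_norm I (S \<xi>)"
      by (subst ell2_norm_scale) simp
    finally show ?thesis
      using operator_norm_bound[OF T \<xi>] operator_norm_bound[OF S \<xi>] by (simp add: distrib_right)
  qed
  moreover have "?R \<xi> \<in> ell2 I" if "\<xi> \<in> ell2 I" for \<xi>
    using that T S by (simp add: operator_diff_apply ell2_diff bounded_operator_mem)
  moreover have "?R (\<lambda>i. \<xi> i + \<eta> i) = (\<lambda>i. ?R \<xi> i + ?R \<eta> i)"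
    if "\<xi> \<in> ell2 I" "\<eta> \<in> ell2 I" for \<xi> \<eta>
    using that
    by (simp add: operator_diff_apply ell2_add bounded_operator_add[OF T] bounded_operator_add[OF S]
        algebra_simps)
  moreover have "?R (\<lambda>i. c * \<xi> i) = (\<lambda>i. c * ?R \<xi> i)" if "\<xi> \<in> ell2 I" for \<xi> c
    using that
    by (simp add: operator_diff_apply ell2_scale bounded_operator_scale[OF T]
        bounded_operator_scale[OF S] algebra_simps)
  ultimately show ?thesis
    unfolding bounded_operators_def PiE_iff mem_Collect_eq using ext
    by (intro conjI ballI allI exI) assumption+
qed

lemma operator_dist_triangle:
  assumes R: "R \<in> bounded_operators I" and S: "S \<in> bounded_operators I" and T: "T \<in> bounded_operators I"
  shows "snorm (operator_alg I) (sdiff (operator_alg I) R T) \<le>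
    snorm (operator_alg I) (sdiff (operator_alg I) R S) + snorm (operator_alg I) (sdiff (operator_alg I) S T)"
proof (rule operator_norm_le)
  let ?d = "\<lambda>R S. sdiff (operator_alg I) R S"
  note RS = operator_diff_closed[OF R S] and ST = operator_diff_closed[OF S T]
  show "0 \<le> snorm (operator_alg I) (?d R S) + snorm (operator_alg I) (?d S T)"
    by (intro add_nonneg_nonneg operator_norm_nonneg RS ST)
  fix \<xi> assume \<xi>: "\<xi> \<in> ell2 I"
  have "?d R T \<xi> = (\<lambda>i. ?d R S \<xi> i + ?d S T \<xi> i)"
    using \<xi> by (simp add: operator_diff_apply)
  then have "ell2_norm I (?d R T \<xi>) \<le> ell2_norm I (?d R S \<xi>) + ell2_norm I (?d S T \<xi>)"
    using ell2_norm_add[OF bounded_operator_mem[OF RS \<xi>] bounded_operator_mem[OF ST \<xi>]] by simp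
  also have "\<dots> \<le> snorm (operator_alg I) (?d R S) * ell2_norm I \<xi> + snorm (operator_alg I) (?d S T) * ell2_norm I \<xi>"
    by (intro add_mono operator_norm_bound RS ST \<xi>)
  finally show "ell2_norm I (?d R T \<xi>) \<le>
      (snorm (operator_alg I) (?d R S) + snorm (operator_alg I) (?d S T)) * ell2_norm I \<xi>"
    by (simp add: distrib_right)
qed

lemma operator_dist_commute_le:
  assumes S: "S \<in> bounded_operators I" and T: "T \<in> bounded_operators I"
  shows "snorm (operator_alg I) (sdiff (operator_alg I) S T) \<le> snorm (operator_alg I) (sdiff (operator_alg I) T S)"
proof (rule operator_norm_le)
  let ?d = "\<lambda>R S. sdiff (operator_alg I) R S"
  show "0 \<le> snorm (operator_alg I) (?d T S)" by (intro operator_norm_nonneg operator_diff_closed T S)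
  fix \<xi> assume \<xi>: "\<xi> \<in> ell2 I"
  have "?d S T \<xi> = (\<lambda>i. (-1) * ?d T S \<xi> i)" using \<xi> by (simp add: operator_diff_apply)
  then have "ell2_norm I (?d S T \<xi>) = ell2_norm I (?d T S \<xi>)"
    using ell2_norm_scale[of I "-1" "?d T S \<xi>"] by simp
  then show "ell2_norm I (?d S T \<xi>) \<le> snorm (operator_alg I) (?d T S) * ell2_norm I \<xi>"
    using operator_norm_bound[OF operator_diff_closed[OF T S] \<xi>] by simp
qed

text \<open>Convergence in operator norm forces convergence of every coordinate of every value.\<close>

lemma operator_limit_unique:
  assumes T: "T \<in> bounded_operators I" and T': "T' \<in> bounded_operators I"
    and S: "\<And>n. S n \<in> bounded_operators I"
    and lim: "(\<lambda>n. snorm (operator_alg I) (sdiff (operator_alg I) (S n) T)) \<longlonglongrightarrow> 0"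
    and lim': "(\<lambda>n. snorm (operator_alg I) (sdiff (operator_alg I) (S n) T')) \<longlonglongrightarrow> 0"
  shows "T = T'"
proof (rule extensionalityI[OF bounded_operator_extensional[OF T] bounded_operator_extensional[OF T']])
  fix \<xi> assume \<xi>: "\<xi> \<in> ell2 I"
  have conv: "(\<lambda>n. S n \<xi> i) \<longlonglongrightarrow> R \<xi> i"
    if R: "R \<in> bounded_operators I"
      and lim: "(\<lambda>n. snorm (operator_alg I) (sdiff (operator_alg I) (S n) R)) \<longlonglongrightarrow> 0" for R i
  proof -
    have "(\<lambda>n. snorm (operator_alg I) (sdiff (operator_alg I) (S n) R) * ell2_norm I \<xi>) \<longlonglongrightarrow> 0 * ell2_norm I \<xi>"
      by (intro tendsto_intros lim)
    then have "(\<lambda>n. snorm (operator_alg I) (sdiff (operator_alg I) (S n) R) * ell2_norm I \<xi>) \<longlonglongrightarrow> 0"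
      by simp
    note lim0 = this
    have le: "cmod (S n \<xi> i - R \<xi> i) \<le> snorm (operator_alg I) (sdiff (operator_alg I) (S n) R) * ell2_norm I \<xi>" for n
    proof -
      have "cmod (sdiff (operator_alg I) (S n) R \<xi> i) \<le> ell2_norm I (sdiff (operator_alg I) (S n) R \<xi>)"
        using bounded_operator_mem[OF operator_diff_closed[OF S R] \<xi>] by (rule cmod_le_ell2_norm)
      also have "\<dots> \<le> snorm (operator_alg I) (sdiff (operator_alg I) (S n) R) * ell2_norm I \<xi>"
        using operator_diff_closed[OF S R] \<xi> by (rule operator_norm_bound)
      finally show ?thesis using \<xi> by (simp add: operator_diff_apply)
    qed
    have "(\<lambda>n. S n \<xi> i - R \<xi> i) \<longlonglongrightarrow> 0"
      by (rule Lim_null_comparison[OF _ lim0]) (use le in \<open>intro always_eventually allI\<close>)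
    then show ?thesis by (rule LIM_zero_cancel)
  qed
  show "T \<xi> = T' \<xi>"
  proof (rule ext)
    fix i
    have "(\<lambda>n. S n \<xi> i) \<longlonglongrightarrow> T \<xi> i" using T lim by (rule conv)
    moreover have "(\<lambda>n. S n \<xi> i) \<longlonglongrightarrow> T' \<xi> i" using T' lim' by (rule conv)
    ultimately show "T \<xi> i = T' \<xi> i" by (rule LIMSEQ_unique)
  qed
qed

text \<open>A Cauchy sequence of operators converges coordinatewise. The estimates on finite sets of coordinates
  survive in the limit, which turns coordinatewise convergence into convergence in norm.\<close>

lemma operator_alg_complete:
  assumes S: "\<And>n. S n \<in> bounded_operators I"
    and cauchy: "\<And>e. 0 < e \<Longrightarrow>
      \<exists>K. \<forall>m\<ge>K. \<forall>n\<ge>K. snorm (operator_alg I) (sdiff (operator_alg I) (S m) (S n)) < e"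
  shows "\<exists>T\<in>bounded_operators I.
    (\<lambda>n. snorm (operator_alg I) (sdiff (operator_alg I) (S n) T)) \<longlonglongrightarrow> 0"
proof -
  let ?d = "\<lambda>T S. snorm (operator_alg I) (sdiff (operator_alg I) T S)"
  have bound: "L2_set (\<lambda>i. cmod (S m \<xi> i - S n \<xi> i)) F \<le> ?d (S m) (S n) * ell2_norm I \<xi>"
    if "\<xi> \<in> ell2 I" "finite F" "F \<subseteq> I" for \<xi> F m n
    using L2_set_le_ell2_norm[OF bounded_operator_mem[OF operator_diff_closed[OF S S] that(1)] that(2,3), of m n]
      operator_norm_bound[OF operator_diff_closed[OF S S] that(1), of m n]
    by (simp add: operator_diff_apply that)
  have conv: "convergent (\<lambda>n. S n \<xi> i)" if \<xi>: "\<xi> \<in> ell2 I" for \<xi> i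
  proof (cases "i \<in> I")
    case False
    then have "S n \<xi> i = 0" for n using ell2_vanish[OF bounded_operator_mem[OF S \<xi>]] by blast
    then show ?thesis by (simp add: convergent_const)
  next
    case True
    have "Cauchy (\<lambda>n. S n \<xi> i)"
    proof (rule metric_CauchyI)
      fix e :: real assume e: "0 < e"
      define d where "d = e / (ell2_norm I \<xi> + 1)"
      have pos: "0 < ell2_norm I \<xi> + 1" by (simp add: add_nonneg_pos)
      then have d: "0 < d" using e by (simp add: d_def)
      then obtain K where K: "\<And>m n. m \<ge> K \<Longrightarrow> n \<ge> K \<Longrightarrow> ?d (S m) (S n) < d"
        using cauchy by blast
      have "dist (S m \<xi> i) (S n \<xi> i) < e" if "m \<ge> K" "n \<ge> K" for m n
      proof -
        have "cmod (S m \<xi> i - S n \<xi> i) \<le> ?d (S m) (S n) * ell2_norm I \<xi>"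
          using bound[OF \<xi>, of "{i}" m n] True by simp
        also have "\<dots> \<le> d * ell2_norm I \<xi>" using K[OF that] by (intro mult_right_mono) auto
        also have "\<dots> < d * (ell2_norm I \<xi> + 1)" using d by simp
        also have "\<dots> = e" using pos by (simp add: d_def)
        finally show ?thesis by (simp add: dist_norm)
      qed
      then show "\<exists>K. \<forall>m\<ge>K. \<forall>n\<ge>K. dist (S m \<xi> i) (S n \<xi> i) < e" by blast
    qed
    then show ?thesis by (simp add: Cauchy_convergent_iff)
  qed
  define T where "T = (\<lambda>\<xi>\<in>ell2 I. \<lambda>i. lim (\<lambda>n. S n \<xi> i))"
  have lim: "(\<lambda>n. S n \<xi> i) \<longlonglongrightarrow> T \<xi> i" if "\<xi> \<in> ell2 I" for \<xi> i
    using conv[OF that, of i] that by (simp add: T_def convergent_LIMSEQ_iff)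
  have diff: "(\<lambda>i. S n \<xi> i - T \<xi> i) \<in> ell2 I" "ell2_norm I (\<lambda>i. S n \<xi> i - T \<xi> i) \<le> e * ell2_norm I \<xi>"
    if \<xi>: "\<xi> \<in> ell2 I" and e: "0 < e" and K: "\<forall>m\<ge>K. \<forall>n\<ge>K. ?d (S m) (S n) < e" and n: "n \<ge> K"
    for \<xi> e n and K :: nat
  proof -
    have z: "S n \<xi> i - T \<xi> i = 0" if "i \<notin> I" for i
    proof -
      have "S m \<xi> i = 0" for m using ell2_vanish[OF bounded_operator_mem[OF S \<xi>] that] .
      then show ?thesis using lim[OF \<xi>, of i] by (simp add: LIMSEQ_const_iff)
    qed
    have le: "L2_set (\<lambda>i. cmod (S n \<xi> i - T \<xi> i)) F \<le> e * ell2_norm I \<xi>"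
      if F: "finite F" "F \<subseteq> I" for F
    proof (rule LIMSEQ_le_const2)
      show "(\<lambda>m. L2_set (\<lambda>i. cmod (S n \<xi> i - S m \<xi> i)) F) \<longlonglongrightarrow> L2_set (\<lambda>i. cmod (S n \<xi> i - T \<xi> i)) F"
        unfolding L2_set_def by (intro tendsto_intros lim \<xi>)
      show "\<exists>N. \<forall>m\<ge>N. L2_set (\<lambda>i. cmod (S n \<xi> i - S m \<xi> i)) F \<le> e * ell2_norm I \<xi>"
      proof (intro exI allI impI)
        fix m assume "K \<le> m"
        then have "?d (S n) (S m) * ell2_norm I \<xi> \<le> e * ell2_norm I \<xi>"
          using K n by (intro mult_right_mono) (auto simp: less_imp_le)
        then show "L2_set (\<lambda>i. cmod (S n \<xi> i - S m \<xi> i)) F \<le> e * ell2_norm I \<xi>"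
          using bound[OF \<xi> F, of n m] by linarith
      qed
    qed
    show "(\<lambda>i. S n \<xi> i - T \<xi> i) \<in> ell2 I" "ell2_norm I (\<lambda>i. S n \<xi> i - T \<xi> i) \<le> e * ell2_norm I \<xi>"
      using ell2_boundI[OF z le] by blast+
  qed
  obtain K1 where K1: "\<forall>m\<ge>K1. \<forall>n\<ge>K1. ?d (S m) (S n) < 1"
    using cauchy[of 1] by auto
  have memT: "T \<xi> \<in> ell2 I" if \<xi>: "\<xi> \<in> ell2 I" for \<xi>
    using ell2_diff[OF bounded_operator_mem[OF S \<xi>, of K1] diff(1)[OF \<xi> zero_less_one K1 order_refl]] by simp
  have TB: "T \<in> bounded_operators I"
    unfolding bounded_operators_def
  proof (intro CollectI conjI ballI allI)
    show "T \<in> ell2 I \<rightarrow>\<^sub>E ell2 I" using memT by (auto simp: PiE_iff T_def)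
    fix \<xi> assume \<xi>: "\<xi> \<in> ell2 I"
    show "T (\<lambda>i. \<xi> i + \<eta> i) = (\<lambda>i. T \<xi> i + T \<eta> i)" if \<eta>: "\<eta> \<in> ell2 I" for \<eta>
    proof
      fix i
      have "(\<lambda>n. S n (\<lambda>i. \<xi> i + \<eta> i) i) \<longlonglongrightarrow> T \<xi> i + T \<eta> i"
        using tendsto_add[OF lim[OF \<xi>, of i] lim[OF \<eta>, of i]] by (simp add: bounded_operator_add[OF S \<xi> \<eta>])
      with lim[OF ell2_add[OF \<xi> \<eta>], of i] show "T (\<lambda>i. \<xi> i + \<eta> i) i = T \<xi> i + T \<eta> i"
        by (rule LIMSEQ_unique)
    qed
    show "T (\<lambda>i. c * \<xi> i) = (\<lambda>i. c * T \<xi> i)" for c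
    proof
      fix i
      have "(\<lambda>n. S n (\<lambda>i. c * \<xi> i) i) \<longlonglongrightarrow> c * T \<xi> i"
        using tendsto_mult_left[OF lim[OF \<xi>, of i], of c] by (simp add: bounded_operator_scale[OF S \<xi>])
      with lim[OF ell2_scale[OF \<xi>], of c i] show "T (\<lambda>i. c * \<xi> i) i = c * T \<xi> i"
        by (rule LIMSEQ_unique)
    qed
  next
    show "\<exists>K. \<forall>\<xi>\<in>ell2 I. ell2_norm I (T \<xi>) \<le> K * ell2_norm I \<xi>"
    proof (intro exI ballI)
      fix \<xi> assume \<xi>: "\<xi> \<in> ell2 I"
      note d = diff[OF \<xi> zero_less_one K1 order_refl]
      have "ell2_norm I (\<lambda>i. S K1 \<xi> i + (- 1) * (S K1 \<xi> i - T \<xi> i))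
          \<le> ell2_norm I (S K1 \<xi>) + ell2_norm I (\<lambda>i. (- 1) * (S K1 \<xi> i - T \<xi> i))"
        by (intro ell2_norm_add bounded_operator_mem[OF S \<xi>] ell2_scale d)
      then have "ell2_norm I (T \<xi>) \<le> ell2_norm I (S K1 \<xi>) + ell2_norm I \<xi>"
        using d(2) unfolding ell2_norm_scale by simp
      then show "ell2_norm I (T \<xi>) \<le> (snorm (operator_alg I) (S K1) + 1) * ell2_norm I \<xi>"
        using operator_norm_bound[OF S \<xi>, of K1] by (simp add: distrib_right)
    qed
  qed
  have "(\<lambda>n. ?d (S n) T) \<longlonglongrightarrow> 0"
  proof (rule LIMSEQ_I)
    fix e :: real assume e: "0 < e"
    then obtain K where K: "\<forall>m\<ge>K. \<forall>n\<ge>K. ?d (S m) (S n) < e / 2"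
      using cauchy[of "e/2"] by auto
    have "?d (S n) T \<le> e / 2" if "n \<ge> K" for n
      using e diff(2)[OF _ half_gt_zero[OF e] K that]
      by (intro operator_norm_le) (simp_all add: operator_diff_apply)
    then show "\<exists>K. \<forall>n\<ge>K. norm (?d (S n) T - 0) < e"
      using e operator_norm_nonneg[OF operator_diff_closed[OF S TB]]
      by (intro exI[of _ K]) (auto simp: abs_of_nonneg intro: le_less_trans[of _ "e/2"])
  qed
  then show ?thesis using TB by blast
qed

section \<open>The convolution algebra of a group acting on a set\<close>

definition translate :: "('g, 'm) monoid_scheme \<Rightarrow> 'x set \<Rightarrow> ('g \<Rightarrow> 'x \<Rightarrow> 'x)
    \<Rightarrow> 'g \<Rightarrow> ('x \<Rightarrow> complex) \<Rightarrow> 'x \<Rightarrow> complex" where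
  "translate G X act g d = (\<lambda>y. if y \<in> X then d (act (inv\<^bsub>G\<^esub> g) y) else 0)"

locale group_on_set = group G for G (structure) +
  fixes X :: "'x set" and act
  assumes act_closed [simp]: "g \<in> carrier G \<Longrightarrow> y \<in> X \<Longrightarrow> act g y \<in> X"
    and act_one [simp]: "y \<in> X \<Longrightarrow> act \<one> y = y"
    and act_mult: "g \<in> carrier G \<Longrightarrow> h \<in> carrier G \<Longrightarrow> y \<in> X \<Longrightarrow> act (g \<otimes> h) y = act g (act h y)"
begin

abbreviation "tr \<equiv> translate G X act"
abbreviation "I \<equiv> carrier G \<times> X"

lemma act_inv_act [simp]: "g \<in> carrier G \<Longrightarrow> y \<in> X \<Longrightarrow> act (inv g) (act g y) = y"
  by (simp add: act_mult[symmetric])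

lemma act_act_inv [simp]: "g \<in> carrier G \<Longrightarrow> y \<in> X \<Longrightarrow> act g (act (inv g) y) = y"
  by (simp add: act_mult[symmetric])

lemma inv_mult_cancel [simp]:
  "t \<in> carrier G \<Longrightarrow> s \<in> carrier G \<Longrightarrow> inv t \<otimes> (t \<otimes> s) = s"
  "t \<in> carrier G \<Longrightarrow> s \<in> carrier G \<Longrightarrow> t \<otimes> (inv t \<otimes> s) = s"
  by (simp_all add: m_assoc[symmetric])

text \<open>The largest coefficient algebra. The algebraic laws do not involve boundedness, so they are proved once
  over all functions on \<open>X\<close>, and every other coefficient algebra inherits them.\<close>

definition vanishing :: "('x \<Rightarrow> complex) set" where
  "vanishing = {d. \<forall>y. y \<notin> X \<longrightarrow> d y = 0}"

abbreviation "CV \<equiv> cc_alg G vanishing tr"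

lemma mem_CV:
  "f \<in> carrier CV \<longleftrightarrow> (\<forall>s y. (s, y) \<notin> I \<longrightarrow> f s y = 0) \<and> finite {s. f s \<noteq> (\<lambda>_. 0)}"
  by (auto simp: cc_alg_def vanishing_def fun_eq_iff)

lemma CV_outside: "f \<in> carrier CV \<Longrightarrow> (s, y) \<notin> I \<Longrightarrow> f s y = 0"
  by (simp add: mem_CV)

lemma CV_support:
  assumes "f \<in> carrier CV"
  shows "finite {t \<in> carrier G. f t \<noteq> (\<lambda>_. 0)}"
  using assms unfolding mem_CV by (auto elim: rev_finite_subset)

text \<open>One summand \<open>d \<delta>\<^sub>t\<close> of the regular representation.\<close>

definition shift_op :: "'a \<Rightarrow> ('x \<Rightarrow> complex) \<Rightarrow> ('a \<times> 'x \<Rightarrow> complex) \<Rightarrow> 'a \<times> 'x \<Rightarrow> complex" where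
  "shift_op t d \<xi> = (\<lambda>(s, y). if s \<in> carrier G \<and> y \<in> X then d (act s y) * \<xi> (inv t \<otimes> s, y) else 0)"

definition lreg :: "('a \<Rightarrow> 'x \<Rightarrow> complex) \<Rightarrow> ('a \<times> 'x \<Rightarrow> complex) \<Rightarrow> 'a \<times> 'x \<Rightarrow> complex" where
  "lreg f \<xi> = (\<lambda>i. \<Sum>t\<in>{t \<in> carrier G. f t \<noteq> (\<lambda>_. 0)}. shift_op t (f t) \<xi> i)"

lemma regular_rep_cc_eq: "regular_rep_cc G X tr f = restrict (lreg f) (ell2 I)"
proof -
  have "(\<lambda>(s, y). if s \<in> carrier G \<and> y \<in> X
     then \<Sum>t\<in>{t\<in>carrier G. f t \<noteq> (\<lambda>_. 0)}. tr (inv s) (f t) y * \<xi> (inv t \<otimes> s, y)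
     else 0) = lreg f \<xi>" for \<xi>
    by (auto simp: lreg_def shift_op_def translate_def fun_eq_iff)
  then show ?thesis by (simp add: regular_rep_cc_def)
qed

lemma shift_op_zero: "shift_op t (\<lambda>_. 0) \<xi> = (\<lambda>_. 0)"
  by (auto simp: shift_op_def)

lemma lreg_eq:
  assumes "finite F" "F \<subseteq> carrier G" "\<And>t. t \<in> carrier G \<Longrightarrow> t \<notin> F \<Longrightarrow> f t = (\<lambda>_. 0)"
  shows "lreg f \<xi> i = (\<Sum>t\<in>F. shift_op t (f t) \<xi> i)"
  unfolding lreg_def
  by (rule sum.mono_neutral_left) (use assms in \<open>auto simp: shift_op_zero\<close>)

lemma lreg_outside: "i \<notin> I \<Longrightarrow> lreg f \<xi> i = 0"
  by (auto simp: lreg_def shift_op_def split: prod.splits intro!: sum.neutral)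

lemma lreg_add:
  assumes f: "f \<in> carrier CV" and g: "g \<in> carrier CV"
  shows "lreg (\<lambda>s y. f s y + g s y) \<xi> = (\<lambda>i. lreg f \<xi> i + lreg g \<xi> i)"
proof
  fix i
  let ?F = "{t \<in> carrier G. f t \<noteq> (\<lambda>_. 0)} \<union> {t \<in> carrier G. g t \<noteq> (\<lambda>_. 0)}"
  have F: "finite ?F" "?F \<subseteq> carrier G" using CV_support[OF f] CV_support[OF g] by auto
  have "shift_op t (\<lambda>y. f t y + g t y) \<xi> i = shift_op t (f t) \<xi> i + shift_op t (g t) \<xi> i" for t
    by (cases i) (simp add: shift_op_def distrib_right)
  moreover have "lreg f \<xi> i = (\<Sum>t\<in>?F. shift_op t (f t) \<xi> i)" by (rule lreg_eq[OF F]) auto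
  moreover have "lreg g \<xi> i = (\<Sum>t\<in>?F. shift_op t (g t) \<xi> i)" by (rule lreg_eq[OF F]) auto
  moreover have "lreg (\<lambda>s y. f s y + g s y) \<xi> i = (\<Sum>t\<in>?F. shift_op t (\<lambda>y. f t y + g t y) \<xi> i)"
    by (rule lreg_eq[OF F]) auto
  ultimately show "lreg (\<lambda>s y. f s y + g s y) \<xi> i = lreg f \<xi> i + lreg g \<xi> i"
    by (simp add: sum.distrib)
qed

lemma lreg_scale:
  assumes f: "f \<in> carrier CV"
  shows "lreg (\<lambda>s y. c * f s y) \<xi> = (\<lambda>i. c * lreg f \<xi> i)"
proof
  fix i
  let ?F = "{t \<in> carrier G. f t \<noteq> (\<lambda>_. 0)}"
  have F: "finite ?F" "?F \<subseteq> carrier G" using CV_support[OF f] by auto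
  have "shift_op t (\<lambda>y. c * f t y) \<xi> i = c * shift_op t (f t) \<xi> i" for t
    by (cases i) (simp add: shift_op_def)
  moreover have "lreg (\<lambda>s y. c * f s y) \<xi> i = (\<Sum>t\<in>?F. shift_op t (\<lambda>y. c * f t y) \<xi> i)"
    by (rule lreg_eq[OF F]) auto
  ultimately show "lreg (\<lambda>s y. c * f s y) \<xi> i = c * lreg f \<xi> i"
    by (simp add: sum_distrib_left lreg_def)
qed

lemma lreg_vec_add: "lreg f (\<lambda>i. \<xi> i + \<eta> i) = (\<lambda>i. lreg f \<xi> i + lreg f \<eta> i)"
proof
  fix i
  have "shift_op t d (\<lambda>i. \<xi> i + \<eta> i) i = shift_op t d \<xi> i + shift_op t d \<eta> i" for t d
    by (cases i) (simp add: shift_op_def distrib_left)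
  then show "lreg f (\<lambda>i. \<xi> i + \<eta> i) i = lreg f \<xi> i + lreg f \<eta> i"
    by (simp add: lreg_def sum.distrib)
qed

lemma lreg_vec_scale: "lreg f (\<lambda>i. c * \<xi> i) = (\<lambda>i. c * lreg f \<xi> i)"
  by (auto simp: lreg_def shift_op_def sum_distrib_left mult.left_commute intro!: sum.cong)

text \<open>The matrix entries of \<open>lreg f\<close> are the values of \<open>f\<close>.\<close>

lemma lreg_delta:
  assumes "f \<in> carrier CV" "t \<in> carrier G" "s \<in> carrier G" "y \<in> X"
  shows "lreg f (delta (s, y)) (t, y) = f (t \<otimes> inv s) (act t y)"
proof -
  let ?F = "{t \<in> carrier G. f t \<noteq> (\<lambda>_. 0)}"
  have "inv u \<otimes> t = s \<longleftrightarrow> u = t \<otimes> inv s" if "u \<in> carrier G" for u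
    using assms that by (metis inv_closed inv_solve_left inv_solve_right')
  then have "shift_op u (f u) (delta (s, y)) (t, y) =
      (if u = t \<otimes> inv s then f (t \<otimes> inv s) (act t y) else 0)" if "u \<in> carrier G" for u
    using assms that by (auto simp: shift_op_def delta_def)
  then have "lreg f (delta (s, y)) (t, y) = (\<Sum>u\<in>?F. if u = t \<otimes> inv s then f (t \<otimes> inv s) (act t y) else 0)"
    unfolding lreg_def by (intro sum.cong) auto
  also have "\<dots> = f (t \<otimes> inv s) (act t y)"
    using CV_support[OF assms(1)] assms by (simp add: sum.delta)
  finally show ?thesis .
qed

text \<open>The regular representation is faithful already on finitely supported vectors; the laws of
  the convolution algebra are inherited through it from those of composition and adjoints.\<close>

lemma lreg_inject:
  assumes f: "f \<in> carrier CV" and g: "g \<in> carrier CV"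
    and eq: "\<And>\<xi>. \<xi> \<in> fin_supp I \<Longrightarrow> lreg f \<xi> = lreg g \<xi>"
  shows "f = g"
proof (intro ext)
  fix t z
  show "f t z = g t z"
  proof (cases "(t, z) \<in> I")
    case False
    then show ?thesis using CV_outside[OF f False] CV_outside[OF g False] by simp
  next
    case True
    then have t: "t \<in> carrier G" "act (inv t) z \<in> X" "z \<in> X" by auto
    have "lreg f (delta (\<one>, act (inv t) z)) = lreg g (delta (\<one>, act (inv t) z))"
      using t by (intro eq delta_fin_supp) auto
    then show ?thesis
      using t lreg_delta[OF f t(1) one_closed t(2)] lreg_delta[OF g t(1) one_closed t(2)] by simp
  qed
qed

lemma mult_apply:
  "s \<in> carrier G \<Longrightarrow> y \<in> X \<Longrightarrow> smult (cc_alg G E tr) f g s y =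
    (\<Sum>t\<in>{t\<in>carrier G. f t \<noteq> (\<lambda>_. 0)}. f t y * g (inv t \<otimes> s) (act (inv t) y))"
  by (simp add: cc_alg_def translate_def)

lemma mult_outside:
  assumes "f \<in> carrier CV" "(s, y) \<notin> I"
  shows "smult (cc_alg G E tr) f g s y = 0"
  using assms by (auto simp: cc_alg_def translate_def)

lemma mult_support:
  assumes "s \<notin> (\<lambda>(t, u). t \<otimes> u) ` ({t\<in>carrier G. f t \<noteq> (\<lambda>_. 0)} \<times> {t\<in>carrier G. g t \<noteq> (\<lambda>_. 0)})"
  shows "smult (cc_alg G E tr) f g s = (\<lambda>_. 0)"
proof (cases "s \<in> carrier G")
  case True
  have "g (inv t \<otimes> s) = (\<lambda>_. 0)" if "t \<in> carrier G" "f t \<noteq> (\<lambda>_. 0)" for t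
  proof (rule ccontr)
    assume "g (inv t \<otimes> s) \<noteq> (\<lambda>_. 0)"
    then have "t \<otimes> (inv t \<otimes> s) \<in> (\<lambda>(t, u). t \<otimes> u) `
        ({t\<in>carrier G. f t \<noteq> (\<lambda>_. 0)} \<times> {t\<in>carrier G. g t \<noteq> (\<lambda>_. 0)})"
      using that True by (intro image_eqI[of _ _ "(t, inv t \<otimes> s)"]) auto
    then show False using assms that True by simp
  qed
  then show ?thesis
    using True by (auto simp: cc_alg_def translate_def intro!: sum.neutral)
qed (simp add: cc_alg_def)

lemma CV_mult_closed:
  assumes f: "f \<in> carrier CV" and g: "g \<in> carrier CV"
  shows "smult CV f g \<in> carrier CV"
proof -
  let ?P = "(\<lambda>(t, u). t \<otimes> u) ` ({t\<in>carrier G. f t \<noteq> (\<lambda>_. 0)} \<times> {t\<in>carrier G. g t \<noteq> (\<lambda>_. 0)})"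
  have "{s. smult CV f g s \<noteq> (\<lambda>_. 0)} \<subseteq> ?P" using mult_support by blast
  moreover have "finite ?P" using CV_support[OF f] CV_support[OF g] by simp
  ultimately have "finite {s. smult CV f g s \<noteq> (\<lambda>_. 0)}" by (rule finite_subset)
  then show ?thesis unfolding mem_CV using mult_outside[OF f] by blast
qed

text \<open>Both sides are double sums over the supports; the substitution \<open>s = t \<otimes> u\<close> matches them.\<close>

lemma lreg_mult:
  assumes f: "f \<in> carrier CV" and g: "g \<in> carrier CV"
  shows "lreg (smult CV f g) \<xi> = lreg f (lreg g \<xi>)"
proof
  fix i :: "'a \<times> 'x"
  obtain r y where i: "i = (r, y)" by (cases i)
  let ?F = "{t\<in>carrier G. f t \<noteq> (\<lambda>_. 0)}" and ?K = "{t\<in>carrier G. g t \<noteq> (\<lambda>_. 0)}"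
  let ?P = "(\<lambda>(t, u). t \<otimes> u) ` (?F \<times> ?K)"
  have fin: "finite ?F" "finite ?K" "finite ?P" using CV_support[OF f] CV_support[OF g] by auto
  show "lreg (smult CV f g) \<xi> i = lreg f (lreg g \<xi>) i"
  proof (cases "i \<in> I")
    case False
    then show ?thesis by (simp add: lreg_outside)
  next
    case True
    then have r: "r \<in> carrier G" "y \<in> X" by (auto simp: i)
    have "lreg (smult CV f g) \<xi> i = (\<Sum>s\<in>?P. shift_op s (smult CV f g s) \<xi> i)"
      by (rule lreg_eq) (use fin mult_support in auto)
    also have "\<dots> = (\<Sum>s\<in>?P. \<Sum>t\<in>?F. f t (act r y) * g (inv t \<otimes> s) (act (inv t) (act r y)) * \<xi> (inv s \<otimes> r, y))"
      using r by (intro sum.cong refl) (auto simp: i shift_op_def mult_apply sum_distrib_right)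
    also have "\<dots> = (\<Sum>t\<in>?F. \<Sum>s\<in>?P. f t (act r y) * g (inv t \<otimes> s) (act (inv t) (act r y)) * \<xi> (inv s \<otimes> r, y))"
      by (rule sum.swap)
    also have "\<dots> = (\<Sum>t\<in>?F. f t (act r y) * lreg g \<xi> (inv t \<otimes> r, y))"
    proof (intro sum.cong refl)
      fix t assume t: "t \<in> ?F"
      then have tG: "t \<in> carrier G" by simp
      let ?h = "\<lambda>s. f t (act r y) * g (inv t \<otimes> s) (act (inv t) (act r y)) * \<xi> (inv s \<otimes> r, y)"
      have "(\<Sum>s\<in>?P. ?h s) = (\<Sum>s\<in>(\<lambda>u. t \<otimes> u) ` ?K. ?h s)"
      proof (rule sum.mono_neutral_right[OF fin(3)])
        show "(\<lambda>u. t \<otimes> u) ` ?K \<subseteq> ?P"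
        proof
          fix s assume "s \<in> (\<lambda>u. t \<otimes> u) ` ?K"
          then obtain u where "u \<in> ?K" "s = t \<otimes> u" by blast
          then show "s \<in> ?P" using t by (intro image_eqI[of _ _ "(t, u)"]) auto
        qed
        show "\<forall>s\<in>?P - (\<lambda>u. t \<otimes> u) ` ?K. ?h s = 0"
        proof
          fix s assume s: "s \<in> ?P - (\<lambda>u. t \<otimes> u) ` ?K"
          then have sG: "s \<in> carrier G" by auto
          have "g (inv t \<otimes> s) = (\<lambda>_. 0)"
          proof (rule ccontr)
            assume "g (inv t \<otimes> s) \<noteq> (\<lambda>_. 0)"
            then have "t \<otimes> (inv t \<otimes> s) \<in> (\<lambda>u. t \<otimes> u) ` ?K"
              using tG sG by (intro imageI) auto
            then show False using s tG sG by simp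
          qed
          then show "?h s = 0" by simp
        qed
      qed
      also have "\<dots> = (\<Sum>u\<in>?K. ?h (t \<otimes> u))"
        using tG by (subst sum.reindex) (auto simp: inj_on_def)
      also have "\<dots> = (\<Sum>u\<in>?K. f t (act r y) * shift_op u (g u) \<xi> (inv t \<otimes> r, y))"
      proof (intro sum.cong refl)
        fix u assume "u \<in> ?K"
        then have u: "u \<in> carrier G" by simp
        have "inv (t \<otimes> u) \<otimes> r = inv u \<otimes> (inv t \<otimes> r)"
          using tG u r by (simp add: inv_mult_group m_assoc)
        then show "?h (t \<otimes> u) = f t (act r y) * shift_op u (g u) \<xi> (inv t \<otimes> r, y)"
          using tG u r by (simp add: shift_op_def act_mult mult.assoc)
      qed
      finally show "(\<Sum>s\<in>?P. ?h s) = f t (act r y) * lreg g \<xi> (inv t \<otimes> r, y)"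
        by (simp add: lreg_def sum_distrib_left)
    qed
    also have "\<dots> = lreg f (lreg g \<xi>) i"
      using r by (simp add: i lreg_def[of f] shift_op_def)
    finally show ?thesis .
  qed
qed

subsection \<open>Adjoints and norm bounds\<close>

lemma shift_op_fin_supp:
  assumes "\<xi> \<in> fin_supp I" "t \<in> carrier G"
  shows "shift_op t d \<xi> \<in> fin_supp I"
proof -
  obtain B where B: "finite B" "B \<subseteq> I" "\<And>i. i \<notin> B \<Longrightarrow> \<xi> i = 0"
    using fin_suppE[OF assms(1)] by metis
  show ?thesis
  proof (rule fin_suppI)
    show "finite ((\<lambda>(s, y). (t \<otimes> s, y)) ` B)" using B by simp
    show "(\<lambda>(s, y). (t \<otimes> s, y)) ` B \<subseteq> I" using B assms by auto
    fix i assume i: "i \<notin> (\<lambda>(s, y). (t \<otimes> s, y)) ` B"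
    obtain s y where sy: "i = (s, y)" by (cases i)
    show "shift_op t d \<xi> i = 0"
    proof (cases "s \<in> carrier G")
      case True
      have "(inv t \<otimes> s, y) \<notin> B"
      proof
        assume "(inv t \<otimes> s, y) \<in> B"
        then have "(t \<otimes> (inv t \<otimes> s), y) \<in> (\<lambda>(s, y). (t \<otimes> s, y)) ` B" by force
        then show False using i sy True assms by simp
      qed
      then show ?thesis using B(3) by (simp add: sy shift_op_def)
    qed (simp add: sy shift_op_def)
  qed
qed

lemma sum_fin_supp:
  assumes "finite F" "\<And>t. t \<in> F \<Longrightarrow> \<xi> t \<in> fin_supp J"
  shows "(\<lambda>i. \<Sum>t\<in>F. \<xi> t i) \<in> fin_supp J"
proof (rule fin_suppI)
  show "finite (\<Union>t\<in>F. {i. \<xi> t i \<noteq> 0})" using assms by (auto simp: fin_supp_def)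
  show "(\<Union>t\<in>F. {i. \<xi> t i \<noteq> 0}) \<subseteq> J" using assms by (auto simp: fin_supp_def)
qed (auto intro!: sum.neutral)

lemma lreg_fin_supp:
  assumes "f \<in> carrier CV" "\<xi> \<in> fin_supp I"
  shows "lreg f \<xi> \<in> fin_supp I"
  unfolding lreg_def
  by (rule sum_fin_supp) (use CV_support[OF assms(1)] shift_op_fin_supp[OF assms(2)] in auto)

text \<open>Translation by \<open>t\<close> permutes the basis, so the sum defining the inner product can be reindexed.\<close>

lemma shift_op_adjoint:
  assumes t: "t \<in> carrier G"
  shows "ell2_inner I (shift_op t d \<xi>) \<eta> =
    ell2_inner I \<xi> (shift_op (inv t) (\<lambda>z. cnj (d (act t z))) \<eta>)"
proof -
  have bij: "bij_betw (\<lambda>(s, y). (t \<otimes> s, y)) I I"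
    by (rule bij_betw_byWitness[of _ "\<lambda>(s, y). (inv t \<otimes> s, y)"]) (use t in auto)
  have "ell2_inner I (shift_op t d \<xi>) \<eta> =
      (\<Sum>\<^sub>\<infinity>i\<in>I. cnj (shift_op t d \<xi> ((\<lambda>(s, y). (t \<otimes> s, y)) i)) * \<eta> ((\<lambda>(s, y). (t \<otimes> s, y)) i))"
    unfolding ell2_inner_def
    by (rule infsum_reindex_bij_betw[OF bij, symmetric])
  also have "\<dots> = ell2_inner I \<xi> (shift_op (inv t) (\<lambda>z. cnj (d (act t z))) \<eta>)"
    unfolding ell2_inner_def
    by (rule infsum_cong) (use t in \<open>auto simp: shift_op_def act_mult\<close>)
  finally show ?thesis .
qed

lemma star_apply:
  "s \<in> carrier G \<Longrightarrow> y \<in> X \<Longrightarrow> sstar (cc_alg G E tr) f s y = cnj (f (inv s) (act (inv s) y))"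
  by (simp add: cc_alg_def translate_def)

lemma star_outside: "(s, y) \<notin> I \<Longrightarrow> sstar (cc_alg G E tr) f s y = 0"
  by (auto simp: cc_alg_def translate_def)

lemma star_support:
  "s \<notin> (\<lambda>t. inv t) ` {t\<in>carrier G. f t \<noteq> (\<lambda>_. 0)} \<Longrightarrow> sstar (cc_alg G E tr) f s = (\<lambda>_. 0)"
proof (cases "s \<in> carrier G")
  case True
  assume s: "s \<notin> (\<lambda>t. inv t) ` {t\<in>carrier G. f t \<noteq> (\<lambda>_. 0)}"
  have "f (inv s) = (\<lambda>_. 0)"
  proof (rule ccontr)
    assume "f (inv s) \<noteq> (\<lambda>_. 0)"
    then have "inv (inv s) \<in> (\<lambda>t. inv t) ` {t\<in>carrier G. f t \<noteq> (\<lambda>_. 0)}"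
      using True by (intro imageI) auto
    then show False using s True by simp
  qed
  then show ?thesis using True by (simp add: cc_alg_def translate_def fun_eq_iff)
qed (simp add: cc_alg_def)

lemma CV_star_closed:
  assumes f: "f \<in> carrier CV"
  shows "sstar CV f \<in> carrier CV"
proof -
  have "{s. sstar CV f s \<noteq> (\<lambda>_. 0)} \<subseteq> (\<lambda>t. inv t) ` {t\<in>carrier G. f t \<noteq> (\<lambda>_. 0)}"
    using star_support by blast
  then have "finite {s. sstar CV f s \<noteq> (\<lambda>_. 0)}"
    by (rule finite_subset) (use CV_support[OF f] in simp)
  then show ?thesis unfolding mem_CV using star_outside by blast
qed

lemma lreg_adjoint:
  assumes f: "f \<in> carrier CV" and \<xi>: "\<xi> \<in> fin_supp I" and \<eta>: "\<eta> \<in> fin_supp I"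
  shows "ell2_inner I (lreg f \<xi>) \<eta> = ell2_inner I \<xi> (lreg (sstar CV f) \<eta>)"
proof -
  let ?F = "{t\<in>carrier G. f t \<noteq> (\<lambda>_. 0)}"
  have "lreg (sstar CV f) \<eta> i = (\<Sum>t\<in>?F. shift_op (inv t) (sstar CV f (inv t)) \<eta> i)" for i
  proof -
    have "lreg (sstar CV f) \<eta> i = (\<Sum>t\<in>(\<lambda>t. inv t) ` ?F. shift_op t (sstar CV f t) \<eta> i)"
      by (rule lreg_eq) (use CV_support[OF f] star_support in auto)
    also have "\<dots> = (\<Sum>t\<in>?F. shift_op (inv t) (sstar CV f (inv t)) \<eta> i)"
      by (subst sum.reindex) (auto intro: inj_on_subset[OF inv_inj])
    finally show ?thesis .
  qed
  moreover have "shift_op (inv t) (sstar CV f (inv t)) \<eta> = shift_op (inv t) (\<lambda>z. cnj (f t (act t z))) \<eta>"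
    if "t \<in> carrier G" for t
    using that by (auto simp: shift_op_def star_apply)
  ultimately have "lreg (sstar CV f) \<eta> = (\<lambda>i. \<Sum>t\<in>?F. shift_op (inv t) (\<lambda>z. cnj (f t (act t z))) \<eta> i)"
    by (auto intro!: sum.cong)
  then show ?thesis
    unfolding lreg_def[of f]
    by (simp add: ell2_inner_sum_left[OF \<eta>] ell2_inner_sum_right[OF \<xi>] shift_op_adjoint)
qed

text \<open>The inner product separates vectors, so an element is known from its matrix entries; identities
  about the star follow from uniqueness of adjoints.\<close>

lemma star_determined:
  assumes f: "f \<in> carrier CV" and g: "g \<in> carrier CV"
    and eq: "\<And>\<xi> \<eta>. \<xi> \<in> fin_supp I \<Longrightarrow> \<eta> \<in> fin_supp I \<Longrightarrow>
      ell2_inner I \<xi> (lreg f \<eta>) = ell2_inner I \<xi> (lreg g \<eta>)"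
  shows "f = g"
proof (rule lreg_inject[OF f g])
  fix \<eta> assume \<eta>: "\<eta> \<in> fin_supp I"
  show "lreg f \<eta> = lreg g \<eta>"
  proof
    fix i show "lreg f \<eta> i = lreg g \<eta> i"
    proof (cases "i \<in> I")
      case True
      have "ell2_inner I (delta i) (lreg f \<eta>) = ell2_inner I (delta i) (lreg g \<eta>)"
        by (rule eq[OF delta_fin_supp[OF True] \<eta>])
      then show ?thesis unfolding ell2_inner_delta[OF True] .
    next
      case False
      show ?thesis by (simp only: lreg_outside[OF False])
    qed
  qed
qed

lemma CV_star_mult:
  assumes f: "f \<in> carrier CV" and g: "g \<in> carrier CV"
  shows "sstar CV (smult CV f g) = smult CV (sstar CV g) (sstar CV f)"
proof (rule star_determined)
  show "sstar CV (smult CV f g) \<in> carrier CV" "smult CV (sstar CV g) (sstar CV f) \<in> carrier CV"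
    by (intro CV_star_closed CV_mult_closed f g)+
  fix \<xi> \<eta> assume v: "\<xi> \<in> fin_supp I" "\<eta> \<in> fin_supp I"
  have "ell2_inner I \<xi> (lreg (sstar CV (smult CV f g)) \<eta>) = ell2_inner I (lreg f (lreg g \<xi>)) \<eta>"
    using lreg_adjoint[OF CV_mult_closed[OF f g] v] by (simp only: lreg_mult[OF f g])
  also have "\<dots> = ell2_inner I \<xi> (lreg (sstar CV g) (lreg (sstar CV f) \<eta>))"
    using lreg_adjoint[OF f lreg_fin_supp[OF g v(1)] v(2)]
      lreg_adjoint[OF g v(1) lreg_fin_supp[OF CV_star_closed[OF f] v(2)]] by (simp only:)
  finally show "ell2_inner I \<xi> (lreg (sstar CV (smult CV f g)) \<eta>) =
      ell2_inner I \<xi> (lreg (smult CV (sstar CV g) (sstar CV f)) \<eta>)"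
    by (simp only: lreg_mult[OF CV_star_closed[OF g] CV_star_closed[OF f]])
qed

lemma shift_op_bound:
  assumes t: "t \<in> carrier G" and d: "\<And>z. z \<in> X \<Longrightarrow> cmod (d z) \<le> K" and K: "0 \<le> K"
    and \<xi>: "\<xi> \<in> ell2 I"
  shows "shift_op t d \<xi> \<in> ell2 I" and "ell2_norm I (shift_op t d \<xi>) \<le> K * ell2_norm I \<xi>"
proof -
  have z: "shift_op t d \<xi> i = 0" if "i \<notin> I" for i using that by (cases i) (auto simp: shift_op_def)
  have le: "L2_set (\<lambda>i. cmod (shift_op t d \<xi> i)) B \<le> K * ell2_norm I \<xi>"
    if B: "finite B" "B \<subseteq> I" for B
  proof -
    let ?\<phi> = "\<lambda>(s, y). (inv t \<otimes> s, y)"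
    have inj: "inj_on ?\<phi> B" using B t by (auto simp: inj_on_def subset_iff)
    have "L2_set (\<lambda>i. cmod (shift_op t d \<xi> i)) B \<le> L2_set (\<lambda>i. K * cmod (\<xi> (?\<phi> i))) B"
      by (rule L2_set_mono) (use B d K in \<open>auto simp: shift_op_def norm_mult intro!: mult_right_mono\<close>)
    also have "\<dots> = K * L2_set (\<lambda>i. cmod (\<xi> i)) (?\<phi> ` B)"
      unfolding L2_set_right_distrib[OF K] by (simp add: L2_set_def sum.reindex[OF inj] comp_def)
    also have "\<dots> \<le> K * ell2_norm I \<xi>"
      by (intro mult_left_mono L2_set_le_ell2_norm \<xi>) (use B t K in auto)
    finally show ?thesis .
  qed
  show "shift_op t d \<xi> \<in> ell2 I" "ell2_norm I (shift_op t d \<xi>) \<le> K * ell2_norm I \<xi>"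
    using ell2_boundI[OF z le] by simp_all
qed

lemma lreg_bound:
  assumes f: "f \<in> carrier CV" and k: "\<And>t z. t \<in> carrier G \<Longrightarrow> z \<in> X \<Longrightarrow> cmod (f t z) \<le> k t"
    and k0: "\<And>t. 0 \<le> k t" and \<xi>: "\<xi> \<in> ell2 I"
  shows "lreg f \<xi> \<in> ell2 I"
    and "ell2_norm I (lreg f \<xi>) \<le> (\<Sum>t\<in>{t\<in>carrier G. f t \<noteq> (\<lambda>_. 0)}. k t) * ell2_norm I \<xi>"
proof -
  let ?F = "{t\<in>carrier G. f t \<noteq> (\<lambda>_. 0)}"
  have b: "shift_op t (f t) \<xi> \<in> ell2 I \<and> ell2_norm I (shift_op t (f t) \<xi>) \<le> k t * ell2_norm I \<xi>"
    if "t \<in> ?F" for t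
    using shift_op_bound[of t "f t" "k t" \<xi>] that k k0 \<xi> by simp
  have s: "lreg f \<xi> \<in> ell2 I \<and> ell2_norm I (lreg f \<xi>) \<le> (\<Sum>t\<in>?F. ell2_norm I (shift_op t (f t) \<xi>))"
    unfolding lreg_def by (rule ell2_sum) (use b CV_support[OF f] in auto)
  then show "lreg f \<xi> \<in> ell2 I" by simp
  have "(\<Sum>t\<in>?F. ell2_norm I (shift_op t (f t) \<xi>)) \<le> (\<Sum>t\<in>?F. k t * ell2_norm I \<xi>)"
    by (rule sum_mono) (use b in simp)
  then show "ell2_norm I (lreg f \<xi>) \<le> (\<Sum>t\<in>?F. k t) * ell2_norm I \<xi>"
    using s by (simp add: sum_distrib_right)
qed

text \<open>Every coordinate of \<open>lreg f \<xi>\<close> depends on finitely many coordinates of \<open>\<xi>\<close>, so truncation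
  extends bounds from finitely supported vectors to all of \<open>\<ell>\<^sup>2\<close>.\<close>

lemma lreg_bound_extend:
  assumes f: "f \<in> carrier CV" and K: "0 \<le> K"
    and le: "\<And>\<xi>. \<xi> \<in> fin_supp I \<Longrightarrow> ell2_norm I (lreg f \<xi>) \<le> K * ell2_norm I \<xi>"
    and \<xi>: "\<xi> \<in> ell2 I"
  shows "ell2_norm I (lreg f \<xi>) \<le> K * ell2_norm I \<xi>"
proof (rule ell2_boundI(2))
  show "lreg f \<xi> i = 0" if "i \<notin> I" for i using that by (rule lreg_outside)
  let ?F = "{t\<in>carrier G. f t \<noteq> (\<lambda>_. 0)}"
  fix B assume B: "finite B" "B \<subseteq> I"
  define C where "C = (\<lambda>(t, s, y). (inv t \<otimes> s, y)) ` (?F \<times> B)"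
  have C: "finite C" "C \<subseteq> I" using B CV_support[OF f] by (auto simp: C_def)
  define \<zeta> where "\<zeta> i = (if i \<in> C then \<xi> i else 0)" for i
  have \<zeta>: "\<zeta> \<in> fin_supp I" by (rule fin_suppI[OF C]) (simp add: \<zeta>_def)
  have eq: "lreg f \<zeta> i = lreg f \<xi> i" if "i \<in> B" for i
  proof -
    obtain s y where i: "i = (s, y)" by (cases i)
    have "(inv t \<otimes> s, y) \<in> C" if "t \<in> ?F" for t
      using that \<open>i \<in> B\<close> unfolding C_def i by (intro image_eqI[of _ _ "(t, s, y)"]) auto
    then show ?thesis
      unfolding lreg_def i by (intro sum.cong refl) (simp add: shift_op_def \<zeta>_def)
  qed
  have "L2_set (\<lambda>i. cmod (lreg f \<xi> i)) B = L2_set (\<lambda>i. cmod (lreg f \<zeta> i)) B"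
    by (rule L2_set_cong) (simp_all add: eq)
  also have "\<dots> \<le> ell2_norm I (lreg f \<zeta>)"
    by (rule L2_set_le_ell2_norm[OF fin_supp_ell2[OF lreg_fin_supp[OF f \<zeta>]] B])
  also have "\<dots> \<le> K * ell2_norm I \<zeta>" by (rule le[OF \<zeta>])
  also have "ell2_norm I \<zeta> = L2_set (\<lambda>i. cmod (\<zeta> i)) C"
    by (rule ell2_norm_finite[OF C]) (simp add: \<zeta>_def)
  also have "\<dots> = L2_set (\<lambda>i. cmod (\<xi> i)) C" by (rule L2_set_cong) (simp_all add: \<zeta>_def)
  also have "K * \<dots> \<le> K * ell2_norm I \<xi>"
    by (intro mult_left_mono L2_set_le_ell2_norm \<xi> C K)
  finally show "L2_set (\<lambda>i. cmod (lreg f \<xi> i)) B \<le> K * ell2_norm I \<xi>"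
    by (simp add: mult_left_mono K)
qed

end

context group_on_set
begin

lemma cc_alg_ops [simp]:
  "sadd (cc_alg G E tr) = (\<lambda>f g s y. f s y + g s y)"
  "sscale (cc_alg G E tr) = (\<lambda>c f s y. c * f s y)"
  by (simp_all add: cc_alg_def)

lemma CV_add_closed: "f \<in> carrier CV \<Longrightarrow> g \<in> carrier CV \<Longrightarrow> (\<lambda>s y. f s y + g s y) \<in> carrier CV"
proof -
  assume f: "f \<in> carrier CV" and g: "g \<in> carrier CV"
  have "{s. (\<lambda>y. f s y + g s y) \<noteq> (\<lambda>_. 0)} \<subseteq> {s. f s \<noteq> (\<lambda>_. 0)} \<union> {s. g s \<noteq> (\<lambda>_. 0)}"
    by (auto simp: fun_eq_iff)
  then have "finite {s. (\<lambda>y. f s y + g s y) \<noteq> (\<lambda>_. 0)}"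
    by (rule finite_subset) (use f g in \<open>simp add: mem_CV\<close>)
  then show ?thesis unfolding mem_CV using CV_outside[OF f] CV_outside[OF g] by auto
qed

lemma CV_scale_closed: "f \<in> carrier CV \<Longrightarrow> (\<lambda>s y. c * f s y) \<in> carrier CV"
proof -
  assume f: "f \<in> carrier CV"
  have "{s. (\<lambda>y. c * f s y) \<noteq> (\<lambda>_. 0)} \<subseteq> {s. f s \<noteq> (\<lambda>_. 0)}"
    by (auto simp: fun_eq_iff)
  then have "finite {s. (\<lambda>y. c * f s y) \<noteq> (\<lambda>_. 0)}"
    by (rule finite_subset) (use f in \<open>simp add: mem_CV\<close>)
  then show ?thesis unfolding mem_CV using CV_outside[OF f] by auto
qed

lemma star_algebra_CV: "star_algebra CV"
proof
  show "carrier CV \<noteq> {}"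
  proof -
    have "(\<lambda>_ _. 0) \<in> carrier CV" by (simp add: mem_CV)
    then show ?thesis by blast
  qed
next
  fix f g h assume f: "f \<in> carrier CV" and g: "g \<in> carrier CV" and h: "h \<in> carrier CV"
  note c = CV_add_closed CV_scale_closed CV_mult_closed f g h
  show "smult CV (smult CV f g) h = smult CV f (smult CV g h)"
    by (rule lreg_inject) (simp_all add: lreg_mult c)
  show "smult CV (sadd CV f g) h = sadd CV (smult CV f h) (smult CV g h)"
    by (rule lreg_inject) (simp_all add: lreg_mult lreg_add c)
  show "smult CV f (sadd CV g h) = sadd CV (smult CV f g) (smult CV f h)"
    by (rule lreg_inject) (simp_all add: lreg_mult lreg_add lreg_vec_add c)
next
  fix c f g assume f: "f \<in> carrier CV" and g: "g \<in> carrier CV"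
  note c = CV_scale_closed CV_mult_closed f g
  show "smult CV (sscale CV c f) g = sscale CV c (smult CV f g)"
    by (rule lreg_inject) (simp_all add: lreg_mult lreg_scale c)
  show "smult CV f (sscale CV c g) = sscale CV c (smult CV f g)"
    by (rule lreg_inject) (simp_all add: lreg_mult lreg_scale lreg_vec_scale c)
next
  fix f assume f: "f \<in> carrier CV"
  show "sstar CV (sstar CV f) = f"
  proof (intro ext)
    fix s y show "sstar CV (sstar CV f) s y = f s y"
      using CV_outside[OF f, of s y] star_outside[of s y]
      by (cases "(s, y) \<in> I") (auto simp: star_apply)
  qed
  show "sstar CV (sscale CV c f) = sscale CV (cnj c) (sstar CV f)" for c
    by (auto simp: cc_alg_def translate_def fun_eq_iff)
  fix g assume g: "g \<in> carrier CV"
  show "sstar CV (sadd CV f g) = sadd CV (sstar CV f) (sstar CV g)"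
    by (auto simp: cc_alg_def translate_def fun_eq_iff)
qed (simp_all add: CV_add_closed CV_scale_closed CV_mult_closed CV_star_closed CV_star_mult
    fun_eq_iff algebra_simps)

sublocale CV: star_algebra CV by (rule star_algebra_CV)

subsection \<open>Homogeneous elements\<close>

definition single :: "'a \<Rightarrow> ('x \<Rightarrow> complex) \<Rightarrow> 'a \<Rightarrow> 'x \<Rightarrow> complex" where
  "single t d = (\<lambda>s. if s = t then d else (\<lambda>_. 0))"

lemma single_CV: "t \<in> carrier G \<Longrightarrow> d \<in> vanishing \<Longrightarrow> single t d \<in> carrier CV"
  unfolding mem_CV
  by (auto simp: single_def vanishing_def intro: finite_subset[of _ "{t}"])

lemma single_mult_apply:
  assumes "t \<in> carrier G" "d \<in> vanishing"
  shows "smult CV (single t d) f =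
    (\<lambda>s. if s \<in> carrier G then \<lambda>y. d y * tr t (f (inv t \<otimes> s)) y else (\<lambda>_. 0))"
proof (intro ext)
  fix s y
  show "smult CV (single t d) f s y =
    (if s \<in> carrier G then \<lambda>y. d y * tr t (f (inv t \<otimes> s)) y else (\<lambda>_. 0)) y"
  proof (cases "d = (\<lambda>_. 0)")
    case True
    then have "{u \<in> carrier G. single t d u \<noteq> (\<lambda>_. 0)} = {}" by (auto simp: single_def)
    then show ?thesis by (simp add: cc_alg_def True)
  next
    case False
    then have "{u \<in> carrier G. single t d u \<noteq> (\<lambda>_. 0)} = {t}"
      using assms by (auto simp: single_def)
    then show ?thesis by (simp add: cc_alg_def single_def)
  qed
qed

lemma single_mult_single:
  assumes "t \<in> carrier G" "d \<in> vanishing" "u \<in> carrier G"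
  shows "smult CV (single t d) (single u e) = single (t \<otimes> u) (\<lambda>y. d y * tr t e y)"
proof -
  have "inv t \<otimes> s = u \<longleftrightarrow> s = t \<otimes> u" if "s \<in> carrier G" for s
    using assms that by (metis inv_mult_cancel)
  then show ?thesis
    unfolding single_mult_apply[OF assms(1,2)]
    using assms by (auto simp: single_def translate_def fun_eq_iff)
qed

lemma star_single:
  assumes "t \<in> carrier G"
  shows "sstar CV (single t d) = single (inv t) (tr (inv t) (\<lambda>y. cnj (d y)))"
proof -
  have "inv s = t \<longleftrightarrow> s = inv t" if "s \<in> carrier G" for s
    using assms that by auto
  then show ?thesis
    using assms by (auto simp: cc_alg_def single_def translate_def fun_eq_iff)
qed

lemma tr_one: "d \<in> vanishing \<Longrightarrow> tr \<one> d = d"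
  by (auto simp: translate_def vanishing_def)

lemma tr_vanishing: "tr t d \<in> vanishing"
  by (auto simp: translate_def vanishing_def)

text \<open>With the C*-identity this reduces the norm of \<open>d \<delta>\<^sub>t\<close> to that of a coefficient at the identity.\<close>

lemma star_single_mult_single:
  assumes "t \<in> carrier G"
  shows "smult CV (sstar CV (single t d)) (single t d) = single \<one> (tr (inv t) (\<lambda>y. cnj (d y) * d y))"
proof -
  have "(\<lambda>y. tr (inv t) (\<lambda>y. cnj (d y)) y * tr (inv t) d y) = tr (inv t) (\<lambda>y. cnj (d y) * d y)"
    by (simp add: translate_def fun_eq_iff)
  then show ?thesis
    using assms by (simp add: star_single single_mult_single tr_vanishing)
qed

end

section \<open>Norms on the convolution algebra\<close>

text \<open>The coefficients need not contain a unit. Closure under \<open>h \<mapsto> 1 - \<surd>(1 - h\<^sup>2)\<close>, a function that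
  vanishes at \<open>0\<close>, is what makes the unitary \<open>h + \<i> \<surd>(1 - h\<^sup>2)\<close> a multiplier of \<open>E\<close> all the same.\<close>

locale function_algebra = group_on_set G X act
  for G (structure) and X :: "'x set" and act +
  fixes E :: "('x \<Rightarrow> complex) set"
  assumes E_vanish: "d \<in> E \<Longrightarrow> y \<notin> X \<Longrightarrow> d y = 0"
    and E_bounded: "d \<in> E \<Longrightarrow> \<exists>K. \<forall>y. cmod (d y) \<le> K"
    and E_zero: "(\<lambda>_. 0) \<in> E"
    and E_add: "d \<in> E \<Longrightarrow> e \<in> E \<Longrightarrow> (\<lambda>y. d y + e y) \<in> E"
    and E_scale: "d \<in> E \<Longrightarrow> (\<lambda>y. c * d y) \<in> E"
    and E_mult: "d \<in> E \<Longrightarrow> e \<in> E \<Longrightarrow> (\<lambda>y. d y * e y) \<in> E"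
    and E_cnj: "d \<in> E \<Longrightarrow> (\<lambda>y. cnj (d y)) \<in> E"
    and E_tr: "t \<in> carrier G \<Longrightarrow> d \<in> E \<Longrightarrow> translate G X act t d \<in> E"
    and E_sqrt: "(\<lambda>y. of_real (h y)) \<in> E \<Longrightarrow> (\<And>y. \<bar>h y\<bar> \<le> 1) \<Longrightarrow>
        (\<lambda>y. of_real (1 - sqrt (1 - (h y)\<^sup>2))) \<in> E"
begin

abbreviation "A \<equiv> cc_alg G E tr"

lemma A_mult_eq: "smult A = smult CV"
  and A_star_eq: "sstar A = sstar CV"
  by (simp_all add: cc_alg_def)

lemma E_vanishing: "d \<in> E \<Longrightarrow> d \<in> vanishing"
  using E_vanish by (auto simp: vanishing_def)

lemma E_sum: "finite F \<Longrightarrow> (\<And>t. t \<in> F \<Longrightarrow> d t \<in> E) \<Longrightarrow> (\<lambda>y. \<Sum>t\<in>F. d t y) \<in> E"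
  by (induction F rule: finite_induct) (simp_all add: E_zero E_add)

lemma mem_A:
  "f \<in> carrier A \<longleftrightarrow> (\<forall>s\<in>carrier G. f s \<in> E) \<and> (\<forall>s. s \<notin> carrier G \<longrightarrow> f s = (\<lambda>_. 0)) \<and>
    finite {s. f s \<noteq> (\<lambda>_. 0)}"
  by (simp add: cc_alg_def)

lemma A_E: "f \<in> carrier A \<Longrightarrow> f s \<in> E"
  unfolding mem_A using E_zero by (cases "s \<in> carrier G") auto

lemma A_CV: "f \<in> carrier A \<Longrightarrow> f \<in> carrier CV"
  using E_vanishing by (auto simp: cc_alg_def)

lemma mem_A_iff_CV: "f \<in> carrier A \<longleftrightarrow> f \<in> carrier CV \<and> (\<forall>s\<in>carrier G. f s \<in> E)"
  using E_vanishing by (auto simp: cc_alg_def)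

lemma A_eq: "CV\<lparr>carrier := carrier A\<rparr> = A"
  by (simp add: cc_alg_def)

lemma star_algebra_A: "star_algebra A"
proof -
  have "star_algebra (CV\<lparr>carrier := carrier A\<rparr>)"
  proof (rule CV.star_subalgebra)
    show "carrier A \<subseteq> carrier CV" using A_CV by blast
    have "(\<lambda>_ _. 0) \<in> carrier A" by (simp add: mem_A E_zero)
    then show "carrier A \<noteq> {}" by blast
    show "sadd CV f g \<in> carrier A" if "f \<in> carrier A" "g \<in> carrier A" for f g
      using that CV.add_closed[of f g] by (auto simp: mem_A_iff_CV intro: E_add)
    show "sscale CV c f \<in> carrier A" if "f \<in> carrier A" for c f
      using that CV.scale_closed[of f c] by (auto simp: mem_A_iff_CV intro: E_scale)
    show "smult CV f g \<in> carrier A" if f: "f \<in> carrier A" and g: "g \<in> carrier A" for f g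
    proof -
      have "smult CV f g s \<in> E" if "s \<in> carrier G" for s
      proof -
        have "smult CV f g s = (\<lambda>y. \<Sum>t\<in>{t\<in>carrier G. f t \<noteq> (\<lambda>_. 0)}. f t y * tr t (g (inv t \<otimes> s)) y)"
          using that by (simp add: cc_alg_def)
        then show ?thesis
          using CV_support[OF A_CV[OF f]] A_E[OF f] A_E[OF g] by (auto intro!: E_sum E_mult E_tr)
      qed
      then show ?thesis
        using CV.mult_closed[OF A_CV[OF f] A_CV[OF g]] by (simp add: mem_A_iff_CV)
    qed
    show "sstar CV f \<in> carrier A" if f: "f \<in> carrier A" for f
    proof -
      have "sstar CV f s \<in> E" if "s \<in> carrier G" for s
        using that A_E[OF f] by (simp add: cc_alg_def E_tr E_cnj)
      then show ?thesis
        using CV.star_closed[OF A_CV[OF f]] by (simp add: mem_A_iff_CV)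
    qed
  qed
  then show ?thesis by (simp only: A_eq)
qed

sublocale A: star_algebra A by (rule star_algebra_A)

lemma single_A: "t \<in> carrier G \<Longrightarrow> d \<in> E \<Longrightarrow> single t d \<in> carrier A"
  using single_CV[of t d] E_vanishing[of d] by (auto simp: mem_A_iff_CV single_def E_zero)

text \<open>Splitting off one homogeneous term is the induction step for every argument on finite supports.\<close>

lemma peel_A:
  assumes "f \<in> carrier A"
  shows "f(t := (\<lambda>_. 0)) \<in> carrier A" and "sadd A (single t (f t)) (f(t := (\<lambda>_. 0))) = f"
proof -
  have "{s. (f(t := (\<lambda>_. 0))) s \<noteq> (\<lambda>_. 0)} \<subseteq> {s. f s \<noteq> (\<lambda>_. 0)}" by auto
  then have "finite {s. (f(t := (\<lambda>_. 0))) s \<noteq> (\<lambda>_. 0)}"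
    by (rule finite_subset) (use assms in \<open>simp add: mem_A\<close>)
  then show "f(t := (\<lambda>_. 0)) \<in> carrier A" using assms E_zero by (simp add: mem_A)
  show "sadd A (single t (f t)) (f(t := (\<lambda>_. 0))) = f"
    by (simp add: single_def fun_eq_iff)
qed

lemma A_induct [consumes 1, case_names single add]:
  assumes f: "f \<in> carrier A"
    and single: "\<And>t d. t \<in> carrier G \<Longrightarrow> d \<in> E \<Longrightarrow> P (single t d)"
    and add: "\<And>f g. f \<in> carrier A \<Longrightarrow> g \<in> carrier A \<Longrightarrow> P f \<Longrightarrow> P g \<Longrightarrow> P (sadd A f g)"
  shows "P f"
proof -
  have main: "finite F \<Longrightarrow> F \<subseteq> carrier G \<Longrightarrow> f \<in> carrier A \<Longrightarrow> {s. f s \<noteq> (\<lambda>_. 0)} \<subseteq> F \<Longrightarrow> P f" for F f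
  proof (induction F arbitrary: f rule: finite_induct)
    case empty
    then have "f = single \<one> (\<lambda>_. 0)" by (auto simp: single_def fun_eq_iff)
    then show ?case using single[of \<one> "\<lambda>_. 0"] E_zero by simp
  next
    case (insert t F)
    note p = peel_A[OF insert.prems(2), of t]
    have "{s. (f(t := (\<lambda>_. 0))) s \<noteq> (\<lambda>_. 0)} \<subseteq> F" using insert.prems(3) by auto
    then have "P (f(t := (\<lambda>_. 0)))"
      using insert.prems(1) by (intro insert.IH p(1)) simp_all
    moreover have "f t \<in> E" "t \<in> carrier G" using A_E[OF insert.prems(2)] insert.prems(1) by auto
    ultimately have "P (sadd A (single t (f t)) (f(t := (\<lambda>_. 0))))"
      by (intro add single single_A p(1))
    then show ?case by (simp only: p(2))
  qed
  have "finite {s. f s \<noteq> (\<lambda>_. 0)}" "{s. f s \<noteq> (\<lambda>_. 0)} \<subseteq> carrier G"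
    using f unfolding mem_A by blast+
  then show ?thesis using f order_refl by (rule main)
qed

subsection \<open>Every C*-seminorm is bounded by the \<open>\<ell>\<^sup>1\<close>-norm\<close>

context
  fixes p
  assumes p: "cstar_seminorm A p"
begin

interpretation p: seminormed_star_algebra A p by unfold_locales (rule p)

lemma seminorm_abs_sq:
  assumes "d \<in> E"
  shows "p (single \<one> (\<lambda>y. cnj (d y) * d y)) = (p (single \<one> d))\<^sup>2"
proof -
  have "(\<lambda>y. cnj (d y) * d y) \<in> vanishing" by (intro E_vanishing E_mult E_cnj assms)
  then show ?thesis
    using p.p_star_mult[OF single_A[OF one_closed assms]]
    by (simp add: A_mult_eq A_star_eq star_single_mult_single tr_one)
qed

text \<open>Multiplication by a unitary multiplier \<open>v\<close> preserves \<open>p\<close>, as \<open>(v d)* (v d) = d* d\<close>. Since \<open>h\<close> is the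
  mean of \<open>v\<close> and its conjugate, where \<open>v = h + \<i> \<surd>(1 - h\<^sup>2)\<close>, multiplication by \<open>h\<close> does not increase
  \<open>p\<close>; applied to \<open>h\<close> itself this says \<open>(p h)\<^sup>2 \<le> p h\<close>.\<close>

lemma seminorm_real_contraction:
  assumes h: "(\<lambda>y. of_real (h y)) \<in> E" and le: "\<And>y. \<bar>h y\<bar> \<le> 1"
  shows "p (single \<one> (\<lambda>y. of_real (h y))) \<le> 1"
proof -
  define w where "w y = complex_of_real (1 - sqrt (1 - (h y)\<^sup>2))" for y
  have w: "w \<in> E" unfolding w_def[abs_def] by (rule E_sqrt[OF h le])
  have isometry: "(\<lambda>y. (of_real (h y) + c * (1 - w y)) * d y) \<in> E \<and>
      p (single \<one> (\<lambda>y. (of_real (h y) + c * (1 - w y)) * d y)) = p (single \<one> d)"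
    if d: "d \<in> E" and c: "c = \<i> \<or> c = - \<i>" for d c
  proof -
    let ?v = "\<lambda>y. of_real (h y) + c * (1 - w y)"
    have "(\<lambda>y. of_real (h y) * d y + (c * d y + (- c) * (w y * d y))) \<in> E"
      by (intro E_add E_scale E_mult d h w)
    then have vd: "(\<lambda>y. ?v y * d y) \<in> E" by (simp add: algebra_simps)
    have v: "cnj (?v y) * ?v y = 1" for y
    proof -
      have "(h y)\<^sup>2 \<le> 1" using le[of y] by (simp add: abs_square_le_1)
      then have "(h y)\<^sup>2 + (sqrt (1 - (h y)\<^sup>2))\<^sup>2 = 1" by simp
      then have "complex_of_real (h y) * of_real (h y)
          + of_real (sqrt (1 - (h y)\<^sup>2)) * of_real (sqrt (1 - (h y)\<^sup>2)) = 1"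
        by (metis of_real_1 of_real_add of_real_mult power2_eq_square)
      then show ?thesis using c by (auto simp: w_def algebra_simps)
    qed
    have "(p (single \<one> (\<lambda>y. ?v y * d y)))\<^sup>2 = p (single \<one> (\<lambda>y. cnj (?v y * d y) * (?v y * d y)))"
      by (rule seminorm_abs_sq[OF vd, symmetric])
    also have "(\<lambda>y. cnj (?v y * d y) * (?v y * d y)) = (\<lambda>y. cnj (d y) * d y)"
    proof
      fix y
      have "cnj (?v y * d y) * (?v y * d y) = (cnj (?v y) * ?v y) * (cnj (d y) * d y)"
        by (simp only: complex_cnj_mult mult_ac)
      then show "cnj (?v y * d y) * (?v y * d y) = cnj (d y) * d y" by (simp only: v mult_1_left)
    qed
    also have "p (single \<one> (\<lambda>y. cnj (d y) * d y)) = (p (single \<one> d))\<^sup>2"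
      by (rule seminorm_abs_sq[OF d])
    finally have "p (single \<one> (\<lambda>y. ?v y * d y)) = p (single \<one> d)"
      using vd d single_A by (simp add: power2_eq_iff_nonneg)
    then show ?thesis using vd by blast
  qed
  let ?h = "\<lambda>y. complex_of_real (h y)"
  let ?a = "single \<one> (\<lambda>y. (?h y + \<i> * (1 - w y)) * ?h y)"
  let ?b = "single \<one> (\<lambda>y. (?h y + (- \<i>) * (1 - w y)) * ?h y)"
  note a = isometry[OF h disjI1[OF refl]] and b = isometry[OF h disjI2[OF refl]]
  have "single \<one> (\<lambda>y. cnj (?h y) * ?h y) = sscale A (1/2) (sadd A ?a ?b)"
    by (simp add: single_def fun_eq_iff algebra_simps)
  then have "(p (single \<one> ?h))\<^sup>2 = 1/2 * p (sadd A ?a ?b)"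
    using seminorm_abs_sq[OF h] a b single_A[OF one_closed]
    by (simp add: p.p_scale del: cc_alg_ops)
  also have "\<dots> \<le> 1/2 * (p ?a + p ?b)"
    using a b single_A[OF one_closed] by (intro mult_left_mono p.p_add) auto
  also have "\<dots> = p (single \<one> ?h)" using a b by simp
  finally have "p (single \<one> ?h) * p (single \<one> ?h) \<le> p (single \<one> ?h) * 1"
    by (simp add: power2_eq_square)
  moreover have "0 \<le> p (single \<one> ?h)" using h single_A by simp
  ultimately show ?thesis by (cases "p (single \<one> ?h) = 0") (auto simp: mult_le_cancel_left)
qed

text \<open>By the C*-identity it is enough to treat \<open>\<bar>d\<bar>\<^sup>2\<close>, which becomes a real contraction after division by
  \<open>L\<^sup>2\<close> for any \<open>L > K\<close>.\<close>

lemma seminorm_single_one_le: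
  assumes d: "d \<in> E" and le: "\<And>y. cmod (d y) \<le> K"
  shows "p (single \<one> d) \<le> K"
proof (rule field_le_epsilon)
  fix e :: real assume e: "0 < e"
  have K: "0 \<le> K" using order_trans[OF norm_ge_zero le] .
  define L where "L = K + e"
  have L: "0 < L" using e K by (simp add: L_def)
  define h where "h y = (cmod (d y))\<^sup>2 / L\<^sup>2" for y
  have hd: "complex_of_real (h y) = of_real (1 / L\<^sup>2) * (cnj (d y) * d y)" for y
    using complex_norm_square[of "d y"] by (simp add: h_def mult.commute)
  have hE: "(\<lambda>y. complex_of_real (h y)) \<in> E"
    unfolding hd by (intro E_scale E_mult E_cnj d)
  have "\<bar>h y\<bar> \<le> 1" for y
  proof -
    have "(cmod (d y))\<^sup>2 \<le> L\<^sup>2" using le[of y] e by (intro power_mono) (auto simp: L_def)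
    then show ?thesis using L by (simp add: h_def)
  qed
  then have "p (single \<one> (\<lambda>y. complex_of_real (h y))) \<le> 1"
    by (rule seminorm_real_contraction[OF hE])
  moreover have "single \<one> (\<lambda>y. complex_of_real (h y)) =
      sscale A (of_real (1 / L\<^sup>2)) (single \<one> (\<lambda>y. cnj (d y) * d y))"
    unfolding hd by (simp add: single_def fun_eq_iff)
  ultimately have "1 / L\<^sup>2 * p (single \<one> (\<lambda>y. cnj (d y) * d y)) \<le> 1"
    using single_A[OF one_closed E_mult[OF E_cnj[OF d] d]] p.p_scale[of "single \<one> (\<lambda>y. cnj (d y) * d y)" "of_real (1 / L\<^sup>2)"]
    by (simp add: norm_divide norm_power del: cc_alg_ops)
  then have "(p (single \<one> d))\<^sup>2 \<le> L\<^sup>2"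
    using L by (simp add: seminorm_abs_sq[OF d] divide_le_eq)
  then have "p (single \<one> d) \<le> L" by (rule power2_le_imp_le) (use L in simp)
  then show "p (single \<one> d) \<le> K + e" by (simp add: L_def)
qed

lemma seminorm_single_le:
  assumes t: "t \<in> carrier G" and d: "d \<in> E" and le: "\<And>y. cmod (d y) \<le> K"
  shows "p (single t d) \<le> K"
proof -
  have K: "0 \<le> K" using order_trans[OF norm_ge_zero le] .
  let ?e = "tr (inv t) (\<lambda>y. cnj (d y) * d y)"
  have "(p (single t d))\<^sup>2 = p (single \<one> ?e)"
    using p.p_star_mult[OF single_A[OF t d]] t
    by (simp add: A_mult_eq A_star_eq star_single_mult_single)
  also have "\<dots> \<le> K\<^sup>2"
  proof (rule seminorm_single_one_le)
    show "?e \<in> E" using t by (intro E_tr E_mult E_cnj d) auto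
    have "cmod (cnj (d y) * d y) \<le> K\<^sup>2" for y
      using power_mono[OF le[of y] norm_ge_zero, of 2] by (simp add: norm_mult power2_eq_square)
    then show "cmod (?e y) \<le> K\<^sup>2" for y
      using K by (simp add: translate_def)
  qed
  finally show ?thesis using K by (rule power2_le_imp_le)
qed

lemma seminorm_le_l1:
  assumes f: "f \<in> carrier A" and F: "finite F" "F \<subseteq> carrier G" "{s. f s \<noteq> (\<lambda>_. 0)} \<subseteq> F"
    and le: "\<And>t y. t \<in> F \<Longrightarrow> cmod (f t y) \<le> k t"
  shows "p f \<le> (\<Sum>t\<in>F. k t)"
  using F f le
proof (induction F arbitrary: f rule: finite_induct)
  case empty
  have "f s = (\<lambda>_. 0)" for s using empty.prems(2) by blast
  then have "sscale A 0 f = f" by (simp add: fun_eq_iff)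
  then show ?case using p.p_scale[OF empty.prems(3), of 0] by (simp del: cc_alg_ops)
next
  case (insert t F)
  note q = peel_A[OF insert.prems(3), of t]
  have "p (f(t := (\<lambda>_. 0))) \<le> (\<Sum>t\<in>F. k t)"
  proof (rule insert.IH[OF _ _ q(1)])
    show "F \<subseteq> carrier G" using insert.prems(1) by blast
    show "{s. (f(t := (\<lambda>_. 0))) s \<noteq> (\<lambda>_. 0)} \<subseteq> F" using insert.prems(2) by auto
    fix s y assume "s \<in> F"
    then show "cmod ((f(t := (\<lambda>_. 0))) s y) \<le> k s"
      using insert.prems(4)[of s y] insert.hyps by auto
  qed
  moreover have t: "t \<in> carrier G" "f t \<in> E" using insert.prems(1) A_E[OF insert.prems(3)] by auto
  then have s: "single t (f t) \<in> carrier A" by (rule single_A)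
  moreover have "p (single t (f t)) \<le> k t"
    using t insert.prems(4) by (intro seminorm_single_le) simp_all
  moreover have "p f \<le> p (single t (f t)) + p (f(t := (\<lambda>_. 0)))"
    using p.p_add[OF s q(1)] by (simp only: q(2))
  ultimately show ?case using insert.hyps by simp
qed

end

end

context function_algebra
begin

subsection \<open>The full norm\<close>

abbreviation "full \<equiv> full_norm G E tr"

lemma A_bounded:
  assumes "f \<in> carrier A"
  shows "\<exists>k. (\<forall>t. 0 \<le> k t) \<and> (\<forall>t y. cmod (f t y) \<le> k t)"
proof -
  have "\<forall>t. \<exists>K. \<forall>y. cmod (f t y) \<le> K" using E_bounded[OF A_E[OF assms]] by blast
  then obtain k where k: "\<forall>t. \<forall>y. cmod (f t y) \<le> k t" unfolding choice_iff by blast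
  then have "0 \<le> k t" for t using order_trans[OF norm_ge_zero] by blast
  then show ?thesis using k by blast
qed

lemma full_norm_bdd:
  assumes f: "f \<in> carrier A"
  shows "bdd_above {p f |p. cstar_seminorm A p}"
proof -
  obtain k where k: "\<forall>t y. cmod (f t y) \<le> k t" using A_bounded[OF f] by blast
  have "{s. f s \<noteq> (\<lambda>_. 0)} \<subseteq> carrier G" "finite {s. f s \<noteq> (\<lambda>_. 0)}"
    using f unfolding mem_A by blast+
  then have "p f \<le> (\<Sum>t\<in>{s. f s \<noteq> (\<lambda>_. 0)}. k t)" if "cstar_seminorm A p" for p
    using k by (intro seminorm_le_l1[OF that f]) auto
  then show ?thesis by (intro bdd_aboveI[of _ "\<Sum>t\<in>{s. f s \<noteq> (\<lambda>_. 0)}. k t"]) blast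
qed

lemma full_norm_upper: "cstar_seminorm A p \<Longrightarrow> f \<in> carrier A \<Longrightarrow> p f \<le> full f"
  unfolding full_norm_def by (rule cSup_upper[OF _ full_norm_bdd]) blast

lemma zero_seminorm: "cstar_seminorm A (\<lambda>_. 0)"
  unfolding cstar_seminorm_def by simp

lemma full_norm_least:
  assumes "\<And>p. cstar_seminorm A p \<Longrightarrow> p f \<le> B"
  shows "full f \<le> B"
  unfolding full_norm_def
proof (rule cSup_least)
  show "{p f |p. cstar_seminorm A p} \<noteq> {}" using zero_seminorm by blast
qed (use assms in blast)

lemma full_norm_nonneg: "f \<in> carrier A \<Longrightarrow> 0 \<le> full f"
  using full_norm_upper[OF zero_seminorm] .

lemma cstar_seminorm_full: "cstar_seminorm A full"
proof (rule A.cstar_seminormI)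
  fix f assume f: "f \<in> carrier A"
  show "0 \<le> full f" by (rule full_norm_nonneg[OF f])
  show "full (sscale A c f) \<le> cmod c * full f" for c
  proof (rule full_norm_least)
    fix p assume p: "cstar_seminorm A p"
    show "p (sscale A c f) \<le> cmod c * full f"
      unfolding cstar_seminorm_scale[OF p f] by (intro mult_left_mono full_norm_upper p f norm_ge_zero)
  qed
  have sf: "smult A (sstar A f) f \<in> carrier A" by (intro A.mult_closed A.star_closed f)
  have "full f \<le> sqrt (full (smult A (sstar A f) f))"
  proof (rule full_norm_least)
    fix p assume p: "cstar_seminorm A p"
    show "p f \<le> sqrt (full (smult A (sstar A f) f))"
      using full_norm_upper[OF p sf] unfolding cstar_seminorm_star_mult[OF p f]
      by (rule real_le_rsqrt)
  qed
  then have "(full f)\<^sup>2 \<le> (sqrt (full (smult A (sstar A f) f)))\<^sup>2"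
    by (intro power_mono full_norm_nonneg f)
  then show "(full f)\<^sup>2 \<le> full (smult A (sstar A f) f)"
    using full_norm_nonneg[OF sf] by simp
  fix g assume g: "g \<in> carrier A"
  show "full (sadd A f g) \<le> full f + full g"
  proof (rule full_norm_least)
    fix p assume p: "cstar_seminorm A p"
    show "p (sadd A f g) \<le> full f + full g"
      using cstar_seminorm_add[OF p f g] full_norm_upper[OF p f] full_norm_upper[OF p g] by linarith
  qed
  show "full (smult A f g) \<le> full f * full g"
  proof (rule full_norm_least)
    fix p assume p: "cstar_seminorm A p"
    have "p (smult A f g) \<le> p f * p g" by (rule cstar_seminorm_mult[OF p f g])
    also have "\<dots> \<le> full f * full g"
      by (intro mult_mono full_norm_upper p f g full_norm_nonneg cstar_seminorm_nonneg[OF p])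
    finally show "p (smult A f g) \<le> full f * full g" .
  qed
qed

subsection \<open>The reduced norm\<close>

abbreviation "Bop \<equiv> operator_alg I"
abbreviation "reg \<equiv> regular_rep_cc G X tr"

definition reduced_norm :: "('a \<Rightarrow> 'x \<Rightarrow> complex) \<Rightarrow> real" where
  "reduced_norm f = snorm Bop (reg f)"

lemma reg_apply: "\<xi> \<in> ell2 I \<Longrightarrow> reg f \<xi> = lreg f \<xi>"
  by (simp add: regular_rep_cc_eq)

lemma reg_bounded:
  assumes f: "f \<in> carrier A"
  shows "reg f \<in> bounded_operators I"
proof -
  obtain k where k: "\<forall>t. 0 \<le> k t" "\<forall>t y. cmod (f t y) \<le> k t" using A_bounded[OF f] by blast
  have mem: "lreg f \<xi> \<in> ell2 I" if "\<xi> \<in> ell2 I" for \<xi>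
    by (rule lreg_bound(1)[OF A_CV[OF f], of k]) (use k that in auto)
  have "ell2_norm I (lreg f \<xi>) \<le> (\<Sum>t\<in>{t\<in>carrier G. f t \<noteq> (\<lambda>_. 0)}. k t) * ell2_norm I \<xi>"
    if "\<xi> \<in> ell2 I" for \<xi>
    by (rule lreg_bound(2)[OF A_CV[OF f], of k]) (use k that in auto)
  then have "\<exists>K. \<forall>\<xi>\<in>ell2 I. ell2_norm I (lreg f \<xi>) \<le> K * ell2_norm I \<xi>" by blast
  then show ?thesis
    unfolding bounded_operators_def regular_rep_cc_eq
    by (simp add: mem ell2_add ell2_scale lreg_vec_add lreg_vec_scale)
qed

lemma reduced_norm_nonneg: "f \<in> carrier A \<Longrightarrow> 0 \<le> reduced_norm f"
  unfolding reduced_norm_def by (intro operator_norm_nonneg reg_bounded)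

lemma reduced_norm_bound:
  "f \<in> carrier A \<Longrightarrow> \<xi> \<in> ell2 I \<Longrightarrow> ell2_norm I (lreg f \<xi>) \<le> reduced_norm f * ell2_norm I \<xi>"
  using operator_norm_bound[OF reg_bounded, of f \<xi>] by (simp add: reduced_norm_def reg_apply)

lemma reduced_norm_le:
  assumes f: "f \<in> carrier A" and K: "0 \<le> K"
    and le: "\<And>\<xi>. \<xi> \<in> fin_supp I \<Longrightarrow> ell2_norm I (lreg f \<xi>) \<le> K * ell2_norm I \<xi>"
  shows "reduced_norm f \<le> K"
  unfolding reduced_norm_def
proof (rule operator_norm_le[OF K])
  fix \<xi> assume "\<xi> \<in> ell2 I"
  then show "ell2_norm I (reg f \<xi>) \<le> K * ell2_norm I \<xi>"
    using lreg_bound_extend[OF A_CV[OF f] K le] by (simp add: reg_apply)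
qed

text \<open>\<open>\<parallel>f \<xi>\<parallel>\<^sup>2 = \<langle>\<xi>, f* f \<xi>\<rangle>\<close>, followed by the Cauchy-Schwarz inequality.\<close>

lemma lreg_norm_sq_le:
  assumes f: "f \<in> carrier CV" and \<xi>: "\<xi> \<in> fin_supp I"
  shows "(ell2_norm I (lreg f \<xi>))\<^sup>2 \<le>
    ell2_norm I \<xi> * ell2_norm I (lreg (smult CV (sstar CV f) f) \<xi>)"
proof -
  note m = lreg_fin_supp[OF f \<xi>]
  have "complex_of_real ((ell2_norm I (lreg f \<xi>))\<^sup>2) = ell2_inner I (lreg f \<xi>) (lreg f \<xi>)"
    by (rule ell2_norm_sq_fin_supp[OF m, symmetric])
  also have "\<dots> = ell2_inner I \<xi> (lreg (smult CV (sstar CV f) f) \<xi>)"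
    unfolding lreg_adjoint[OF f \<xi> m] lreg_mult[OF CV_star_closed[OF f] f] by (rule refl)
  finally have "(ell2_norm I (lreg f \<xi>))\<^sup>2 = cmod (ell2_inner I \<xi> (lreg (smult CV (sstar CV f) f) \<xi>))"
    by (metis abs_of_nonneg norm_of_real zero_le_power2)
  also have "\<dots> \<le> ell2_norm I \<xi> * ell2_norm I (lreg (smult CV (sstar CV f) f) \<xi>)"
    by (intro ell2_cauchy_schwarz \<xi> fin_supp_ell2 lreg_fin_supp CV_mult_closed CV_star_closed f)
  finally show ?thesis .
qed

lemma cstar_seminorm_reduced: "cstar_seminorm A reduced_norm"
proof (rule A.cstar_seminormI)
  fix f assume f: "f \<in> carrier A"
  show "0 \<le> reduced_norm f" by (rule reduced_norm_nonneg[OF f])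
  show "reduced_norm (sscale A c f) \<le> cmod c * reduced_norm f" for c
  proof (rule reduced_norm_le)
    fix \<xi> assume "\<xi> \<in> fin_supp I"
    then have "ell2_norm I (lreg f \<xi>) \<le> reduced_norm f * ell2_norm I \<xi>"
      by (intro reduced_norm_bound f fin_supp_ell2)
    then have "cmod c * ell2_norm I (lreg f \<xi>) \<le> cmod c * (reduced_norm f * ell2_norm I \<xi>)"
      by (intro mult_left_mono) auto
    then show "ell2_norm I (lreg (sscale A c f) \<xi>) \<le> cmod c * reduced_norm f * ell2_norm I \<xi>"
      by (simp add: lreg_scale[OF A_CV[OF f]] ell2_norm_scale mult.assoc)
  qed (use f reduced_norm_nonneg[OF f] A.scale_closed[OF f, of c] in simp_all)
  have sf: "smult A (sstar A f) f \<in> carrier A" by (intro A.mult_closed A.star_closed f)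
  have "reduced_norm f \<le> sqrt (reduced_norm (smult A (sstar A f) f))"
  proof (rule reduced_norm_le[OF f])
    show "0 \<le> sqrt (reduced_norm (smult A (sstar A f) f))"
      using reduced_norm_nonneg[OF sf] by simp
    fix \<xi> assume \<xi>: "\<xi> \<in> fin_supp I"
    have "(ell2_norm I (lreg f \<xi>))\<^sup>2 \<le> ell2_norm I \<xi> * ell2_norm I (lreg (smult A (sstar A f) f) \<xi>)"
      using lreg_norm_sq_le[OF A_CV[OF f] \<xi>] by (simp only: A_mult_eq A_star_eq)
    also have "\<dots> \<le> ell2_norm I \<xi> * (reduced_norm (smult A (sstar A f) f) * ell2_norm I \<xi>)"
      by (intro mult_left_mono reduced_norm_bound sf fin_supp_ell2 \<xi> ell2_norm_nonneg)
    also have "\<dots> = (sqrt (reduced_norm (smult A (sstar A f) f)) * ell2_norm I \<xi>)\<^sup>2"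
      using reduced_norm_nonneg[OF sf] by (simp add: power_mult_distrib power2_eq_square)
    finally show "ell2_norm I (lreg f \<xi>) \<le> sqrt (reduced_norm (smult A (sstar A f) f)) * ell2_norm I \<xi>"
      by (rule power2_le_imp_le) (use reduced_norm_nonneg[OF sf] in simp)
  qed
  then have "(reduced_norm f)\<^sup>2 \<le> (sqrt (reduced_norm (smult A (sstar A f) f)))\<^sup>2"
    by (intro power_mono reduced_norm_nonneg f)
  then show "(reduced_norm f)\<^sup>2 \<le> reduced_norm (smult A (sstar A f) f)"
    using reduced_norm_nonneg[OF sf] by simp
  fix g assume g: "g \<in> carrier A"
  show "reduced_norm (smult A f g) \<le> reduced_norm f * reduced_norm g"
  proof (rule reduced_norm_le)
    show "0 \<le> reduced_norm f * reduced_norm g" by (intro mult_nonneg_nonneg reduced_norm_nonneg f g)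
    fix \<xi> assume \<xi>: "\<xi> \<in> fin_supp I"
    have "ell2_norm I (lreg f (lreg g \<xi>)) \<le> reduced_norm f * ell2_norm I (lreg g \<xi>)"
      by (intro reduced_norm_bound f fin_supp_ell2 lreg_fin_supp A_CV[OF g] \<xi>)
    also have "\<dots> \<le> reduced_norm f * (reduced_norm g * ell2_norm I \<xi>)"
      by (intro mult_left_mono reduced_norm_bound g fin_supp_ell2 \<xi> reduced_norm_nonneg f)
    finally show "ell2_norm I (lreg (smult A f g) \<xi>) \<le> reduced_norm f * reduced_norm g * ell2_norm I \<xi>"
      by (simp add: A_mult_eq lreg_mult[OF A_CV[OF f] A_CV[OF g]] mult.assoc)
  qed (use f g in simp)
  show "reduced_norm (sadd A f g) \<le> reduced_norm f + reduced_norm g"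
  proof (rule reduced_norm_le[OF A.add_closed[OF f g]])
    show "0 \<le> reduced_norm f + reduced_norm g"
      by (intro add_nonneg_nonneg reduced_norm_nonneg f g)
    fix \<xi> assume \<xi>: "\<xi> \<in> fin_supp I"
    have "ell2_norm I (\<lambda>i. lreg f \<xi> i + lreg g \<xi> i) \<le> ell2_norm I (lreg f \<xi>) + ell2_norm I (lreg g \<xi>)"
      by (intro ell2_norm_add fin_supp_ell2 lreg_fin_supp A_CV f g \<xi>)
    also have "\<dots> \<le> reduced_norm f * ell2_norm I \<xi> + reduced_norm g * ell2_norm I \<xi>"
      by (intro add_mono reduced_norm_bound f g fin_supp_ell2 \<xi>)
    finally show "ell2_norm I (lreg (sadd A f g) \<xi>) \<le> (reduced_norm f + reduced_norm g) * ell2_norm I \<xi>"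
      by (simp add: lreg_add[OF A_CV[OF f] A_CV[OF g]] distrib_right)
  qed
qed

text \<open>An operator of norm \<open>0\<close> has no nonzero matrix entry.\<close>

lemma reduced_norm_faithful:
  assumes f: "f \<in> carrier A" and z: "reduced_norm f = 0"
  shows "f = sscale A 0 f"
proof -
  have c: "(\<lambda>s y. 0 * f s y) \<in> carrier CV" by (rule CV_scale_closed[OF A_CV[OF f]])
  have "lreg f \<xi> = lreg (\<lambda>s y. 0 * f s y) \<xi>" if \<xi>: "\<xi> \<in> fin_supp I" for \<xi>
  proof
    fix i
    have "cmod (lreg f \<xi> i) \<le> ell2_norm I (lreg f \<xi>)"
      by (intro cmod_le_ell2_norm fin_supp_ell2 lreg_fin_supp A_CV f \<xi>)
    also have "\<dots> \<le> 0"
      using reduced_norm_bound[OF f fin_supp_ell2[OF \<xi>]] z by simp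
    finally show "lreg f \<xi> i = lreg (\<lambda>s y. 0 * f s y) \<xi> i"
      unfolding lreg_scale[OF A_CV[OF f]] by simp
  qed
  then have "f = (\<lambda>s y. 0 * f s y)" by (rule lreg_inject[OF A_CV[OF f] c])
  then show ?thesis by simp
qed

lemma reduced_le_full: "f \<in> carrier A \<Longrightarrow> reduced_norm f \<le> full f"
  by (rule full_norm_upper[OF cstar_seminorm_reduced])

subsection \<open>Seminorms that dominate the conditional expectation\<close>

lemma lreg_vec_sum:
  "finite B \<Longrightarrow> lreg f (\<lambda>j. \<Sum>i\<in>B. \<eta> i j) = (\<lambda>j. \<Sum>i\<in>B. lreg f (\<eta> i) j)"
proof (induction B rule: finite_induct)
  case empty
  show ?case using lreg_vec_scale[of f 0 "\<lambda>_. 0"] by simp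
next
  case (insert i B)
  then show ?case using lreg_vec_add[of f "\<eta> i" "\<lambda>j. \<Sum>i\<in>B. \<eta> i j"] by simp
qed

text \<open>The vector state of \<open>\<delta>\<^sub>(\<^sub>s\<^sub>,\<^sub>y\<^sub>)\<close> is evaluation of the conditional expectation \<open>f \<mapsto> f \<one>\<close> at
  \<open>act s y\<close>. Hence a seminorm dominating the expectation bounds \<open>lreg f\<close> on basis vectors, so on every
  finitely supported vector up to a constant; passing to powers removes the constant.\<close>

lemma reduced_norm_le_of_expectation:
  assumes p: "cstar_seminorm A p"
    and expect: "\<And>f y. f \<in> carrier A \<Longrightarrow> y \<in> X \<Longrightarrow> cmod (f \<one> y) \<le> p f"
    and f: "f \<in> carrier A"
  shows "reduced_norm f \<le> p f"
proof -
  interpret p: seminormed_star_algebra A p by unfold_locales (rule p)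
  have basis: "ell2_norm I (lreg x (delta i)) \<le> p x" if x: "x \<in> carrier A" and i: "i \<in> I" for x i
  proof -
    obtain s y where sy: "i = (s, y)" "s \<in> carrier G" "y \<in> X" using i by auto
    let ?xx = "smult A (sstar A x) x"
    have xx: "?xx \<in> carrier A" by (intro A.mult_closed A.star_closed x)
    note m = lreg_fin_supp[OF A_CV[OF x] delta_fin_supp[OF i]]
    have "complex_of_real ((ell2_norm I (lreg x (delta i)))\<^sup>2) = ell2_inner I (lreg x (delta i)) (lreg x (delta i))"
      by (rule ell2_norm_sq_fin_supp[OF m, symmetric])
    also have "\<dots> = ell2_inner I (delta i) (lreg ?xx (delta i))"
      unfolding lreg_adjoint[OF A_CV[OF x] delta_fin_supp[OF i] m] A_mult_eq A_star_eq
        lreg_mult[OF CV_star_closed[OF A_CV[OF x]] A_CV[OF x]] by (rule refl)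
    also have "\<dots> = lreg ?xx (delta i) i" by (rule ell2_inner_delta[OF i])
    also have "\<dots> = ?xx \<one> (act s y)"
      using lreg_delta[OF A_CV[OF xx] sy(2) sy(2) sy(3)] sy by simp
    finally have "(ell2_norm I (lreg x (delta i)))\<^sup>2 = cmod (?xx \<one> (act s y))"
      by (metis abs_of_nonneg norm_of_real zero_le_power2)
    also have "\<dots> \<le> p ?xx" by (rule expect[OF xx]) (use sy in simp)
    also have "\<dots> = (p x)\<^sup>2" by (rule p.p_star_mult[OF x])
    finally show ?thesis by (rule power2_le_imp_le) (use x in simp)
  qed
  have finite_bound: "\<exists>C. \<forall>x\<in>carrier A. ell2_norm I (lreg x \<xi>) \<le> C * p x" if \<xi>: "\<xi> \<in> fin_supp I" for \<xi>
  proof -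
    obtain B where B: "finite B" "B \<subseteq> I" "\<And>i. i \<notin> B \<Longrightarrow> \<xi> i = 0"
      using fin_suppE[OF \<xi>] by metis
    have \<xi>_eq: "\<xi> = (\<lambda>j. \<Sum>i\<in>B. \<xi> i * delta i j)"
    proof
      fix j
      have "(\<Sum>i\<in>B. \<xi> i * delta i j) = (\<Sum>i\<in>B. if i = j then \<xi> j else 0)"
        by (rule sum.cong) (auto simp: delta_def)
      then show "\<xi> j = (\<Sum>i\<in>B. \<xi> i * delta i j)" using B by simp
    qed
    have "ell2_norm I (lreg x \<xi>) \<le> (\<Sum>i\<in>B. cmod (\<xi> i)) * p x" if x: "x \<in> carrier A" for x
    proof -
      have "lreg x \<xi> = lreg x (\<lambda>j. \<Sum>i\<in>B. \<xi> i * delta i j)" using \<xi>_eq by (rule arg_cong)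
      also have "\<dots> = (\<lambda>j. \<Sum>i\<in>B. lreg x (\<lambda>j. \<xi> i * delta i j) j)"
        by (rule lreg_vec_sum[OF B(1)])
      also have "\<dots> = (\<lambda>j. \<Sum>i\<in>B. \<xi> i * lreg x (delta i) j)" by (simp only: lreg_vec_scale)
      finally have "ell2_norm I (lreg x \<xi>) = ell2_norm I (\<lambda>j. \<Sum>i\<in>B. \<xi> i * lreg x (delta i) j)"
        by (rule arg_cong)
      also have "\<dots> \<le> (\<Sum>i\<in>B. ell2_norm I (\<lambda>j. \<xi> i * lreg x (delta i) j))"
      proof (rule conjunct2[OF ell2_sum[OF B(1)]])
        show "(\<lambda>j. \<xi> i * lreg x (delta i) j) \<in> ell2 I" if "i \<in> B" for i
          using that B(2) by (intro ell2_scale fin_supp_ell2 lreg_fin_supp A_CV x delta_fin_supp) blast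
      qed
      also have "\<dots> = (\<Sum>i\<in>B. cmod (\<xi> i) * ell2_norm I (lreg x (delta i)))"
        by (simp only: ell2_norm_scale)
      also have "\<dots> \<le> (\<Sum>i\<in>B. cmod (\<xi> i) * p x)"
        using B(2) by (intro sum_mono mult_left_mono basis x norm_ge_zero) blast
      finally show ?thesis by (simp only: sum_distrib_right)
    qed
    then show ?thesis by blast
  qed
  have unit_ball: "ell2_norm I (lreg f \<xi>) \<le> p f" if \<xi>: "\<xi> \<in> fin_supp I" "ell2_norm I \<xi> \<le> 1" for \<xi>
  proof -
    have square: "(ell2_norm I (lreg x \<xi>))\<^sup>2 \<le> ell2_norm I (lreg (smult A (sstar A x) x) \<xi>)"
      if x: "x \<in> carrier A" for x
    proof -
      have "(ell2_norm I (lreg x \<xi>))\<^sup>2 \<le> ell2_norm I \<xi> * ell2_norm I (lreg (smult A (sstar A x) x) \<xi>)"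
        using lreg_norm_sq_le[OF A_CV[OF x] \<xi>(1)] by (simp only: A_mult_eq A_star_eq)
      also have "\<dots> \<le> 1 * ell2_norm I (lreg (smult A (sstar A x) x) \<xi>)"
        by (intro mult_right_mono \<xi>(2) ell2_norm_nonneg)
      finally show ?thesis by simp
    qed
    obtain C where C: "\<And>x. x \<in> carrier A \<Longrightarrow> ell2_norm I (lreg x \<xi>) \<le> C * p x"
      using finite_bound[OF \<xi>(1)] by blast
    define x where "x = smult A (sstar A f) f"
    have x: "x \<in> carrier A" "sstar A x = x"
      unfolding x_def using f by (simp_all add: A.star_mult A.star_star)
    define P where "P k = ((\<lambda>y. smult A y y) ^^ k) x" for k
    have P: "P k \<in> carrier A" "sstar A (P k) = P k" "p (P k) = p x ^ (2 ^ k)" for k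
      using A.iterated_square(1,2)[OF x, of k] A.iterated_square(3)[OF x p, of k]
      unfolding P_def by simp_all
    \<comment> \<open>for self-adjoint \<open>x\<close> and \<open>\<parallel>\<xi>\<parallel> \<le> 1\<close>, iterating \<open>\<parallel>x \<xi>\<parallel>\<^sup>2 \<le> \<parallel>x\<^sup>2 \<xi>\<parallel>\<close> reaches the powers of \<open>x\<close>\<close>
    have grow: "ell2_norm I (lreg x \<xi>) ^ (2 ^ k) \<le> ell2_norm I (lreg (P k) \<xi>)" for k
    proof (induction k)
      case 0
      then show ?case by (simp add: P_def)
    next
      case (Suc k)
      have "ell2_norm I (lreg x \<xi>) ^ (2 ^ Suc k) = (ell2_norm I (lreg x \<xi>) ^ (2 ^ k))\<^sup>2"
        by (simp add: power_mult[symmetric] mult.commute)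
      also have "\<dots> \<le> (ell2_norm I (lreg (P k) \<xi>))\<^sup>2"
        by (intro power_mono Suc.IH zero_le_power ell2_norm_nonneg)
      also have "\<dots> \<le> ell2_norm I (lreg (smult A (sstar A (P k)) (P k)) \<xi>)" by (rule square[OF P(1)])
      also have "smult A (sstar A (P k)) (P k) = P (Suc k)" unfolding P(2) by (simp add: P_def)
      finally show ?case .
    qed
    have "ell2_norm I (lreg x \<xi>) \<le> p x"
    proof (rule le_of_le_const_mult_powers[OF ell2_norm_nonneg])
      show "ell2_norm I (lreg x \<xi>) ^ (2 ^ k) \<le> C * p x ^ (2 ^ k)" for k
        using grow[of k] C[OF P(1)[of k]] P(3)[of k] by simp
    qed (use x in simp)
    then have "(ell2_norm I (lreg f \<xi>))\<^sup>2 \<le> (p f)\<^sup>2"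
      using square[OF f] p.p_star_mult[OF f] unfolding x_def by linarith
    then show ?thesis by (rule power2_le_imp_le) (use f in simp)
  qed
  show ?thesis
  proof (rule reduced_norm_le[OF f])
    show "0 \<le> p f" using f by simp
    fix \<xi> assume \<xi>: "\<xi> \<in> fin_supp I"
    show "ell2_norm I (lreg f \<xi>) \<le> p f * ell2_norm I \<xi>"
    proof (cases "ell2_norm I \<xi> = 0")
      case True
      then show ?thesis using reduced_norm_bound[OF f fin_supp_ell2[OF \<xi>]] by simp
    next
      case False
      define c where "c = complex_of_real (1 / ell2_norm I \<xi>)"
      have n: "0 < ell2_norm I \<xi>" using False by (simp add: less_le)
      have c: "cmod c = 1 / ell2_norm I \<xi>" using n unfolding c_def norm_of_real by simp
      have s: "(\<lambda>i. c * \<xi> i) \<in> fin_supp I"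
      proof -
        have "{i. c * \<xi> i \<noteq> 0} \<subseteq> {i. \<xi> i \<noteq> 0}" by auto
        then show ?thesis using \<xi> unfolding fin_supp_def by (auto intro: finite_subset)
      qed
      have "ell2_norm I (lreg f (\<lambda>i. c * \<xi> i)) \<le> p f"
        by (rule unit_ball[OF s]) (use n in \<open>simp add: ell2_norm_scale c\<close>)
      then have "1 / ell2_norm I \<xi> * ell2_norm I (lreg f \<xi>) \<le> p f"
        by (simp only: lreg_vec_scale ell2_norm_scale c)
      then show ?thesis using n by (simp add: field_simps)
    qed
  qed
qed

end

section \<open>Comparison of the full and the reduced norm\<close>

context function_algebra
begin

sublocale Full: seminormed_star_algebra A full
  by unfold_locales (rule cstar_seminorm_full)

sublocale Red: seminormed_star_algebra A reduced_norm
  by unfold_locales (rule cstar_seminorm_reduced)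

lemma reg_diff:
  assumes f: "f \<in> carrier A" and g: "g \<in> carrier A"
  shows "sdiff Bop (reg f) (reg g) = reg (sdiff A f g)"
proof (rule extensionalityI[of _ "ell2 I"])
  show "sdiff Bop (reg f) (reg g) \<in> extensional (ell2 I)"
    by (intro bounded_operator_extensional operator_diff_closed reg_bounded f g)
  show "reg (sdiff A f g) \<in> extensional (ell2 I)"
    by (intro bounded_operator_extensional reg_bounded A.diff_closed f g)
  fix \<xi> assume \<xi>: "\<xi> \<in> ell2 I"
  show "sdiff Bop (reg f) (reg g) \<xi> = reg (sdiff A f g) \<xi>"
  proof -
    have d: "sdiff A f g = (\<lambda>s y. f s y + (-1) * g s y)" by (simp add: sdiff_def)
    have "lreg (sdiff A f g) \<xi> = (\<lambda>i. lreg f \<xi> i + (-1) * lreg g \<xi> i)"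
      unfolding d lreg_add[OF A_CV[OF f] CV_scale_closed[OF A_CV[OF g]]] lreg_scale[OF A_CV[OF g]]
      by (rule refl)
    then show ?thesis
      by (simp add: operator_diff_apply[OF \<xi>] reg_apply[OF \<xi>])
  qed
qed

lemma reg_dist:
  "f \<in> carrier A \<Longrightarrow> g \<in> carrier A \<Longrightarrow> snorm Bop (sdiff Bop (reg f) (reg g)) = reduced_norm (sdiff A f g)"
  by (simp only: reg_diff reduced_norm_def)

lemma cauchy_full_imp_reduced: "f \<in> Full.CS \<Longrightarrow> f \<in> Red.CS"
proof -
  assume f: "f \<in> Full.CS"
  have le: "reduced_norm (sdiff A (f m) (f n)) \<le> full (sdiff A (f m) (f n))" for m n
    by (intro reduced_le_full A.diff_closed Full.cauchy_seqs_carrier f)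
  show ?thesis
    unfolding cauchy_seqs_def
  proof (intro CollectI conjI allI impI Full.cauchy_seqs_carrier f)
    fix e :: real assume "0 < e"
    with Full.cauchy_seqsD[OF f] obtain K where "\<forall>m\<ge>K. \<forall>n\<ge>K. full (sdiff A (f m) (f n)) < e" by blast
    then show "\<exists>K. \<forall>m\<ge>K. \<forall>n\<ge>K. reduced_norm (sdiff A (f m) (f n)) < e"
      using le le_less_trans by blast
  qed
qed

text \<open>Completeness of the operators on \<open>\<ell>\<^sup>2\<close> provides the values of the extended regular representation.\<close>

lemma reduced_limit_exists:
  assumes f: "f \<in> Red.CS"
  shows "\<exists>T\<in>bounded_operators I. (\<lambda>n. snorm Bop (sdiff Bop (reg (f n)) T)) \<longlonglongrightarrow> 0"
proof (rule operator_alg_complete)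
  note c = Red.cauchy_seqs_carrier[OF f]
  show "reg (f n) \<in> bounded_operators I" for n by (rule reg_bounded[OF c])
  show "\<exists>K. \<forall>m\<ge>K. \<forall>n\<ge>K. snorm Bop (sdiff Bop (reg (f m)) (reg (f n))) < e" if "0 < e" for e
    using Red.cauchy_seqsD[OF f that] by (simp only: reg_dist[OF c c])
qed

lemma regular_rep_eq:
  assumes f: "f \<in> Full.CS" and T: "T \<in> bounded_operators I"
    and lim: "(\<lambda>n. snorm Bop (sdiff Bop (reg (f n)) T)) \<longlonglongrightarrow> 0"
  shows "regular_rep G X tr (Full.cls f) = T"
  unfolding regular_rep_def Let_def
proof (rule the_equality)
  note fc = Full.cauchy_seqs_carrier[OF f]
  have "(\<lambda>n. snorm Bop (sdiff Bop (reg (g n)) T)) \<longlonglongrightarrow> 0" if g: "g \<in> Full.cls f" for g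
  proof -
    have gf: "g \<in> Full.CS" "(\<lambda>n. full (sdiff A (f n) (g n))) \<longlonglongrightarrow> 0"
      using g Full.mem_cauchy_class[OF f] by blast+
    note gc = Full.cauchy_seqs_carrier[OF gf(1)]
    have "(\<lambda>n. full (sdiff A (f n) (g n)) + snorm Bop (sdiff Bop (reg (f n)) T)) \<longlonglongrightarrow> 0"
      using tendsto_add[OF gf(2) lim] by simp
    moreover have "0 \<le> snorm Bop (sdiff Bop (reg (g n)) T)" for n
      by (intro operator_norm_nonneg operator_diff_closed reg_bounded gc T)
    moreover have "snorm Bop (sdiff Bop (reg (g n)) T) \<le>
        full (sdiff A (f n) (g n)) + snorm Bop (sdiff Bop (reg (f n)) T)" for n
    proof -
      have "snorm Bop (sdiff Bop (reg (g n)) T) \<le>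
          snorm Bop (sdiff Bop (reg (g n)) (reg (f n))) + snorm Bop (sdiff Bop (reg (f n)) T)"
        by (intro operator_dist_triangle reg_bounded gc fc T)
      also have "snorm Bop (sdiff Bop (reg (g n)) (reg (f n))) = reduced_norm (sdiff A (f n) (g n))"
        unfolding reg_dist[OF gc fc] by (rule Red.p_diff_commute[OF gc fc])
      also have "\<dots> \<le> full (sdiff A (f n) (g n))" by (intro reduced_le_full A.diff_closed fc gc)
      finally show ?thesis by simp
    qed
    ultimately show ?thesis by (rule null_seq_le)
  qed
  then show "T \<in> carrier Bop \<and> (\<forall>g\<in>Full.cls f. (\<lambda>n. snorm Bop (sdiff Bop (reg (g n)) T)) \<longlonglongrightarrow> 0)"
    using T by (simp add: operator_alg_def)
  fix T' assume T': "T' \<in> carrier Bop \<and> (\<forall>g\<in>Full.cls f. (\<lambda>n. snorm Bop (sdiff Bop (reg (g n)) T')) \<longlonglongrightarrow> 0)"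
  have "f \<in> Full.cls f" using f fc by (simp add: Full.mem_cauchy_class)
  then have lim': "(\<lambda>n. snorm Bop (sdiff Bop (reg (f n)) T')) \<longlonglongrightarrow> 0" using T' by blast
  have "T' \<in> bounded_operators I" using T' by (simp add: operator_alg_def)
  then show "T' = T"
    using T reg_bounded[OF fc] lim' lim by (rule operator_limit_unique)
qed

text \<open>Bijectivity of the regular representation on the completion translates into the two conditions on
  Cauchy sequences under which the bounded inverse theorem applies.\<close>

theorem full_eq_reduced:
  assumes iso: "star_iso (full_crossed_product G E tr) (reduced_crossed_product G X E tr) (regular_rep G X tr)"
    and f: "f \<in> carrier A"
  shows "full f = reduced_norm f"
proof -
  have bij: "bij_betw (regular_rep G X tr) (carrier Full.Comp) (carrier (reduced_crossed_product G X E tr))"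
    using iso unfolding star_iso_def full_crossed_product_def by (rule conjunct1)
  interpret N: two_seminorms A full reduced_norm
    by unfold_locales (rule cstar_seminorm_full cstar_seminorm_reduced reduced_le_full, assumption?)+
  show ?thesis
  proof (rule N.seminorms_eq[OF _ _ f])
    show "completion_map_inj A full reduced_norm"
      unfolding completion_map_inj_def
    proof (intro ballI impI)
      fix g assume g: "g \<in> Full.CS" and lim: "(\<lambda>n. reduced_norm (g n)) \<longlonglongrightarrow> 0"
      note gc = Full.cauchy_seqs_carrier[OF g]
      define z where "z = sscale A 0 f"
      have z: "z \<in> carrier A" unfolding z_def by (rule A.scale_closed[OF f])
      have gz: "sdiff A (g n) z = g n" for n by (simp add: z_def sdiff_def)
      have zB: "reg z \<in> bounded_operators I" by (rule reg_bounded[OF z])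
      have "regular_rep G X tr (Full.cls g) = reg z"
        by (rule regular_rep_eq[OF g zB]) (simp only: reg_dist[OF gc z] gz lim)
      moreover have "regular_rep G X tr (Full.cls (\<lambda>_. z)) = reg z"
        by (rule regular_rep_eq[OF Full.const_in_cauchy_seqs[OF z] zB])
          (simp only: reg_dist[OF z z] Red.p_diff_self[OF z] tendsto_const)
      ultimately have "Full.cls g = Full.cls (\<lambda>_. z)"
        by (intro inj_onD[OF bij_betw_imp_inj_on[OF bij]] Full.cauchy_class_closed g
            Full.const_in_cauchy_seqs z) simp
      then have "(\<lambda>n. full (sdiff A (g n) z)) \<longlonglongrightarrow> 0"
        using Full.cauchy_class_eq_iff[OF g Full.const_in_cauchy_seqs[OF z]] by blast
      then show "(\<lambda>n. full (g n)) \<longlonglongrightarrow> 0" by (simp only: gz)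
    qed
    show "completion_map_surj A full reduced_norm"
      unfolding completion_map_surj_def
    proof
      fix g assume g: "g \<in> Red.CS"
      note gc = Red.cauchy_seqs_carrier[OF g]
      obtain T where T: "T \<in> bounded_operators I"
        and lim: "(\<lambda>n. snorm Bop (sdiff Bop (reg (g n)) T)) \<longlonglongrightarrow> 0"
        using reduced_limit_exists[OF g] by blast
      have "\<exists>h\<in>carrier A. snorm Bop (sdiff Bop T (reg h)) < e" if "0 < e" for e
      proof -
        have "eventually (\<lambda>n. snorm Bop (sdiff Bop (reg (g n)) T) < e) sequentially"
          by (rule order_tendstoD(2)[OF lim that])
        then obtain n where "snorm Bop (sdiff Bop (reg (g n)) T) < e"
          by (auto simp: eventually_sequentially)
        then show ?thesis
          using operator_dist_commute_le[OF T reg_bounded[OF gc[of n]]] gc[of n]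
          by (intro bexI[of _ "g n"]) linarith+
      qed
      then have "T \<in> carrier (reduced_crossed_product G X E tr)"
        using T by (simp add: reduced_crossed_product_def Let_def operator_alg_def)
      then have "T \<in> regular_rep G X tr ` carrier Full.Comp"
        by (simp only: bij_betw_imp_surj_on[OF bij])
      then obtain a where a: "T = regular_rep G X tr a" "a \<in> carrier Full.Comp"
        by (rule imageE)
      obtain h where h: "h \<in> Full.CS" "a = Full.cls h" using a(2) by (rule Full.completion_cases)
      note hc = Full.cauchy_seqs_carrier[OF h(1)]
      obtain T' where T': "T' \<in> bounded_operators I"
        and lim': "(\<lambda>n. snorm Bop (sdiff Bop (reg (h n)) T')) \<longlonglongrightarrow> 0"
        using reduced_limit_exists[OF cauchy_full_imp_reduced[OF h(1)]] by blast
      have "T' = T" using regular_rep_eq[OF h(1) T' lim'] a(1) unfolding h(2) by (simp only:)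
      have "(\<lambda>n. snorm Bop (sdiff Bop (reg (h n)) T) + snorm Bop (sdiff Bop (reg (g n)) T)) \<longlonglongrightarrow> 0"
        using tendsto_add[OF lim'[unfolded \<open>T' = T\<close>] lim] by simp
      moreover have "0 \<le> reduced_norm (sdiff A (h n) (g n))" for n
        by (intro reduced_norm_nonneg A.diff_closed hc gc)
      moreover have "reduced_norm (sdiff A (h n) (g n)) \<le>
          snorm Bop (sdiff Bop (reg (h n)) T) + snorm Bop (sdiff Bop (reg (g n)) T)" for n
        unfolding reg_dist[OF hc gc, symmetric]
        using operator_dist_triangle[OF reg_bounded[OF hc] T reg_bounded[OF gc], of n n]
          operator_dist_commute_le[OF T reg_bounded[OF gc], of n] by linarith
      ultimately have "(\<lambda>n. reduced_norm (sdiff A (h n) (g n))) \<longlonglongrightarrow> 0" by (rule null_seq_le)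
      then show "\<exists>h\<in>Full.CS. (\<lambda>n. reduced_norm (sdiff A (h n) (g n))) \<longlonglongrightarrow> 0"
        using h(1) by blast
    qed
  qed
qed

section \<open>The algebraic crossed product\<close>

text \<open>The unitary \<open>\<delta>\<^sub>s\<close> lies in the convolution algebra over all functions on \<open>X\<close>, where it is the
  homogeneous element with the unit as its coefficient. Multiplication by it maps \<open>A\<close> to \<open>A\<close>.\<close>

definition oneX :: "'x \<Rightarrow> complex" where
  "oneX = (\<lambda>y. if y \<in> X then 1 else 0)"

abbreviation "shift s \<equiv> smult CV (single s oneX)"

lemma oneX_vanishing: "oneX \<in> vanishing"
  by (simp add: oneX_def vanishing_def)

lemma unitary_CV: "s \<in> carrier G \<Longrightarrow> single s oneX \<in> carrier CV"
  by (rule single_CV[OF _ oneX_vanishing])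

lemma shift_apply:
  "s \<in> carrier G \<Longrightarrow> shift s f = (\<lambda>t. if t \<in> carrier G then tr s (f (inv s \<otimes> t)) else (\<lambda>_. 0))"
  by (simp add: single_mult_apply oneX_vanishing) (auto simp: oneX_def translate_def fun_eq_iff)

lemma shift_A:
  assumes "s \<in> carrier G" "f \<in> carrier A"
  shows "shift s f \<in> carrier A"
proof -
  have "shift s f \<in> carrier CV" by (intro CV_mult_closed unitary_CV A_CV assms)
  then show ?thesis
    using assms A_E[OF assms(2)] by (simp add: mem_A_iff_CV shift_apply E_tr)
qed

lemma shift_star_mult_shift:
  assumes s: "s \<in> carrier G" and f: "f \<in> carrier CV"
  shows "smult CV (sstar CV (shift s f)) (shift s f) = smult CV (sstar CV f) f"
proof -
  note u = unitary_CV[OF s]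
  have "tr (inv s) (\<lambda>y. cnj (oneX y) * oneX y) = oneX"
    using s by (auto simp: translate_def oneX_def fun_eq_iff)
  then have uu: "smult CV (sstar CV (single s oneX)) (single s oneX) = single \<one> oneX"
    by (simp only: star_single_mult_single[OF s])
  have one: "smult CV (single \<one> oneX) f = f"
    unfolding shift_apply[OF one_closed]
  proof (intro ext)
    fix t y show "(if t \<in> carrier G then tr \<one> (f (inv \<one> \<otimes> t)) else (\<lambda>_. 0)) y = f t y"
      using CV_outside[OF f, of t y] by (cases "(t, y) \<in> I") (auto simp: translate_def)
  qed
  have "smult CV (sstar CV (shift s f)) (shift s f) =
      smult CV (sstar CV f) (smult CV (smult CV (sstar CV (single s oneX)) (single s oneX)) f)"
    using u f by (simp only: CV_star_mult CV.mult_assoc CV.mult_closed CV.star_closed)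
  then show ?thesis by (simp only: uu one)
qed

text \<open>\<open>\<delta>\<^sub>s\<close> is unitary, so \<open>\<delta>\<^sub>s f\<close> and \<open>f\<close> have the same absolute square.\<close>

lemma full_shift:
  assumes s: "s \<in> carrier G" and f: "f \<in> carrier A"
  shows "full (shift s f) = full f"
proof -
  have "(full (shift s f))\<^sup>2 = (full f)\<^sup>2"
    using Full.p_star_mult[OF shift_A[OF s f]] Full.p_star_mult[OF f]
    by (simp only: A_mult_eq A_star_eq shift_star_mult_shift[OF s A_CV[OF f]])
  then show ?thesis
    using full_norm_nonneg[OF f] full_norm_nonneg[OF shift_A[OF s f]] by (simp add: power2_eq_iff_nonneg)
qed

lemma shift_diff:
  assumes "s \<in> carrier G" "f \<in> carrier A" "g \<in> carrier A"
  shows "sdiff A (shift s f) (shift s g) = shift s (sdiff A f g)"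
proof -
  have "sdiff A = sdiff CV" by (simp add: sdiff_def fun_eq_iff)
  then show ?thesis
    by (simp only: CV.diff_mult_right[OF unitary_CV[OF assms(1)] A_CV[OF assms(2)] A_CV[OF assms(3)]])
qed

lemma shift_cauchy:
  assumes s: "s \<in> carrier G" and f: "f \<in> Full.CS"
  shows "(\<lambda>n. shift s (f n)) \<in> Full.CS"
proof (rule Full.cauchy_seqsI2[OF f f, of _ 1])
  note c = Full.cauchy_seqs_carrier[OF f]
  show "shift s (f n) \<in> carrier A" for n by (rule shift_A[OF s c])
  show "full (sdiff A (shift s (f m)) (shift s (f n))) \<le>
      1 * (full (sdiff A (f m) (f n)) + full (sdiff A (f m) (f n)))" for m n
    using full_norm_nonneg[OF A.diff_closed[OF c c]]
    by (simp add: shift_diff[OF s c c] full_shift[OF s A.diff_closed[OF c c]])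
qed simp

lemma iG_class:
  assumes s: "s \<in> carrier G" and f: "f \<in> Full.CS"
  shows "iG G E tr s (Full.cls f) = Full.cls (\<lambda>n. shift s (f n))"
proof -
  have "congruent (cauchy_rel A full) (\<lambda>f. Full.cls (\<lambda>n. shift s (f n)))"
  proof (rule congruentI)
    fix f g assume fg: "(f, g) \<in> cauchy_rel A full"
    then have c: "f \<in> Full.CS" "g \<in> Full.CS" and lim: "(\<lambda>n. full (sdiff A (f n) (g n))) \<longlonglongrightarrow> 0"
      unfolding cauchy_rel_def by blast+
    note fc = Full.cauchy_seqs_carrier[OF c(1)] and gc = Full.cauchy_seqs_carrier[OF c(2)]
    show "Full.cls (\<lambda>n. shift s (f n)) = Full.cls (\<lambda>n. shift s (g n))"
      unfolding Full.cauchy_class_eq_iff[OF shift_cauchy[OF s c(1)] shift_cauchy[OF s c(2)]]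
        shift_diff[OF s fc gc] full_shift[OF s A.diff_closed[OF fc gc]]
      by (rule lim)
  qed
  from UN_equiv_class[OF Full.equiv_cauchy_rel this f]
  have "(\<Union>f\<in>Full.cls f. Full.cls (\<lambda>n. shift s (f n))) = Full.cls (\<lambda>n. shift s (f n))"
    by (simp only: cauchy_class_def)
  then show ?thesis
    using Full.cauchy_class_closed[OF f]
    by (simp add: iG_def full_crossed_product_def shift_apply[OF s])
qed

lemma iD_eq: "iD G E tr d = Full.left_mult (single \<one> d)"
  by (simp add: iD_def Full.left_mult_def full_crossed_product_def single_def)

text \<open>This is the relation \<open>\<delta>\<^sub>s d = \<alpha>\<^sub>s(d) \<delta>\<^sub>s\<close>.\<close>

lemma generator_eq_left_mult:
  assumes s: "s \<in> carrier G" and d: "d \<in> E"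
  shows "smult (multiplier_alg Full.Comp) (iG G E tr s) (iD G E tr d) = Full.left_mult (single s (tr s d))"
proof (rule Full.left_mult_ext)
  note sd = single_A[OF one_closed d]
  show "single s (tr s d) \<in> carrier A" by (intro single_A E_tr s d)
  have eq: "iG G E tr s (iD G E tr d (Full.cls f)) = Full.cls (\<lambda>n. smult A (single s (tr s d)) (f n))"
    if f: "f \<in> Full.CS" for f
  proof -
    have "iG G E tr s (iD G E tr d (Full.cls f)) = Full.cls (\<lambda>n. shift s (smult A (single \<one> d) (f n)))"
      by (simp only: iD_eq Full.left_mult_class[OF sd f] iG_class[OF s Full.cauchy_seqs_left_mult[OF sd f]])
    moreover have "shift s (smult A (single \<one> d) (f n)) = smult A (single s (tr s d)) (f n)" for n
    proof -
      have "(\<lambda>y. oneX y * tr s d y) = tr s d" by (auto simp: oneX_def translate_def)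
      then have "smult CV (single s oneX) (single \<one> d) = single s (tr s d)"
        using s by (simp add: single_mult_single oneX_vanishing)
      then show ?thesis
        using CV.mult_assoc[OF unitary_CV[OF s] A_CV[OF sd] A_CV[OF Full.cauchy_seqs_carrier[OF f]], of n]
        by (simp only: A_mult_eq)
    qed
    ultimately show ?thesis by (simp only:)
  qed
  have mem: "(\<lambda>n. smult A (single s (tr s d)) (f n)) \<in> Full.CS" if "f \<in> Full.CS" for f
    by (intro Full.cauchy_seqs_left_mult single_A E_tr s d that)
  show "smult (multiplier_alg Full.Comp) (iG G E tr s) (iD G E tr d) (Full.cls f) =
      Full.cls (\<lambda>n. smult A (single s (tr s d)) (f n))" if "f \<in> Full.CS" for f
    using eq[OF that] Full.cauchy_class_closed[OF that] by (simp add: multiplier_alg_def)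
  show "smult (multiplier_alg Full.Comp) (iG G E tr s) (iD G E tr d) \<in> carrier Full.Comp \<rightarrow>\<^sub>E carrier Full.Comp"
  proof (rule PiE_I)
    fix a assume a: "a \<in> carrier Full.Comp"
    then obtain f where f: "f \<in> Full.CS" "a = Full.cls f" by (rule Full.completion_cases)
    show "smult (multiplier_alg Full.Comp) (iG G E tr s) (iD G E tr d) a \<in> carrier Full.Comp"
      using a f eq[OF f(1)] Full.cauchy_class_closed[OF mem[OF f(1)]] by (simp add: multiplier_alg_def)
  qed (simp add: multiplier_alg_def)
qed

end

locale function_algebra_pair = function_algebra G X act E + sub: function_algebra G X act E0
  for G (structure) and X :: "'x set" and act and E E0 +
  assumes E0_subset: "E0 \<subseteq> E"
begin

abbreviation "A0 \<equiv> cc_alg G E0 tr"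

lemma A0_A: "f \<in> carrier A0 \<Longrightarrow> f \<in> carrier A"
  using E0_subset unfolding mem_A sub.mem_A by blast

text \<open>The generators are the left multiplications by the homogeneous elements with coefficients in \<open>E0\<close>, and
  these span \<open>A0\<close>.\<close>

lemma algebraic_crossed_product_eq:
  "algebraic_crossed_product G E E0 tr =
     multiplier_alg Full.Comp \<lparr>carrier := Full.left_mult ` carrier A0\<rparr>"
proof -
  let ?M = "multiplier_alg Full.Comp"
  let ?S = "{smult ?M (iG G E tr s) (iD G E tr d) | s d. s \<in> carrier G \<and> d \<in> E0}"
  have "Full.left_mult f \<in> cspan ?M ?S" if "f \<in> carrier A0" for f
    using that
  proof (induction rule: sub.A_induct)
    case (single t d)
    have "tr t (tr (inv t) d) = d"
      using single sub.E_vanish[OF single(2)] by (auto simp: translate_def fun_eq_iff)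
    then have "Full.left_mult (single t d) = smult ?M (iG G E tr t) (iD G E tr (tr (inv t) d))"
      using generator_eq_left_mult[of t "tr (inv t) d"] single sub.E_tr[of "inv t" d] E0_subset by auto
    then show ?case
      using single sub.E_tr[of "inv t" d] by (intro cspan.base) auto
  next
    case (add f g)
    have "sadd ?M (Full.left_mult f) (Full.left_mult g) \<in> cspan ?M ?S"
      by (rule cspan.add[OF add.IH])
    then show ?case
      by (simp add: Full.multiplier_add_left_mult[OF A0_A[OF add.hyps(1)] A0_A[OF add.hyps(2)]])
  qed
  moreover have "T \<in> Full.left_mult ` carrier A0" if "T \<in> cspan ?M ?S" for T
    using that
  proof (induction rule: cspan.induct)
    case (base T)
    then obtain s d where "s \<in> carrier G" "d \<in> E0" "T = smult ?M (iG G E tr s) (iD G E tr d)" by blast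
    then show ?case
      using generator_eq_left_mult[of s d] E0_subset
      by (intro image_eqI[of _ _ "single s (tr s d)"]) (auto intro: sub.single_A sub.E_tr)
  next
    case (add S T)
    then obtain f g where fg: "f \<in> carrier A0" "g \<in> carrier A0" "S = Full.left_mult f" "T = Full.left_mult g"
      by blast
    show ?case
      unfolding fg(3,4) Full.multiplier_add_left_mult[OF A0_A[OF fg(1)] A0_A[OF fg(2)]]
      using sub.A.add_closed[OF fg(1,2)] by simp
  next
    case (scale T c)
    then obtain f where f: "f \<in> carrier A0" "T = Full.left_mult f" by blast
    show ?case
      unfolding f(2) Full.multiplier_scale_left_mult[OF A0_A[OF f(1)]]
      using sub.A.scale_closed[OF f(1), of c] by simp
  qed
  ultimately have "cspan ?M ?S = Full.left_mult ` carrier A0" by blast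
  then show ?thesis
    by (simp add: algebraic_crossed_product_def Let_def full_crossed_product_def)
qed

lemma A0_eq: "A\<lparr>carrier := carrier A0\<rparr> = A0"
  by (simp add: cc_alg_def)

theorem star_iso_algebraic_crossed_product:
  "star_iso A0 (algebraic_crossed_product G E E0 tr) Full.left_mult"
proof -
  have "star_iso (A\<lparr>carrier := carrier A0\<rparr>)
      (multiplier_alg Full.Comp \<lparr>carrier := Full.left_mult ` carrier A0\<rparr>) Full.left_mult"
  proof (rule Full.star_iso_left_mult)
    show "carrier A0 \<subseteq> carrier A" using A0_A by blast
    show "sadd A f g \<in> carrier A0" if "f \<in> carrier A0" "g \<in> carrier A0" for f g
      using sub.A.add_closed[OF that] by simp
    show "sscale A c f \<in> carrier A0" if "f \<in> carrier A0" for c f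
      using sub.A.scale_closed[OF that, of c] by simp
    fix f assume f: "f \<in> carrier A0" and z: "full f = 0"
    then have "reduced_norm f = 0"
      using reduced_le_full[OF A0_A[OF f]] reduced_norm_nonneg[OF A0_A[OF f]] by simp
    then show "f = sscale A 0 f" by (rule reduced_norm_faithful[OF A0_A[OF f]])
  qed
  then show ?thesis by (simp only: A0_eq algebraic_crossed_product_eq)
qed

end

section \<open>Extension of C*-seminorms by density\<close>

context group_on_set
begin

text \<open>The algebra operations and, by the \<open>\<ell>\<^sup>1\<close>-bound, all C*-seminorms are continuous for uniform convergence
  with supports in a common finite set \<open>F\<close>. A single null sequence \<open>c\<close> controls all coefficients, so that
  errors can be added over \<open>F\<close>.\<close>

definition conv_via :: "'a set \<Rightarrow> (nat \<Rightarrow> real) \<Rightarrow> (nat \<Rightarrow> 'a \<Rightarrow> 'x \<Rightarrow> complex) \<Rightarrow> ('a \<Rightarrow> 'x \<Rightarrow> complex) \<Rightarrow> bool" where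
  "conv_via F c fn f \<longleftrightarrow> finite F \<and> F \<subseteq> carrier G \<and> c \<longlonglongrightarrow> 0 \<and>
     (\<forall>t. t \<notin> F \<longrightarrow> (\<forall>n. fn n t = (\<lambda>_. 0)) \<and> f t = (\<lambda>_. 0)) \<and>
     (\<forall>n t y. cmod (fn n t y - f t y) \<le> c n)"

definition conv :: "(nat \<Rightarrow> 'a \<Rightarrow> 'x \<Rightarrow> complex) \<Rightarrow> ('a \<Rightarrow> 'x \<Rightarrow> complex) \<Rightarrow> bool" where
  "conv fn f \<longleftrightarrow> (\<exists>F c. conv_via F c fn f)"

lemma conv_viaD:
  assumes "conv_via F c fn f"
  shows "finite F" "F \<subseteq> carrier G" "c \<longlonglongrightarrow> 0" "\<And>n. 0 \<le> c n"
    "\<And>n t. t \<notin> F \<Longrightarrow> fn n t = (\<lambda>_. 0)" "\<And>t. t \<notin> F \<Longrightarrow> f t = (\<lambda>_. 0)"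
    "\<And>n t y. cmod (fn n t y - f t y) \<le> c n"
proof -
  show *: "\<And>n t y. cmod (fn n t y - f t y) \<le> c n" using assms unfolding conv_via_def by blast
  show "0 \<le> c n" for n using order_trans[OF norm_ge_zero *] .
qed (use assms in \<open>unfold conv_via_def, blast+\<close>)

lemma convI:
  assumes "finite F" "F \<subseteq> carrier G" "c \<longlonglongrightarrow> 0"
    "\<And>n t. t \<notin> F \<Longrightarrow> fn n t = (\<lambda>_. 0)" "\<And>t. t \<notin> F \<Longrightarrow> f t = (\<lambda>_. 0)"
    "\<And>n t y. cmod (fn n t y - f t y) \<le> c n"
  shows "conv fn f"
  unfolding conv_def conv_via_def by (rule exI[of _ F], rule exI[of _ c]) (use assms in simp)

lemma conv_const: "f \<in> carrier CV \<Longrightarrow> conv (\<lambda>_. f) f"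
proof (rule convI)
  assume f: "f \<in> carrier CV"
  show "finite {t \<in> carrier G. f t \<noteq> (\<lambda>_. 0)}" by (rule CV_support[OF f])
  show "f t = (\<lambda>_. 0)" if "t \<notin> {t \<in> carrier G. f t \<noteq> (\<lambda>_. 0)}" for t
    using that CV_outside[OF f, of t] by (cases "t \<in> carrier G") auto
  then show "f t = (\<lambda>_. 0)" if "t \<notin> {t \<in> carrier G. f t \<noteq> (\<lambda>_. 0)}" for t using that .
qed auto

lemma conv_add:
  assumes "conv fn f" "conv gn g"
  shows "conv (\<lambda>n s y. fn n s y + gn n s y) (\<lambda>s y. f s y + g s y)"
proof -
  obtain F c where "conv_via F c fn f"
    using assms(1) unfolding conv_def by blast
  note F = conv_viaD[OF this]
  obtain F' c' where "conv_via F' c' gn g"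
    using assms(2) unfolding conv_def by blast
  note F' = conv_viaD[OF this]
  show ?thesis
  proof (rule convI[of "F \<union> F'"])
    show "(\<lambda>n. c n + c' n) \<longlonglongrightarrow> 0" using tendsto_add[OF F(3) F'(3)] by simp
    fix n t y
    have "cmod ((fn n t y - f t y) + (gn n t y - g t y)) \<le> c n + c' n"
      by (rule order_trans[OF norm_triangle_ineq add_mono[OF F(7) F'(7)]])
    then show "cmod (fn n t y + gn n t y - (f t y + g t y)) \<le> c n + c' n"
      by (simp add: algebra_simps)
  qed (use F F' in auto)
qed

lemma conv_scale:
  assumes "conv fn f"
  shows "conv (\<lambda>n s y. a * fn n s y) (\<lambda>s y. a * f s y)"
proof -
  obtain F c where "conv_via F c fn f"
    using assms unfolding conv_def by blast
  note F = conv_viaD[OF this]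
  show ?thesis
  proof (rule convI)
    show "(\<lambda>n. cmod a * c n) \<longlonglongrightarrow> 0" using F(3) by (rule tendsto_mult_right_zero)
    fix n t y
    show "cmod (a * fn n t y - a * f t y) \<le> cmod a * c n"
      unfolding right_diff_distrib[symmetric] norm_mult by (intro mult_left_mono F(7) norm_ge_zero)
  qed (use F in auto)
qed

lemma conv_star:
  assumes "conv fn f"
  shows "conv (\<lambda>n. sstar CV (fn n)) (sstar CV f)"
proof -
  obtain F c where "conv_via F c fn f"
    using assms unfolding conv_def by blast
  note F = conv_viaD[OF this]
  have z: "sstar CV h t = (\<lambda>_. 0)" if "t \<notin> (\<lambda>t. inv t) ` F" "\<And>t. t \<notin> F \<Longrightarrow> h t = (\<lambda>_. 0)" for h t
  proof (rule star_support)
    show "t \<notin> (\<lambda>t. inv t) ` {t \<in> carrier G. h t \<noteq> (\<lambda>_. 0)}" using that by blast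
  qed
  show ?thesis
  proof (rule convI[OF _ _ F(3)])
    show "finite ((\<lambda>t. inv t) ` F)" using F(1) by simp
    show "(\<lambda>t. inv t) ` F \<subseteq> carrier G" using F(2) by auto
    show "sstar CV (fn n) t = (\<lambda>_. 0)" if "t \<notin> (\<lambda>t. inv t) ` F" for n t by (rule z[OF that F(5)])
    show "sstar CV f t = (\<lambda>_. 0)" if "t \<notin> (\<lambda>t. inv t) ` F" for t by (rule z[OF that F(6)])
    fix n t y
    show "cmod (sstar CV (fn n) t y - sstar CV f t y) \<le> c n"
    proof (cases "t \<in> carrier G \<and> y \<in> X")
      case True
      then show ?thesis
        using F(7)[of n "inv t" "act (inv t) y"]
        by (simp add: star_apply complex_cnj_diff[symmetric] del: complex_cnj_diff)
    next
      case False
      then show ?thesis using F(4) by (simp add: star_outside)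
    qed
  qed
qed

lemma mult_apply_superset:
  assumes "finite F" "F \<subseteq> carrier G" "\<And>t. t \<notin> F \<Longrightarrow> f t = (\<lambda>_. 0)" "s \<in> carrier G" "y \<in> X"
  shows "smult CV f g s y = (\<Sum>t\<in>F. f t y * g (inv t \<otimes> s) (act (inv t) y))"
  unfolding mult_apply[OF assms(4,5)]
  by (rule sum.mono_neutral_left) (use assms in auto)

lemma conv_mult:
  assumes "conv fn f" "conv gn g"
    and fb: "\<And>t y. cmod (f t y) \<le> Kf" and gb: "\<And>t y. cmod (g t y) \<le> Kg"
  shows "conv (\<lambda>n. smult CV (fn n) (gn n)) (smult CV f g)"
proof -
  obtain F c where "conv_via F c fn f"
    using assms(1) unfolding conv_def by blast
  note F = conv_viaD[OF this]
  obtain F' c' where "conv_via F' c' gn g"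
    using assms(2) unfolding conv_def by blast
  note F' = conv_viaD[OF this]
  have Kf: "0 \<le> Kf" using order_trans[OF norm_ge_zero fb] .
  let ?P = "(\<lambda>(t, u). t \<otimes> u) ` (F \<times> F')"
  let ?e = "\<lambda>n. c n * (Kg + c' n) + Kf * c' n"
  have e0: "0 \<le> ?e n" for n
    using order_trans[OF norm_ge_zero gb] Kf F(4) F'(4) by (intro add_nonneg_nonneg mult_nonneg_nonneg)
  have z: "smult CV h k t = (\<lambda>_. 0)"
    if "t \<notin> ?P" "\<And>t. t \<notin> F \<Longrightarrow> h t = (\<lambda>_. 0)" "\<And>t. t \<notin> F' \<Longrightarrow> k t = (\<lambda>_. 0)" for h k t
  proof (rule mult_support)
    have "{t \<in> carrier G. h t \<noteq> (\<lambda>_. 0)} \<times> {t \<in> carrier G. k t \<noteq> (\<lambda>_. 0)} \<subseteq> F \<times> F'"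
      using that(2,3) by blast
    then show "t \<notin> (\<lambda>(t, u). t \<otimes> u) ` ({t \<in> carrier G. h t \<noteq> (\<lambda>_. 0)} \<times> {t \<in> carrier G. k t \<noteq> (\<lambda>_. 0)})"
      using that(1) by blast
  qed
  show ?thesis
  proof (rule convI)
    show "finite ?P" using F(1) F'(1) by simp
    show "?P \<subseteq> carrier G" using F(2) F'(2) by auto
    have "?e \<longlonglongrightarrow> 0 * (Kg + 0) + Kf * 0" by (intro tendsto_intros F(3) F'(3))
    then have "?e \<longlonglongrightarrow> 0" by simp
    then show "(\<lambda>n. of_nat (card F) * ?e n) \<longlonglongrightarrow> 0" by (rule tendsto_mult_right_zero)
    show "smult CV (fn n) (gn n) t = (\<lambda>_. 0)" if "t \<notin> ?P" for n t by (rule z[OF that F(5) F'(5)])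
    show "smult CV f g t = (\<lambda>_. 0)" if "t \<notin> ?P" for t by (rule z[OF that F(6) F'(6)])
    fix n s y
    show "cmod (smult CV (fn n) (gn n) s y - smult CV f g s y) \<le> of_nat (card F) * ?e n"
    proof (cases "s \<in> carrier G \<and> y \<in> X")
      case True
      let ?g = "\<lambda>t. g (inv t \<otimes> s) (act (inv t) y)" and ?gn = "\<lambda>t. gn n (inv t \<otimes> s) (act (inv t) y)"
      have "smult CV (fn n) (gn n) s y - smult CV f g s y = (\<Sum>t\<in>F. fn n t y * ?gn t - f t y * ?g t)"
      proof -
        have "smult CV (fn n) (gn n) s y = (\<Sum>t\<in>F. fn n t y * ?gn t)"
          by (rule mult_apply_superset[OF F(1,2) F(5)]) (use True in simp_all)
        moreover have "smult CV f g s y = (\<Sum>t\<in>F. f t y * ?g t)"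
          by (rule mult_apply_superset[OF F(1,2) F(6)]) (use True in simp_all)
        ultimately show ?thesis by (simp only: sum_subtractf)
      qed
      then have eq: "cmod (smult CV (fn n) (gn n) s y - smult CV f g s y) =
          cmod (\<Sum>t\<in>F. fn n t y * ?gn t - f t y * ?g t)" by (rule arg_cong)
      have "cmod (fn n t y * ?gn t - f t y * ?g t) \<le> ?e n" for t
      proof -
        have "cmod (?gn t) \<le> cmod (?g t) + cmod (?gn t - ?g t)"
          using norm_triangle_ineq[of "?g t" "?gn t - ?g t"] by simp
        also have "\<dots> \<le> Kg + c' n" by (intro add_mono gb F'(7))
        finally have gn: "cmod (?gn t) \<le> Kg + c' n" .
        have "fn n t y * ?gn t - f t y * ?g t = (fn n t y - f t y) * ?gn t + f t y * (?gn t - ?g t)"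
          by (simp add: algebra_simps)
        then have "cmod (fn n t y * ?gn t - f t y * ?g t) \<le>
            cmod (fn n t y - f t y) * cmod (?gn t) + cmod (f t y) * cmod (?gn t - ?g t)"
          using norm_triangle_ineq[of "(fn n t y - f t y) * ?gn t" "f t y * (?gn t - ?g t)"]
          by (simp add: norm_mult)
        also have "\<dots> \<le> ?e n"
          by (intro add_mono mult_mono F(7) F'(7) gn fb F(4) Kf norm_ge_zero)
        finally show ?thesis .
      qed
      then have "cmod (\<Sum>t\<in>F. fn n t y * ?gn t - f t y * ?g t) \<le> (\<Sum>t\<in>F. ?e n)"
        by (intro sum_norm_le)
      then show ?thesis unfolding eq sum_constant .
    next
      case False
      then have "smult CV (fn n) (gn n) s y = 0 \<and> smult CV f g s y = 0"
        by (auto simp: cc_alg_def translate_def)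
      then show ?thesis using e0[of n] by simp
    qed
  qed
qed

end

lemma (in function_algebra) A_uniformly_bounded:
  assumes f: "f \<in> carrier A"
  shows "\<exists>K. \<forall>t y. cmod (f t y) \<le> K"
proof -
  obtain k where k: "\<forall>t. 0 \<le> k t" "\<forall>t y. cmod (f t y) \<le> k t" using A_bounded[OF f] by blast
  let ?F = "{s. f s \<noteq> (\<lambda>_. 0)}"
  have F: "finite ?F" using f unfolding mem_A by blast
  have "cmod (f t y) \<le> (\<Sum>t\<in>?F. k t)" for t y
  proof (cases "t \<in> ?F")
    case True
    have "k t \<le> (\<Sum>t\<in>?F. k t)" by (rule member_le_sum[OF True _ F]) (use k in blast)
    then show ?thesis using k order_trans by blast
  next
    case False
    then show ?thesis using k by (simp add: sum_nonneg)
  qed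
  then show ?thesis by blast
qed

locale dense_function_algebra = function_algebra_pair G X act E E0
  for G (structure) and X :: "'x set" and act and E E0 +
  assumes E0_dense: "d \<in> E \<Longrightarrow> 0 < e \<Longrightarrow> \<exists>d0\<in>E0. \<forall>y. cmod (d y - d0 y) \<le> e"
begin

text \<open>Each coefficient is approximated separately; the coefficient \<open>0\<close> is approximated by \<open>0\<close>, which keeps
  the support.\<close>

lemma approximation:
  assumes f: "f \<in> carrier A"
  shows "\<exists>fn. (\<forall>n. fn n \<in> carrier A0) \<and> conv fn f"
proof -
  define P where "P n d d0 \<longleftrightarrow> d0 \<in> E0 \<and> (\<forall>y. cmod (d y - d0 y) \<le> inverse (real (Suc n))) \<and>
    (d = (\<lambda>_. 0) \<longrightarrow> d0 = (\<lambda>_. 0))" for n d d0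
  have P_ex: "\<exists>d0. P n d d0" if d: "d \<in> E" for n d
  proof (cases "d = (\<lambda>_. 0)")
    case True
    then show ?thesis using sub.E_zero by (intro exI[of _ "\<lambda>_. 0"]) (simp add: P_def)
  next
    case False
    obtain d0 where "d0 \<in> E0" "\<forall>y. cmod (d y - d0 y) \<le> inverse (real (Suc n))"
      using E0_dense[OF d, of "inverse (real (Suc n))"] by auto
    then show ?thesis using False by (intro exI[of _ d0]) (simp add: P_def)
  qed
  have ex: "P n d (SOME d0. P n d d0)" if "d \<in> E" for n d
    by (rule someI_ex[OF P_ex[OF that]])
  define fn where "fn n t = (SOME d0. P n (f t) d0)" for n t
  have fn: "fn n t \<in> E0" "cmod (f t y - fn n t y) \<le> inverse (real (Suc n))"
      "f t = (\<lambda>_. 0) \<Longrightarrow> fn n t = (\<lambda>_. 0)" for n t y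
    using ex[OF A_E[OF f], of n t] unfolding fn_def P_def by blast+
  let ?F = "{s. f s \<noteq> (\<lambda>_. 0)}"
  have F: "finite ?F" "?F \<subseteq> carrier G" using f unfolding mem_A by blast+
  have "fn n \<in> carrier A0" for n
    unfolding sub.mem_A
  proof (intro conjI ballI allI impI fn(1))
    show "fn n s = (\<lambda>_. 0)" if "s \<notin> carrier G" for s using that F(2) by (intro fn(3)) blast
    have "{s. fn n s \<noteq> (\<lambda>_. 0)} \<subseteq> ?F" using fn(3) by blast
    then show "finite {s. fn n s \<noteq> (\<lambda>_. 0)}" using F(1) by (rule finite_subset)
  qed
  moreover have "conv fn f"
  proof (rule convI[OF F LIMSEQ_inverse_real_of_nat])
    fix n t y
    show "cmod (fn n t y - f t y) \<le> inverse (real (Suc n))"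
      using fn(2)[of t y n] by (simp only: norm_minus_commute)
  qed (use fn(3) in auto)
  ultimately show ?thesis by blast
qed

definition approximant :: "('a \<Rightarrow> 'x \<Rightarrow> complex) \<Rightarrow> nat \<Rightarrow> 'a \<Rightarrow> 'x \<Rightarrow> complex" where
  "approximant f = (SOME fn. (\<forall>n. fn n \<in> carrier A0) \<and> conv fn f)"

lemma approximant:
  assumes "f \<in> carrier A"
  shows "approximant f n \<in> carrier A0" "conv (approximant f) f"
  using someI_ex[OF approximation[OF assms]] unfolding approximant_def by blast+

definition extend :: "(('a \<Rightarrow> 'x \<Rightarrow> complex) \<Rightarrow> real) \<Rightarrow> ('a \<Rightarrow> 'x \<Rightarrow> complex) \<Rightarrow> real" where
  "extend p f = lim (\<lambda>n. p (approximant f n))"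

context
  fixes p
  assumes p: "cstar_seminorm A0 p"
begin

interpretation p: seminormed_star_algebra A0 p by unfold_locales (rule p)

text \<open>The two sequences may be equal, which gives the Cauchy property, or different, which gives
  independence of the approximating sequence.\<close>

lemma seminorm_conv_dist:
  assumes fn: "\<And>n. fn n \<in> carrier A0" and gn: "\<And>n. gn n \<in> carrier A0"
    and cf: "conv fn f" and cg: "conv gn f"
  shows "\<exists>c. c \<longlonglongrightarrow> 0 \<and> (\<forall>m n. p (sdiff A0 (fn m) (gn n)) \<le> c m + (c n :: real))"
proof -
  obtain F c where "conv_via F c fn f"
    using cf unfolding conv_def by blast
  note F = conv_viaD[OF this]
  obtain F' c' where "conv_via F' c' gn f"
    using cg unfolding conv_def by blast
  note F' = conv_viaD[OF this]
  let ?F = "F \<union> F'"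
  let ?c = "\<lambda>n. real (card ?F) * (c n + c' n)"
  have lim: "?c \<longlonglongrightarrow> 0"
    using tendsto_add[OF F(3) F'(3)] by (intro tendsto_mult_right_zero) simp
  have "p (sdiff A0 (fn m) (gn n)) \<le> ?c m + ?c n" for m n
  proof -
    have d: "sdiff A0 (fn m) (gn n) = (\<lambda>t y. fn m t y - gn n t y)" by (simp add: sdiff_def)
    have "p (sdiff A0 (fn m) (gn n)) \<le> (\<Sum>t\<in>?F. c m + c' n)"
    proof (rule sub.seminorm_le_l1[OF p sub.A.diff_closed[OF fn gn]])
      show "finite ?F" "?F \<subseteq> carrier G" using F F' by auto
      show "{s. sdiff A0 (fn m) (gn n) s \<noteq> (\<lambda>_. 0)} \<subseteq> ?F"
        unfolding d using F(5) F'(5) by auto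
      fix t y
      have "cmod ((fn m t y - f t y) - (gn n t y - f t y)) \<le> c m + c' n"
        by (rule order_trans[OF norm_triangle_ineq4 add_mono[OF F(7) F'(7)]])
      then show "cmod (sdiff A0 (fn m) (gn n) t y) \<le> c m + c' n" unfolding d by simp
    qed
    also have "\<dots> = real (card ?F) * (c m + c' n)" by simp
    also have "\<dots> \<le> real (card ?F) * ((c m + c' m) + (c n + c' n))"
      using F(4)[of n] F'(4)[of m] by (intro mult_left_mono) auto
    finally show ?thesis by (simp only: distrib_left)
  qed
  then show ?thesis using lim by (intro exI[of _ ?c]) blast
qed

lemma extend_approximant:
  assumes f: "f \<in> carrier A"
  shows "(\<lambda>n. p (approximant f n)) \<longlonglongrightarrow> extend p f"
proof -
  note a = approximant[OF f]
  obtain c where c: "c \<longlonglongrightarrow> 0" "\<forall>m n. p (sdiff A0 (approximant f m) (approximant f n)) \<le> c m + (c n :: real)"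
    using seminorm_conv_dist[OF a(1) a(1) a(2) a(2)] by blast
  have "Cauchy (\<lambda>n. p (approximant f n))"
  proof (rule metric_CauchyI)
    fix e :: real assume e: "0 < e"
    have "eventually (\<lambda>n. c n < e / 2) sequentially"
      by (rule order_tendstoD(2)[OF c(1)]) (use e in simp)
    then obtain K where K: "\<forall>n\<ge>K. c n < e / 2" unfolding eventually_sequentially by blast
    have "dist (p (approximant f m)) (p (approximant f n)) < e" if "m \<ge> K" "n \<ge> K" for m n
    proof -
      have "dist (p (approximant f m)) (p (approximant f n)) \<le> c m + c n"
        unfolding dist_real_def using p.p_abs_diff[OF a(1) a(1)] c(2) order_trans by blast
      also have "\<dots> < e" using K that by (smt (verit) field_sum_of_halves)
      finally show ?thesis .
    qed
    then show "\<exists>K. \<forall>m\<ge>K. \<forall>n\<ge>K. dist (p (approximant f m)) (p (approximant f n)) < e" by blast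
  qed
  then have "convergent (\<lambda>n. p (approximant f n))" by (rule Cauchy_convergent)
  then show ?thesis unfolding extend_def convergent_LIMSEQ_iff .
qed

lemma extend_limit:
  assumes f: "f \<in> carrier A" and fn: "\<And>n. fn n \<in> carrier A0" and cf: "conv fn f"
  shows "(\<lambda>n. p (fn n)) \<longlonglongrightarrow> extend p f"
proof -
  note a = approximant[OF f]
  obtain c where c: "c \<longlonglongrightarrow> 0" "\<forall>m n. p (sdiff A0 (fn m) (approximant f n)) \<le> c m + (c n :: real)"
    using seminorm_conv_dist[OF fn a(1) cf a(2)] by blast
  have lim: "(\<lambda>n. c n + c n) \<longlonglongrightarrow> 0" using tendsto_add[OF c(1) c(1)] by simp
  have le: "\<bar>p (fn n) - p (approximant f n)\<bar> \<le> c n + c n" for n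
    using p.p_abs_diff[OF fn a(1)] c(2) order_trans by blast
  have "(\<lambda>n. \<bar>p (fn n) - p (approximant f n)\<bar>) \<longlonglongrightarrow> 0"
    by (rule null_seq_le[OF lim abs_ge_zero le])
  then have "(\<lambda>n. p (fn n) - p (approximant f n)) \<longlonglongrightarrow> 0" by (rule tendsto_rabs_zero_cancel)
  from tendsto_add[OF this extend_approximant[OF f]] show ?thesis by simp
qed

lemma extend_eq:
  assumes f: "f \<in> carrier A0"
  shows "extend p f = p f"
proof (rule LIMSEQ_unique)
  show "(\<lambda>_. p f) \<longlonglongrightarrow> extend p f"
    by (rule extend_limit[OF A0_A[OF f] f conv_const[OF A_CV[OF A0_A[OF f]]]])
qed (rule tendsto_const)

text \<open>Each property of \<open>p\<close> holds along approximants and passes to the limit.\<close>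

lemma cstar_seminorm_extend: "cstar_seminorm A (extend p)"
  unfolding cstar_seminorm_def
proof (intro conjI ballI allI)
  fix f assume f: "f \<in> carrier A"
  note a = approximant[OF f] and lf = extend_approximant[OF f]
  show "0 \<le> extend p f"
    by (rule LIMSEQ_le_const[OF lf]) (intro exI allI impI p.p_nonneg a(1))
  show "extend p (sscale A c f) = cmod c * extend p f" for c
  proof (rule LIMSEQ_unique)
    show "(\<lambda>n. p (sscale A0 c (approximant f n))) \<longlonglongrightarrow> extend p (sscale A c f)"
      using conv_scale[OF a(2), of c] by (intro extend_limit A.scale_closed f sub.A.scale_closed a(1)) simp
    show "(\<lambda>n. p (sscale A0 c (approximant f n))) \<longlonglongrightarrow> cmod c * extend p f"
      unfolding p.p_scale[OF a(1)] by (intro tendsto_mult_left lf)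
  qed
  have star: "conv (\<lambda>n. sstar A0 (approximant f n)) (sstar A f)"
    unfolding A_star_eq sub.A_star_eq by (rule conv_star[OF a(2)])
  show "extend p (sstar A f) = extend p f"
  proof (rule LIMSEQ_unique)
    show "(\<lambda>n. p (sstar A0 (approximant f n))) \<longlonglongrightarrow> extend p (sstar A f)"
      by (intro extend_limit A.star_closed f sub.A.star_closed a(1) star)
    show "(\<lambda>n. p (sstar A0 (approximant f n))) \<longlonglongrightarrow> extend p f"
      unfolding p.p_star[OF a(1)] by (rule lf)
  qed
  have prod: "(\<lambda>n. p (smult A0 (hn n) (gn n))) \<longlonglongrightarrow> extend p (smult A h g)"
    if "h \<in> carrier A" "g \<in> carrier A" "\<And>n. hn n \<in> carrier A0" "\<And>n. gn n \<in> carrier A0"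
      "conv hn h" "conv gn g" for h g hn gn
  proof -
    note hyps = that
    obtain Kh where Kh: "\<And>t y. cmod (h t y) \<le> Kh" using A_uniformly_bounded[OF hyps(1)] by blast
    obtain Kg where Kg: "\<And>t y. cmod (g t y) \<le> Kg" using A_uniformly_bounded[OF hyps(2)] by blast
    have "conv (\<lambda>n. smult A0 (hn n) (gn n)) (smult A h g)"
      unfolding A_mult_eq sub.A_mult_eq by (rule conv_mult[OF hyps(5,6) Kh Kg])
    then show ?thesis by (intro extend_limit A.mult_closed sub.A.mult_closed hyps(1-4))
  qed
  show "extend p (smult A (sstar A f) f) = (extend p f)\<^sup>2"
  proof (rule LIMSEQ_unique)
    show "(\<lambda>n. p (smult A0 (sstar A0 (approximant f n)) (approximant f n))) \<longlonglongrightarrow> extend p (smult A (sstar A f) f)"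
      by (intro prod A.star_closed f sub.A.star_closed a star)
    show "(\<lambda>n. p (smult A0 (sstar A0 (approximant f n)) (approximant f n))) \<longlonglongrightarrow> (extend p f)\<^sup>2"
      unfolding p.p_star_mult[OF a(1)] by (intro tendsto_power lf)
  qed
  fix g assume g: "g \<in> carrier A"
  note b = approximant[OF g] and lg = extend_approximant[OF g]
  show "extend p (sadd A f g) \<le> extend p f + extend p g"
  proof (rule LIMSEQ_le)
    show "(\<lambda>n. p (sadd A0 (approximant f n) (approximant g n))) \<longlonglongrightarrow> extend p (sadd A f g)"
      using conv_add[OF a(2) b(2)] by (intro extend_limit A.add_closed f g sub.A.add_closed a(1) b(1)) simp
    show "(\<lambda>n. p (approximant f n) + p (approximant g n)) \<longlonglongrightarrow> extend p f + extend p g"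
      by (intro tendsto_add lf lg)
    show "\<exists>N. \<forall>n\<ge>N. p (sadd A0 (approximant f n) (approximant g n)) \<le> p (approximant f n) + p (approximant g n)"
      by (intro exI allI impI p.p_add a(1) b(1))
  qed
  show "extend p (smult A f g) \<le> extend p f * extend p g"
  proof (rule LIMSEQ_le)
    show "(\<lambda>n. p (smult A0 (approximant f n) (approximant g n))) \<longlonglongrightarrow> extend p (smult A f g)"
      by (intro prod f g a b)
    show "(\<lambda>n. p (approximant f n) * p (approximant g n)) \<longlonglongrightarrow> extend p f * extend p g"
      by (intro tendsto_mult lf lg)
    show "\<exists>N. \<forall>n\<ge>N. p (smult A0 (approximant f n) (approximant g n)) \<le> p (approximant f n) * p (approximant g n)"
      by (intro exI allI impI p.p_mult a(1) b(1))
  qed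
qed

end

lemma cstar_norm_full: "cstar_norm A0 full"
proof -
  have "cstar_seminorm A0 full"
    using cstar_seminorm_full A0_A
    unfolding cstar_seminorm_def A_mult_eq A_star_eq sub.A_mult_eq sub.A_star_eq cc_alg_ops by blast
  moreover have "f = sscale A0 0 f" if f: "f \<in> carrier A0" and z: "full f = 0" for f
  proof -
    have "reduced_norm f = 0"
      using reduced_le_full[OF A0_A[OF f]] reduced_norm_nonneg[OF A0_A[OF f]] z by simp
    then have "f = sscale A 0 f" by (rule reduced_norm_faithful[OF A0_A[OF f]])
    then show ?thesis unfolding cc_alg_ops .
  qed
  ultimately show ?thesis unfolding cstar_norm_def by blast
qed

text \<open>A C*-norm on \<open>A0\<close> lies below the full norm because it extends to \<open>A\<close>, and above the reduced
  norm because it dominates the conditional expectation.\<close>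

theorem unique_cstar_norm:
  assumes iso: "star_iso (full_crossed_product G E tr) (reduced_crossed_product G X E tr) (regular_rep G X tr)"
    and expect: "\<And>p f y. cstar_norm A0 p \<Longrightarrow> f \<in> carrier A0 \<Longrightarrow> y \<in> X \<Longrightarrow> cmod (f \<one> y) \<le> p f"
  shows "\<exists>!p. p \<in> extensional (carrier (algebraic_crossed_product G E E0 tr)) \<and>
    cstar_norm (algebraic_crossed_product G E E0 tr) p"
proof (rule ex1_cstar_norm_star_iso[OF sub.star_algebra_A star_iso_algebraic_crossed_product cstar_norm_full])
  fix p f assume p: "cstar_norm A0 p" and f: "f \<in> carrier A0"
  have s: "cstar_seminorm A0 p" using p unfolding cstar_norm_def by (rule conjunct1)
  have "p f = extend p f" by (rule extend_eq[OF s f, symmetric])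
  also have "\<dots> \<le> full f" by (rule full_norm_upper[OF cstar_seminorm_extend[OF s] A0_A[OF f]])
  finally have "p f \<le> full f" .
  moreover have "full f = reduced_norm f" by (rule full_eq_reduced[OF iso A0_A[OF f]])
  moreover have "reduced_norm f \<le> p f"
    by (rule sub.reduced_norm_le_of_expectation[OF s expect[OF p] f])
  ultimately show "p f = full f" by simp
qed

end

section \<open>Semidirect products and the conjugates of a normal subgroup\<close>

locale conj_system = group G for G (structure) +
  fixes N H M :: "'a set" and \<U> :: "'a set set"
  assumes N_normal: "N \<lhd> G" and H_subgroup: "subgroup H G" and NH: "N <#> H = carrier G"
    and NH_disjoint: "N \<inter> H = {\<one>}" and M_normal: "M \<lhd> (G\<lparr>carrier := N\<rparr>)"
    and U_eq: "\<U> = conj_family G H M"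
    and filter_base: "\<forall>U\<in>\<U>. \<forall>V\<in>\<U>. \<exists>W\<in>\<U>. W \<subseteq> U \<inter> V"
    and separating: "\<Inter>\<U> = {\<one>}"
    and finite_quotients: "\<forall>U\<in>\<U>. \<forall>V\<in>\<U>. V \<subseteq> U \<longrightarrow> finite (carrier (G\<lparr>carrier := U\<rparr> Mod V))"
    and effective: "\<forall>a\<in>H. a \<noteq> \<one> \<longrightarrow> (\<exists>s\<in>M. a \<otimes> s \<otimes> inv a \<noteq> s)"
begin

lemma N_subgroup: "subgroup N G"
  using N_normal by (rule normal_imp_subgroup)

lemma N_carrier [simp]: "x \<in> N \<Longrightarrow> x \<in> carrier G"
  using subgroup.mem_carrier[OF N_subgroup] .

lemma H_carrier [simp]: "a \<in> H \<Longrightarrow> a \<in> carrier G"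
  using subgroup.mem_carrier[OF H_subgroup] .

lemma N_closed [simp]: "x \<in> N \<Longrightarrow> y \<in> N \<Longrightarrow> x \<otimes> y \<in> N" "x \<in> N \<Longrightarrow> inv x \<in> N" "\<one> \<in> N"
  using N_subgroup by (auto simp: subgroup.m_closed subgroup.m_inv_closed subgroup.one_closed)

lemma H_closed [simp]: "x \<in> H \<Longrightarrow> y \<in> H \<Longrightarrow> x \<otimes> y \<in> H" "x \<in> H \<Longrightarrow> inv x \<in> H" "\<one> \<in> H"
  using H_subgroup by (auto simp: subgroup.m_closed subgroup.m_inv_closed subgroup.one_closed)

lemma M_subgroup: "subgroup M G"
  using N_subgroup normal_imp_subgroup[OF M_normal] by (rule incl_subgroup)

lemma M_N: "s \<in> M \<Longrightarrow> s \<in> N"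
  using subgroup.subset[OF normal_imp_subgroup[OF M_normal]] by auto

lemma cancel_left [simp]:
  "t \<in> carrier G \<Longrightarrow> s \<in> carrier G \<Longrightarrow> inv t \<otimes> (t \<otimes> s) = s"
  "t \<in> carrier G \<Longrightarrow> s \<in> carrier G \<Longrightarrow> t \<otimes> (inv t \<otimes> s) = s"
  by (simp_all add: m_assoc[symmetric])

definition conj :: "'a \<Rightarrow> 'a \<Rightarrow> 'a" where
  "conj a y = a \<otimes> y \<otimes> inv a"

lemma conj_carrier [simp]: "a \<in> carrier G \<Longrightarrow> y \<in> carrier G \<Longrightarrow> conj a y \<in> carrier G"
  by (simp add: conj_def)

lemma conj_N [simp]: "a \<in> carrier G \<Longrightarrow> y \<in> N \<Longrightarrow> conj a y \<in> N"
  unfolding conj_def using normal.inv_op_closed2[OF N_normal] by blast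

lemma conj_mult:
  "a \<in> carrier G \<Longrightarrow> y \<in> carrier G \<Longrightarrow> z \<in> carrier G \<Longrightarrow> conj a (y \<otimes> z) = conj a y \<otimes> conj a z"
  by (simp add: conj_def m_assoc)

lemma conj_conj:
  "a \<in> carrier G \<Longrightarrow> b \<in> carrier G \<Longrightarrow> y \<in> carrier G \<Longrightarrow> conj a (conj b y) = conj (a \<otimes> b) y"
  by (simp add: conj_def m_assoc inv_mult_group)

lemma conj_one [simp]: "y \<in> carrier G \<Longrightarrow> conj \<one> y = y" "a \<in> carrier G \<Longrightarrow> conj a \<one> = \<one>"
  by (simp_all add: conj_def)

lemma conj_inv_cancel [simp]:
  "a \<in> carrier G \<Longrightarrow> y \<in> carrier G \<Longrightarrow> conj a (conj (inv a) y) = y"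
  "a \<in> carrier G \<Longrightarrow> y \<in> carrier G \<Longrightarrow> conj (inv a) (conj a y) = y"
  by (simp_all add: conj_conj)

lemma decompose:
  assumes "g \<in> carrier G"
  obtains x a where "x \<in> N" "a \<in> H" "g = x \<otimes> a"
proof -
  have "g \<in> N <#> H" using assms NH by simp
  then show thesis using that unfolding set_mult_def by blast
qed

lemma decompose_unique:
  assumes "x \<in> N" "a \<in> H" "x' \<in> N" "a' \<in> H" and eq: "x \<otimes> a = x' \<otimes> a'"
  shows "x = x'" "a = a'"
proof -
  have e: "inv x' \<otimes> x = a' \<otimes> inv a"
  proof -
    have "inv x' \<otimes> x = inv x' \<otimes> (x \<otimes> a) \<otimes> inv a" using assms(1-4) by (simp add: m_assoc)
    also have "\<dots> = a' \<otimes> inv a" using assms(1-4) by (simp add: eq m_assoc[symmetric])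
    finally show ?thesis .
  qed
  have "inv x' \<otimes> x \<in> N" using assms by simp
  moreover have "inv x' \<otimes> x \<in> H" unfolding e using assms by simp
  ultimately have one: "inv x' \<otimes> x = \<one>" using NH_disjoint by blast
  have "x = x' \<otimes> (inv x' \<otimes> x)" using assms by simp
  then show "x = x'" using one assms by simp
  have "a' = (a' \<otimes> inv a) \<otimes> a" using assms by (simp add: m_assoc)
  then show "a = a'" using one assms by (simp add: e)
qed

lemma beta_apply:
  assumes "x \<in> N" "a \<in> H" "y \<in> N"
  shows "beta G N H (x \<otimes> a) y = x \<otimes> conj a y"
  unfolding beta_def
proof (rule the_equality)
  show "\<exists>x'\<in>N. \<exists>a'\<in>H. x \<otimes> a = x' \<otimes> a' \<and> x \<otimes> conj a y = x' \<otimes> a' \<otimes> y \<otimes> inv a'"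
    using assms by (intro bexI[of _ x] bexI[of _ a]) (simp_all add: conj_def m_assoc)
  fix z assume "\<exists>x'\<in>N. \<exists>a'\<in>H. x \<otimes> a = x' \<otimes> a' \<and> z = x' \<otimes> a' \<otimes> y \<otimes> inv a'"
  then obtain x' a' where x': "x' \<in> N" "a' \<in> H" "x \<otimes> a = x' \<otimes> a'" "z = x' \<otimes> a' \<otimes> y \<otimes> inv a'"
    by blast
  have eq: "x = x'" "a = a'" by (rule decompose_unique[OF assms(1,2) x'(1,2,3)])+
  show "z = x \<otimes> conj a y"
    unfolding x'(4) eq using x'(1,2) assms(3) by (simp add: conj_def m_assoc)
qed

sublocale action: group_on_set G N "beta G N H"
proof
  fix g y assume g: "g \<in> carrier G" and y: "y \<in> N"
  obtain x a where xa: "x \<in> N" "a \<in> H" "g = x \<otimes> a" using g by (rule decompose)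
  show "beta G N H g y \<in> N" using xa y by (simp add: beta_apply)
  fix h assume h: "h \<in> carrier G"
  obtain x' a' where xa': "x' \<in> N" "a' \<in> H" "h = x' \<otimes> a'" using h by (rule decompose)
  have gh: "g \<otimes> h = (x \<otimes> conj a x') \<otimes> (a \<otimes> a')"
    using xa xa' by (simp add: conj_def m_assoc)
  have "beta G N H (g \<otimes> h) y = (x \<otimes> conj a x') \<otimes> conj (a \<otimes> a') y"
    unfolding gh by (rule beta_apply) (use xa xa' y in simp_all)
  moreover have "beta G N H g (beta G N H h y) = x \<otimes> conj a (x' \<otimes> conj a' y)"
    using xa xa' y by (simp add: beta_apply)
  ultimately show "beta G N H (g \<otimes> h) y = beta G N H g (beta G N H h y)"
    using xa xa' y by (simp add: conj_mult conj_conj m_assoc)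
next
  fix y assume "y \<in> N"
  then show "beta G N H \<one> y = y" using beta_apply[of \<one> \<one> y] by simp
qed

lemma alpha_eq: "alpha G N H = translate G N (beta G N H)"
  by (simp add: alpha_def translate_def fun_eq_iff)

text \<open>An element of \<open>G\<close> acts on \<open>N\<close> by an affine map, whose linear part is conjugation by its
  \<open>H\<close>-component.\<close>

lemma beta_affine:
  assumes "t \<in> carrier G"
  obtains a where "a \<in> H" "a = \<one> \<Longrightarrow> t \<in> N"
    "\<And>y u. y \<in> N \<Longrightarrow> u \<in> N \<Longrightarrow> beta G N H t (y \<otimes> u) = beta G N H t y \<otimes> conj a u"
proof -
  obtain x a where xa: "x \<in> N" "a \<in> H" "t = x \<otimes> a" using assms by (rule decompose)
  show thesis
  proof (rule that[OF xa(2)])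
    show "t \<in> N" if "a = \<one>" using xa that by simp
    show "beta G N H t (y \<otimes> u) = beta G N H t y \<otimes> conj a u" if "y \<in> N" "u \<in> N" for y u
      using xa that by (simp add: beta_apply conj_mult m_assoc)
  qed
qed

subsection \<open>The neighbourhood base\<close>

lemma U_cases:
  assumes "U \<in> \<U>"
  obtains b where "b \<in> H" "U = conj b ` M"
proof -
  obtain b where b: "b \<in> H" "U = (b <# M) #> inv b"
    using assms unfolding U_eq conj_family_def by blast
  have "(b <# M) #> inv b = conj b ` M"
    unfolding l_coset_def r_coset_def conj_def by blast
  then show thesis using b that by simp
qed

lemma U_I: "b \<in> H \<Longrightarrow> conj b ` M \<in> \<U>"
proof -
  assume b: "b \<in> H"
  have "conj b ` M = (b <# M) #> inv b"
    unfolding l_coset_def r_coset_def conj_def by blast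
  then show ?thesis using b unfolding U_eq conj_family_def by blast
qed

lemma U_nonempty: "\<exists>U. U \<in> \<U>"
  using U_I[of \<one>] by auto

lemma M_carrier [simp]: "s \<in> M \<Longrightarrow> s \<in> carrier G"
  using M_N by simp

lemma U_N: "U \<in> \<U> \<Longrightarrow> u \<in> U \<Longrightarrow> u \<in> N"
  by (elim U_cases) (auto simp: M_N)

lemma U_carrier: "U \<in> \<U> \<Longrightarrow> u \<in> U \<Longrightarrow> u \<in> carrier G"
  using U_N by simp

lemma U_one: "U \<in> \<U> \<Longrightarrow> \<one> \<in> U"
  using separating by blast

lemma U_mult:
  assumes "U \<in> \<U>" "u \<in> U" "v \<in> U"
  shows "u \<otimes> v \<in> U"
proof -
  obtain b where b: "b \<in> H" "U = conj b ` M" using assms(1) by (rule U_cases)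
  obtain s s' where s: "s \<in> M" "u = conj b s" "s' \<in> M" "v = conj b s'" using assms b by blast
  have "u \<otimes> v = conj b (s \<otimes> s')" using b s by (simp add: conj_mult)
  then show ?thesis using b subgroup.m_closed[OF M_subgroup s(1,3)] by blast
qed

lemma U_inv:
  assumes "U \<in> \<U>" "u \<in> U"
  shows "inv u \<in> U"
proof -
  obtain b where b: "b \<in> H" "U = conj b ` M" using assms(1) by (rule U_cases)
  obtain s where s: "s \<in> M" "u = conj b s" using assms b by blast
  have "inv u = conj b (inv s)" using b s by (simp add: conj_def inv_mult_group m_assoc)
  then show ?thesis using b subgroup.m_inv_closed[OF M_subgroup s(1)] by blast
qed

lemma U_conj:
  assumes "U \<in> \<U>" "a \<in> H"
  shows "conj a ` U \<in> \<U>"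
proof -
  obtain b where b: "b \<in> H" "U = conj b ` M" using assms(1) by (rule U_cases)
  have "conj a ` U = conj (a \<otimes> b) ` M"
    unfolding b(2) image_image by (rule image_cong) (use b assms in \<open>simp_all add: conj_conj\<close>)
  then show ?thesis using U_I[of "a \<otimes> b"] b assms by simp
qed

lemma mem_l_coset: "y \<in> x <# U \<longleftrightarrow> (\<exists>u\<in>U. y = x \<otimes> u)"
  unfolding l_coset_def by blast

text \<open>The quotient consists of right cosets, and inversion turns these into left cosets.\<close>

lemma finite_coset_cover:
  assumes U: "U \<in> \<U>" and W: "W \<in> \<U>" and WU: "W \<subseteq> U"
  shows "\<exists>T. finite T \<and> T \<subseteq> U \<and> (\<forall>u\<in>U. \<exists>t\<in>T. u \<in> t <# W)"
proof -
  let ?C = "(\<lambda>u. W #> u) ` U"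
  have "carrier (G\<lparr>carrier := U\<rparr> Mod W) = ?C"
    by (auto simp: FactGroup_def RCOSETS_def r_coset_def)
  then have fin: "finite ?C" using finite_quotients U W WU by metis
  then obtain R where R: "finite R" "R \<subseteq> U" "?C = (\<lambda>u. W #> u) ` R"
    by (metis finite_subset_image order_refl)
  let ?T = "(\<lambda>c. inv c) ` R"
  have "\<exists>t\<in>?T. u \<in> t <# W" if u: "u \<in> U" for u
  proof -
    have "W #> inv u \<in> ?C" using U_inv[OF U u] by blast
    then obtain c where c: "c \<in> R" "W #> inv u = W #> c" using R by auto
    have uc: "u \<in> carrier G" "c \<in> carrier G" using U_carrier[OF U] u c R by auto
    have "\<one> \<otimes> inv u \<in> W #> inv u" unfolding r_coset_def using U_one[OF W] by blast
    then have "inv u \<in> W #> c" using uc by (simp add: c(2)[symmetric])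
    then obtain w where w: "w \<in> W" "inv u = w \<otimes> c" unfolding r_coset_def by blast
    have wc: "w \<in> carrier G" using U_carrier[OF W w(1)] .
    have "u = inv (inv u)" using uc by simp
    also have "\<dots> = inv c \<otimes> inv w" using w(2) uc wc by (simp add: inv_mult_group)
    finally have "u \<in> inv c <# W" unfolding mem_l_coset using U_inv[OF W w(1)] by blast
    then show ?thesis using c(1) by blast
  qed
  moreover have "?T \<subseteq> U" using R(2) U_inv[OF U] by blast
  ultimately show ?thesis using R(1) by (intro exI[of _ ?T]) simp
qed

subsection \<open>Elements other than the identity move small cosets off themselves\<close>

text \<open>If \<open>t\<close> fixed all of \<open>xU\<close>, its linear part would fix \<open>U = b M b\<^sup>-\<^sup>1\<close> pointwise, so the conjugate of that
  linear part by \<open>b\<close> would fix \<open>M\<close>. Effectiveness makes the linear part trivial, and then \<open>t\<close> is a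
  translation with a fixed point.\<close>

lemma moved_point:
  assumes t: "t \<in> carrier G" "t \<noteq> \<one>" and x: "x \<in> N" and U: "U \<in> \<U>"
  shows "\<exists>u\<in>U. beta G N H t (x \<otimes> u) \<noteq> x \<otimes> u"
proof (rule ccontr)
  assume "\<not> ?thesis"
  then have fix_all: "beta G N H t (x \<otimes> u) = x \<otimes> u" if "u \<in> U" for u using that by blast
  obtain a where a: "a \<in> H" "a = \<one> \<Longrightarrow> t \<in> N"
    "\<And>y u. y \<in> N \<Longrightarrow> u \<in> N \<Longrightarrow> beta G N H t (y \<otimes> u) = beta G N H t y \<otimes> conj a u"
    using t(1) by (rule beta_affine) blast
  have fx: "beta G N H t x = x" using fix_all[OF U_one[OF U]] x by simp
  have cu: "conj a u = u" if u: "u \<in> U" for u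
  proof -
    have "x \<otimes> conj a u = x \<otimes> u" using a(3)[OF x U_N[OF U u]] fix_all[OF u] fx by simp
    then show ?thesis using x a(1) U_carrier[OF U u] by simp
  qed
  obtain b where b: "b \<in> H" "U = conj b ` M" using U by (rule U_cases)
  define a' where "a' = inv b \<otimes> a \<otimes> b"
  have a': "a' \<in> H" using a b by (simp add: a'_def)
  have "a' \<otimes> s \<otimes> inv a' = s" if s: "s \<in> M" for s
  proof -
    have "conj a (conj b s) = conj b s" using cu b s by blast
    then have "conj (inv b) (conj a (conj b s)) = s" using b s by simp
    moreover have "conj (inv b) (conj a (conj b s)) = conj a' s"
      using a b s by (simp add: conj_conj a'_def m_assoc)
    ultimately show ?thesis by (simp add: conj_def)
  qed
  then have "a' = \<one>" using effective a' by blast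
  have "a = b \<otimes> a' \<otimes> inv b" using a(1) b(1) by (simp add: a'_def m_assoc)
  then have "a = \<one>" using \<open>a' = \<one>\<close> b(1) by simp
  then have tN: "t \<in> N" by (rule a(2))
  then have "beta G N H t x = t \<otimes> x" using beta_apply[of t \<one> x] x by simp
  then have "t \<otimes> x = \<one> \<otimes> x" using fx x by simp
  then show False using t x tN by simp
qed

text \<open>For a moved point \<open>y\<close>, some \<open>V\<close> does not contain \<open>k = y\<^sup>-\<^sup>1 \<beta>\<^sub>t(y)\<close>. An intersection of \<open>\<beta>\<^sub>t(yW)\<close> and
  \<open>yW\<close> puts \<open>k\<close> in \<open>W \<cdot> a W a\<^sup>-\<^sup>1\<close>, where \<open>a\<close> is the \<open>H\<close>-component of \<open>t\<close>, so it suffices that \<open>W\<close> lies in \<open>V\<close>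
  and in \<open>a\<^sup>-\<^sup>1 V a\<close>.\<close>

lemma moved_coset:
  assumes t: "t \<in> carrier G" "t \<noteq> \<one>" and x: "x \<in> N" and U: "U \<in> \<U>"
  shows "\<exists>y W. y \<in> x <# U \<and> W \<in> \<U> \<and> W \<subseteq> U \<and>
    (\<forall>w\<in>W. \<forall>w'\<in>W. beta G N H t (y \<otimes> w) \<noteq> y \<otimes> w')"
proof -
  obtain u where u: "u \<in> U" "beta G N H t (x \<otimes> u) \<noteq> x \<otimes> u" using moved_point[OF assms] by blast
  define y where "y = x \<otimes> u"
  have y: "y \<in> N" using x U_N[OF U u(1)] by (simp add: y_def)
  obtain a where a: "a \<in> H" "a = \<one> \<Longrightarrow> t \<in> N"
    "\<And>y u. y \<in> N \<Longrightarrow> u \<in> N \<Longrightarrow> beta G N H t (y \<otimes> u) = beta G N H t y \<otimes> conj a u"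
    using t(1) by (rule beta_affine) blast
  define k where "k = inv y \<otimes> beta G N H t y"
  have byN: "beta G N H t y \<in> N" using t y by simp
  have "k \<noteq> \<one>"
  proof
    assume "k = \<one>"
    then have "y \<otimes> k = y" using y by simp
    then show False using u(2) y byN by (simp add: k_def y_def[symmetric])
  qed
  then obtain V where V: "V \<in> \<U>" "k \<notin> V" using separating by blast
  obtain W1 where W1: "W1 \<in> \<U>" "W1 \<subseteq> U \<inter> V" using filter_base U V(1) by blast
  have aV: "conj (inv a) ` V \<in> \<U>" using U_conj[OF V(1), of "inv a"] a(1) by simp
  obtain W where W: "W \<in> \<U>" "W \<subseteq> W1 \<inter> conj (inv a) ` V" using filter_base W1(1) aV by blast
  have "beta G N H t (y \<otimes> w) \<noteq> y \<otimes> w'" if w: "w \<in> W" "w' \<in> W" for w w'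
  proof
    assume eq: "beta G N H t (y \<otimes> w) = y \<otimes> w'"
    have wN: "w \<in> N" "w' \<in> N" using U_N[OF W(1)] w by blast+
    obtain v where v: "v \<in> V" "w = conj (inv a) v" using W(2) w by blast
    have "conj a w = v" using v a(1) U_carrier[OF V(1) v(1)] by simp
    then have cV: "conj a w \<in> V" using v by simp
    have "k \<otimes> conj a w = inv y \<otimes> beta G N H t (y \<otimes> w)"
      using a(3)[OF y wN(1)] y byN wN a(1) by (simp add: k_def m_assoc)
    also have "\<dots> = w'" using y wN by (simp add: eq)
    finally have e: "k \<otimes> conj a w = w'" .
    have kN: "k \<in> N" using y byN by (simp add: k_def)
    have "k = (k \<otimes> conj a w) \<otimes> inv (conj a w)"
      using kN wN a(1) by (simp add: m_assoc)
    also have "\<dots> = w' \<otimes> inv (conj a w)" by (simp only: e)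
    also have "\<dots> \<in> V" using W W1 w(2) cV by (intro U_mult[OF V(1)] U_inv[OF V(1)]) blast+
    finally show False using V(2) by simp
  qed
  moreover have "y \<in> x <# U" unfolding mem_l_coset y_def using u(1) by blast
  ultimately show ?thesis using W W1 by blast
qed

text \<open>A coset that is disjoint from its image stays so when it is made smaller, so the elements of \<open>F\<close> can
  be treated one after the other.\<close>

lemma moved_coset_finite:
  assumes F: "finite F" "F \<subseteq> carrier G - {\<one>}" and x: "x \<in> N" and U: "U \<in> \<U>"
  shows "\<exists>y W. y \<in> x <# U \<and> W \<in> \<U> \<and> W \<subseteq> U \<and>
    (\<forall>t\<in>F. \<forall>w\<in>W. \<forall>w'\<in>W. beta G N H t (y \<otimes> w) \<noteq> y \<otimes> w')"
  using F
proof (induction F rule: finite_induct)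
  case empty
  have "x \<in> x <# U" unfolding mem_l_coset using U_one[OF U] x by (intro bexI[of _ \<one>]) simp_all
  then show ?case using U by blast
next
  case (insert t F)
  then obtain y W where y: "y \<in> x <# U" and W: "W \<in> \<U>" "W \<subseteq> U"
    and free: "\<forall>t\<in>F. \<forall>w\<in>W. \<forall>w'\<in>W. beta G N H t (y \<otimes> w) \<noteq> y \<otimes> w'" by blast
  obtain u where u: "u \<in> U" "y = x \<otimes> u" using y unfolding mem_l_coset by blast
  have yN: "y \<in> N" using u x U_N[OF U u(1)] by simp
  have t: "t \<in> carrier G" "t \<noteq> \<one>" using insert.prems by auto
  obtain z V where z: "z \<in> y <# W" and V: "V \<in> \<U>" "V \<subseteq> W"
    and free_t: "\<forall>w\<in>V. \<forall>w'\<in>V. beta G N H t (z \<otimes> w) \<noteq> z \<otimes> w'"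
    using moved_coset[OF t yN W(1)] by blast
  obtain v where v: "v \<in> W" "z = y \<otimes> v" using z unfolding mem_l_coset by blast
  have vc: "v \<in> carrier G" "u \<in> carrier G" using U_carrier[OF W(1) v(1)] U_carrier[OF U u(1)] .
  have "z = x \<otimes> (u \<otimes> v)" using v u x vc by (simp add: m_assoc)
  moreover have "u \<otimes> v \<in> U" using U_mult[OF U u(1)] v(1) W(2) by blast
  ultimately have "z \<in> x <# U" unfolding mem_l_coset by blast
  moreover have "beta G N H s (z \<otimes> w) \<noteq> z \<otimes> w'" if s: "s \<in> F" and w: "w \<in> V" "w' \<in> V" for s w w'
  proof -
    have c: "w \<in> carrier G" "w' \<in> carrier G" using U_carrier[OF V(1)] w by blast+
    have "z \<otimes> w = y \<otimes> (v \<otimes> w)" "z \<otimes> w' = y \<otimes> (v \<otimes> w')"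
      using v yN vc c by (simp_all add: m_assoc)
    moreover have "v \<otimes> w \<in> W" "v \<otimes> w' \<in> W" using U_mult[OF W(1) v(1)] w V(2) by blast+
    ultimately show ?thesis using free s by metis
  qed
  ultimately show ?case using free_t V W(2) by (intro exI[of _ z] exI[of _ V]) blast
qed

subsection \<open>Step functions\<close>

text \<open>The span of the coset indicators, described without choosing a linear combination: invariance under
  some \<open>U\<close>, and a support covered by finitely many cosets of \<open>U\<close>.\<close>

definition step_via :: "'a set \<Rightarrow> 'a set \<Rightarrow> ('a \<Rightarrow> complex) \<Rightarrow> bool" where
  "step_via U S f \<longleftrightarrow> U \<in> \<U> \<and> finite S \<and> S \<subseteq> N \<and> (\<forall>y. y \<notin> N \<longrightarrow> f y = 0) \<and>
     (\<forall>y\<in>N. \<forall>u\<in>U. f (y \<otimes> u) = f y) \<and> (\<forall>y\<in>N. f y \<noteq> 0 \<longrightarrow> (\<exists>x\<in>S. y \<in> x <# U))"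

definition steps :: "('a \<Rightarrow> complex) set" where
  "steps = {f. \<exists>U S. step_via U S f}"

lemma step_viaD:
  assumes "step_via U S f"
  shows "U \<in> \<U>" "finite S" "S \<subseteq> N" "\<And>y. y \<notin> N \<Longrightarrow> f y = 0"
    "\<And>y u. y \<in> N \<Longrightarrow> u \<in> U \<Longrightarrow> f (y \<otimes> u) = f y"
    "\<And>y. y \<in> N \<Longrightarrow> f y \<noteq> 0 \<Longrightarrow> \<exists>x\<in>S. y \<in> x <# U"
  using assms unfolding step_via_def by blast+

text \<open>Two step functions can be brought to a common \<open>U\<close>. This is the use of the finite quotients.\<close>

lemma step_refine:
  assumes f: "step_via U S f" and W: "W \<in> \<U>" "W \<subseteq> U"
  shows "\<exists>S'. step_via W S' f"
proof -
  note s = step_viaD[OF f]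
  obtain T where T: "finite T" "T \<subseteq> U" "\<forall>u\<in>U. \<exists>t\<in>T. u \<in> t <# W"
    using finite_coset_cover[OF s(1) W] by blast
  let ?S = "(\<lambda>(x, t). x \<otimes> t) ` (S \<times> T)"
  have "\<exists>x\<in>?S. y \<in> x <# W" if y: "y \<in> N" "f y \<noteq> 0" for y
  proof -
    obtain x u where x: "x \<in> S" "u \<in> U" "y = x \<otimes> u" using s(6)[OF y] unfolding mem_l_coset by blast
    obtain t w where t: "t \<in> T" "w \<in> W" "u = t \<otimes> w" using T(3) x(2) unfolding mem_l_coset by blast
    have c: "x \<in> carrier G" "t \<in> carrier G" "w \<in> carrier G"
      using x(1) s(3) t T(2) U_carrier[OF s(1)] U_carrier[OF W(1)] by auto
    have "y = (x \<otimes> t) \<otimes> w" using x t c by (simp add: m_assoc)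
    then have "y \<in> (x \<otimes> t) <# W" unfolding mem_l_coset using t(2) by blast
    then show ?thesis using x(1) t(1) by (intro bexI[of _ "x \<otimes> t"]) auto
  qed
  moreover have "?S \<subseteq> N" using subsetD[OF s(3)] subsetD[OF T(2)] U_N[OF s(1)] by auto
  ultimately have "step_via W ?S f"
    unfolding step_via_def using s(2,4,5) T(1) W by (intro conjI) auto
  then show ?thesis by blast
qed

text \<open>All closure properties of the step functions, including those under nonlinear functions such as
  \<open>h \<mapsto> 1 - \<surd>(1 - h\<^sup>2)\<close>, are instances of this one.\<close>

lemma steps_combine:
  assumes f: "f \<in> steps" and g: "g \<in> steps" and zero: "\<phi> 0 0 = 0"
  shows "(\<lambda>y. \<phi> (f y) (g y)) \<in> steps"
proof -
  obtain U S where f: "step_via U S f" using f unfolding steps_def by blast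
  obtain V T where g: "step_via V T g" using g unfolding steps_def by blast
  obtain W where W: "W \<in> \<U>" "W \<subseteq> U \<inter> V"
    using filter_base step_viaD(1)[OF f] step_viaD(1)[OF g] by blast
  obtain S' where f': "step_via W S' f" using step_refine[OF f W(1)] W(2) by blast
  obtain T' where g': "step_via W T' g" using step_refine[OF g W(1)] W(2) by blast
  note F = step_viaD[OF f'] and K = step_viaD[OF g']
  have "step_via W (S' \<union> T') (\<lambda>y. \<phi> (f y) (g y))"
    unfolding step_via_def
  proof (intro conjI ballI allI impI)
    show "\<exists>x\<in>S' \<union> T'. y \<in> x <# W" if "y \<in> N" "\<phi> (f y) (g y) \<noteq> 0" for y
    proof -
      have "f y \<noteq> 0 \<or> g y \<noteq> 0" using that zero by metis
      then show ?thesis using F(6) K(6) that(1) by blast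
    qed
  qed (use F(2,3,4,5) K(2,3,4,5) W zero in auto)
  then show ?thesis unfolding steps_def by blast
qed

lemma indicator_step:
  assumes x: "x \<in> N" and U: "U \<in> \<U>"
  shows "step_via U {x} (indicator (x <# U))"
proof -
  have inv_U: "(indicator (x <# U) (y \<otimes> u) :: complex) = indicator (x <# U) y" if "y \<in> N" "u \<in> U" for y u
  proof -
    have "y \<otimes> u \<in> x <# U \<longleftrightarrow> y \<in> x <# U"
    proof
      assume "y \<otimes> u \<in> x <# U"
      then obtain v where v: "v \<in> U" "y \<otimes> u = x \<otimes> v" unfolding mem_l_coset by blast
      have c: "u \<in> carrier G" "v \<in> carrier G" using U_carrier[OF U] that v by blast+
      have "y = (y \<otimes> u) \<otimes> inv u" using that c by (simp add: m_assoc)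
      also have "\<dots> = x \<otimes> (v \<otimes> inv u)" using v x c by (simp add: m_assoc)
      finally show "y \<in> x <# U"
        unfolding mem_l_coset using U_mult[OF U v(1) U_inv[OF U that(2)]] by blast
    next
      assume "y \<in> x <# U"
      then obtain v where v: "v \<in> U" "y = x \<otimes> v" unfolding mem_l_coset by blast
      have "y \<otimes> u = x \<otimes> (v \<otimes> u)"
        using v x that U_carrier[OF U v(1)] U_carrier[OF U that(2)] by (simp add: m_assoc)
      then show "y \<otimes> u \<in> x <# U" unfolding mem_l_coset using U_mult[OF U v(1) that(2)] by blast
    qed
    then show ?thesis by (simp add: indicator_def)
  qed
  have "x <# U \<subseteq> N" unfolding l_coset_def using x U_N[OF U] by auto
  then have out: "(indicator (x <# U) y :: complex) = 0" if "y \<notin> N" for y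
    using that by (auto simp: indicator_def)
  show ?thesis
    unfolding step_via_def using U x inv_U out by (auto simp: indicator_def split: if_splits)
qed

lemma steps_zero: "(\<lambda>_. 0) \<in> steps"
  using U_nonempty unfolding steps_def step_via_def by (auto intro!: exI[of _ "{}"])

lemma linf_ops [simp]:
  "sadd (linf N) = (\<lambda>f g y. f y + g y)" "sscale (linf N) = (\<lambda>c f y. c * f y)"
  "smult (linf N) = (\<lambda>f g y. f y * g y)" "sstar (linf N) = (\<lambda>f y. cnj (f y))"
  "snorm (linf N) = (\<lambda>f. SUP y\<in>N. cmod (f y))"
  by (simp_all add: linf_def)

lemma D0_eq_steps: "D0_alg G N \<U> = steps"
proof
  show "D0_alg G N \<U> \<subseteq> steps"
  proof
    fix f assume "f \<in> D0_alg G N \<U>"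
    then show "f \<in> steps"
      unfolding D0_alg_def
    proof (induction rule: cspan.induct)
      case (base f)
      then show ?case
        unfolding coset_indicators_def steps_def using indicator_step by blast
    next
      case (add f g)
      then show ?case using steps_combine[of f g "(+)"] by simp
    next
      case (scale f c)
      then show ?case using steps_combine[of f f "\<lambda>z _. c * z"] by simp
    qed
  qed
  let ?S = "cspan (linf N) (coset_indicators G N \<U>)"
  have ind: "indicator (x <# U) \<in> ?S" if "x \<in> N" "U \<in> \<U>" for x U
    by (rule cspan.base) (use that in \<open>auto simp: coset_indicators_def\<close>)
  have zero: "(\<lambda>_. 0) \<in> ?S"
  proof -
    obtain U where "U \<in> \<U>" using U_nonempty by blast
    from cspan.scale[OF ind[OF N_closed(3) this], of 0] show ?thesis by simp
  qed
  have sum: "(\<lambda>y. \<Sum>C\<in>\<C>. c C * indicator C y) \<in> ?S"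
    if "finite \<C>" "\<And>C. C \<in> \<C> \<Longrightarrow> indicator C \<in> ?S" for \<C> :: "'a set set" and c :: "'a set \<Rightarrow> complex"
    using that
  proof (induction \<C> rule: finite_induct)
    case empty
    show ?case using zero by simp
  next
    case (insert C \<C>)
    have "sadd (linf N) (sscale (linf N) (c C) (indicator C)) (\<lambda>y. \<Sum>C\<in>\<C>. c C * indicator C y) \<in> ?S"
      using insert.prems by (intro cspan.add cspan.scale insert.IH) auto
    then show ?case by (simp only: linf_ops sum.insert[OF insert.hyps(1,2)])
  qed
  show "steps \<subseteq> D0_alg G N \<U>"
  proof
    fix f assume "f \<in> steps"
    then obtain U S where "step_via U S f" unfolding steps_def by blast
    note s = step_viaD[OF this]
    let ?C = "(\<lambda>x. x <# U) ` S"
    define r where "r C = (SOME x. x \<in> S \<and> C = x <# U)" for C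
    have r: "r C \<in> S \<and> C = r C <# U" if "C \<in> ?C" for C
      unfolding r_def by (rule someI_ex) (use that in blast)
    have f_const: "f y = f (r C)" if C: "C \<in> ?C" and y: "y \<in> C" for C y
    proof -
      have "y \<in> r C <# U" using r[OF C] y by blast
      then obtain u where "u \<in> U" "y = r C \<otimes> u" unfolding mem_l_coset by blast
      then show ?thesis using s(5)[of "r C" u] r[OF C] s(3) by blast
    qed
    \<comment> \<open>left cosets of \<open>U\<close> partition the group\<close>
    have disjoint: "C = C'" if C: "C \<in> ?C" "C' \<in> ?C" and y: "y \<in> C" "y \<in> C'" for C C' y
    proof -
      obtain x x' where x: "x \<in> S" "C = x <# U" "x' \<in> S" "C' = x' <# U" using C by blast
      obtain u u' where u: "u \<in> U" "y = x \<otimes> u" "u' \<in> U" "y = x' \<otimes> u'"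
        using y unfolding x mem_l_coset by blast
      have c: "x \<in> carrier G" "x' \<in> carrier G" "u \<in> carrier G" "u' \<in> carrier G"
        using x s(3) u U_carrier[OF s(1)] by auto
      have sub: "x1 <# U \<subseteq> x2 <# U"
        if "x1 \<in> carrier G" "x2 \<in> carrier G" "u1 \<in> U" "u2 \<in> U" "x1 \<otimes> u1 = x2 \<otimes> u2" for x1 x2 u1 u2
      proof
        fix z assume "z \<in> x1 <# U"
        then obtain v where v: "v \<in> U" "z = x1 \<otimes> v" unfolding mem_l_coset by blast
        have cc: "u1 \<in> carrier G" "u2 \<in> carrier G" "v \<in> carrier G"
          using that v U_carrier[OF s(1)] by auto
        have "x1 = (x1 \<otimes> u1) \<otimes> inv u1" using that(1) cc by (simp add: m_assoc)
        also have "\<dots> = x2 \<otimes> (u2 \<otimes> inv u1)"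
          unfolding that(5) using that(2) cc by (simp add: m_assoc)
        finally have "x1 \<otimes> v = x2 \<otimes> (u2 \<otimes> inv u1) \<otimes> v" by (rule arg_cong)
        then have "z = x2 \<otimes> ((u2 \<otimes> inv u1) \<otimes> v)" using v(2) that(2) cc by (simp add: m_assoc)
        moreover have "(u2 \<otimes> inv u1) \<otimes> v \<in> U"
          using that v by (intro U_mult[OF s(1)] U_inv[OF s(1)])
        ultimately show "z \<in> x2 <# U" unfolding mem_l_coset by blast
      qed
      have e: "x \<otimes> u = x' \<otimes> u'" using u(2,4) by simp
      show "C = C'"
        unfolding x using sub[OF c(1,2) u(1,3) e] sub[OF c(2,1) u(3,1) e[symmetric]]
        by (rule subset_antisym)
    qed
    have "f = (\<lambda>y. \<Sum>C\<in>?C. f (r C) * indicator C y)"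
    proof
      fix y
      show "f y = (\<Sum>C\<in>?C. f (r C) * indicator C y)"
      proof (cases "\<exists>C\<in>?C. y \<in> C")
        case True
        then obtain C where C: "C \<in> ?C" "y \<in> C" by blast
        have "(\<Sum>C'\<in>?C. f (r C') * indicator C' y) = (\<Sum>C'\<in>?C. if C' = C then f y else 0)"
        proof (rule sum.cong[OF refl])
          fix C' assume C': "C' \<in> ?C"
          show "f (r C') * indicator C' y = (if C' = C then f y else 0)"
          proof (cases "y \<in> C'")
            case True
            then show ?thesis using disjoint[OF C' C(1) True C(2)] f_const[OF C' True] by simp
          next
            case False
            then show ?thesis using C(2) by auto
          qed
        qed
        then show ?thesis using C(1) s(2) by simp
      next
        case False
        have "f y = 0"
        proof (cases "y \<in> N")
          case True
          then show ?thesis using s(6)[OF True] False by blast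
        qed (rule s(4))
        moreover have "(\<Sum>C\<in>?C. f (r C) * indicator C y) = 0"
          by (rule sum.neutral) (use False in \<open>auto simp: indicator_def\<close>)
        ultimately show ?thesis by simp
      qed
    qed
    moreover have "(\<lambda>y. \<Sum>C\<in>?C. f (r C) * indicator C y) \<in> ?S"
      by (rule sum) (use s(1,2,3) ind in auto)
    ultimately show "f \<in> D0_alg G N \<U>" unfolding D0_alg_def by simp
  qed
qed

end

context conj_system
begin

lemma steps_vanish: "f \<in> steps \<Longrightarrow> y \<notin> N \<Longrightarrow> f y = 0"
  unfolding steps_def step_via_def by blast

lemma steps_bounded:
  assumes "f \<in> steps"
  shows "\<exists>K. \<forall>y. cmod (f y) \<le> K"
proof -
  obtain U S where "step_via U S f" using assms unfolding steps_def by blast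
  note s = step_viaD[OF this]
  have "cmod (f y) \<le> (\<Sum>x\<in>S. cmod (f x))" for y
  proof (cases "f y = 0")
    case True
    then show ?thesis by (simp add: sum_nonneg)
  next
    case False
    then have "y \<in> N" using s(4) by blast
    then obtain x u where x: "x \<in> S" "u \<in> U" "y = x \<otimes> u"
      using s(6)[OF _ False] unfolding mem_l_coset by blast
    then have "f y = f x" using s(3,5) by blast
    then show ?thesis using member_le_sum[of x S "\<lambda>x. cmod (f x)"] x(1) s(2) by simp
  qed
  then show ?thesis by blast
qed

text \<open>If \<open>b\<close> is the \<open>H\<close>-component of \<open>t\<^sup>-\<^sup>1\<close>, the translate of a function invariant under \<open>U\<close> is invariant under
  \<open>b\<^sup>-\<^sup>1 U b\<close>.\<close>

lemma steps_translate:
  assumes t: "t \<in> carrier G" and f: "f \<in> steps"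
  shows "translate G N (beta G N H) t f \<in> steps"
proof -
  obtain U S where "step_via U S f" using f unfolding steps_def by blast
  note s = step_viaD[OF this]
  let ?\<beta> = "beta G N H"
  obtain b where b: "b \<in> H" "b = \<one> \<Longrightarrow> inv t \<in> N"
    "\<And>y u. y \<in> N \<Longrightarrow> u \<in> N \<Longrightarrow> ?\<beta> (inv t) (y \<otimes> u) = ?\<beta> (inv t) y \<otimes> conj b u"
    using inv_closed[OF t] by (rule beta_affine) blast
  let ?V = "conj (inv b) ` U"
  have V: "?V \<in> \<U>" using U_conj[OF s(1), of "inv b"] b(1) by simp
  have "step_via ?V (?\<beta> t ` S) (translate G N ?\<beta> t f)"
    unfolding step_via_def
  proof (intro conjI ballI allI impI V)
    show "finite (?\<beta> t ` S)" using s(2) by simp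
    show "?\<beta> t ` S \<subseteq> N" using subsetD[OF s(3)] t by auto
    show "translate G N ?\<beta> t f y = 0" if "y \<notin> N" for y using that by (simp add: translate_def)
    fix y assume y: "y \<in> N"
    show "translate G N ?\<beta> t f (y \<otimes> v) = translate G N ?\<beta> t f y" if v: "v \<in> ?V" for v
    proof -
      obtain u where u: "u \<in> U" "v = conj (inv b) u" using v by blast
      have vN: "v \<in> N" using U_N[OF V v] .
      have cv: "conj b v = u" using u b(1) U_carrier[OF s(1) u(1)] by simp
      have "f (?\<beta> (inv t) (y \<otimes> v)) = f (?\<beta> (inv t) y)"
        unfolding b(3)[OF y vN] cv using t y by (intro s(5) u(1)) simp
      then show ?thesis using y vN by (simp add: translate_def)
    qed
    assume "translate G N ?\<beta> t f y \<noteq> 0"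
    then have "f (?\<beta> (inv t) y) \<noteq> 0" using y by (simp add: translate_def)
    then obtain x u where x: "x \<in> S" "u \<in> U" "?\<beta> (inv t) y = x \<otimes> u"
      using s(6)[of "?\<beta> (inv t) y"] t y unfolding mem_l_coset by auto
    have xN: "x \<in> N" using x(1) s(3) by blast
    have uc: "u \<in> carrier G" "u \<in> N" using U_carrier[OF s(1) x(2)] U_N[OF s(1) x(2)] .
    let ?v = "conj (inv b) u"
    have vN: "?v \<in> N" using uc b(1) by simp
    have "?\<beta> (inv t) (?\<beta> t x \<otimes> ?v) = ?\<beta> (inv t) (?\<beta> t x) \<otimes> conj b ?v"
      by (rule b(3)) (use xN t vN in simp_all)
    also have "\<dots> = x \<otimes> u" using xN t uc b(1) by simp
    also have "\<dots> = ?\<beta> (inv t) y" by (rule x(3)[symmetric])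
    finally have "?\<beta> t (?\<beta> (inv t) (?\<beta> t x \<otimes> ?v)) = ?\<beta> t (?\<beta> (inv t) y)" by (rule arg_cong)
    then have "y = ?\<beta> t x \<otimes> ?v" using t y xN vN by simp
    then show "\<exists>z\<in>?\<beta> t ` S. y \<in> z <# ?V"
      unfolding mem_l_coset using x(1,2) by blast
  qed
  then show ?thesis unfolding steps_def by blast
qed

lemma function_algebra_steps: "function_algebra G N (beta G N H) steps"
proof
  show "d \<in> steps \<Longrightarrow> y \<notin> N \<Longrightarrow> d y = 0" for d y by (rule steps_vanish)
  show "d \<in> steps \<Longrightarrow> \<exists>K. \<forall>y. cmod (d y) \<le> K" for d by (rule steps_bounded)
  show "(\<lambda>_. 0) \<in> steps" by (rule steps_zero)
  show "d \<in> steps \<Longrightarrow> e \<in> steps \<Longrightarrow> (\<lambda>y. d y + e y) \<in> steps" for d e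
    by (rule steps_combine[where \<phi> = "\<lambda>z w. z + w"]) simp_all
  show "d \<in> steps \<Longrightarrow> (\<lambda>y. c * d y) \<in> steps" for c d
    using steps_combine[where \<phi> = "\<lambda>z w. c * z" and f = d and g = d] by simp
  show "d \<in> steps \<Longrightarrow> e \<in> steps \<Longrightarrow> (\<lambda>y. d y * e y) \<in> steps" for d e
    by (rule steps_combine[where \<phi> = "\<lambda>z w. z * w"]) simp_all
  show "d \<in> steps \<Longrightarrow> (\<lambda>y. cnj (d y)) \<in> steps" for d
    using steps_combine[where \<phi> = "\<lambda>z w. cnj z" and f = d and g = d] by simp
  show "t \<in> carrier G \<Longrightarrow> d \<in> steps \<Longrightarrow> translate G N (beta G N H) t d \<in> steps" for t d
    by (rule steps_translate)
  show "(\<lambda>y. of_real (1 - sqrt (1 - (h y)\<^sup>2))) \<in> steps" if "(\<lambda>y. of_real (h y)) \<in> steps" for h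
    using steps_combine[where \<phi> = "\<lambda>z w. of_real (1 - sqrt (1 - (Re z)\<^sup>2))", OF that that] by simp
qed

subsection \<open>Uniform limits of step functions\<close>

definition unif :: "('a \<Rightarrow> complex) set" where
  "unif = {f. (\<forall>y. y \<notin> N \<longrightarrow> f y = 0) \<and> (\<forall>e>0. \<exists>d\<in>steps. \<forall>y. cmod (f y - d y) \<le> e)}"

lemma unifI:
  "(\<And>y. y \<notin> N \<Longrightarrow> f y = 0) \<Longrightarrow> (\<And>e. 0 < e \<Longrightarrow> \<exists>d\<in>steps. \<forall>y. cmod (f y - d y) \<le> e) \<Longrightarrow> f \<in> unif"
  unfolding unif_def by simp

lemma unif_vanish: "f \<in> unif \<Longrightarrow> y \<notin> N \<Longrightarrow> f y = 0"
  unfolding unif_def by simp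

lemma unif_approx: "f \<in> unif \<Longrightarrow> 0 < e \<Longrightarrow> \<exists>d\<in>steps. \<forall>y. cmod (f y - d y) \<le> e"
  unfolding unif_def by simp

lemma steps_unif: "f \<in> steps \<Longrightarrow> f \<in> unif"
  by (rule unifI) (auto simp: steps_vanish intro!: bexI[of _ f])

lemma unif_bounded:
  assumes "f \<in> unif"
  shows "\<exists>K. \<forall>y. cmod (f y) \<le> K"
proof -
  obtain d where d: "d \<in> steps" "\<forall>y. cmod (f y - d y) \<le> 1" using unif_approx[OF assms zero_less_one] by blast
  obtain K where K: "\<forall>y. cmod (d y) \<le> K" using steps_bounded[OF d(1)] by blast
  have "cmod (f y) \<le> K + 1" for y
    using norm_triangle_ineq[of "d y" "f y - d y"] d(2)[rule_format, of y] K[rule_format, of y] by simp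
  then show ?thesis by blast
qed

lemma unif_add:
  assumes f: "f \<in> unif" and g: "g \<in> unif"
  shows "(\<lambda>y. f y + g y) \<in> unif"
proof (rule unifI)
  show "f y + g y = 0" if "y \<notin> N" for y using unif_vanish[OF f that] unif_vanish[OF g that] by simp
  fix e :: real assume "0 < e"
  then have e: "0 < e / 2" by simp
  obtain d d' where d: "d \<in> steps" "\<forall>y. cmod (f y - d y) \<le> e / 2"
    and d': "d' \<in> steps" "\<forall>y. cmod (g y - d' y) \<le> e / 2"
    using unif_approx[OF f e] unif_approx[OF g e] by blast
  have "cmod (f y + g y - (d y + d' y)) \<le> e" for y
    using norm_triangle_ineq[of "f y - d y" "g y - d' y"] d(2)[rule_format, of y] d'(2)[rule_format, of y]
    by (simp add: algebra_simps)
  moreover have "(\<lambda>y. d y + d' y) \<in> steps"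
    using function_algebra.E_add[OF function_algebra_steps d(1) d'(1)] .
  ultimately show "\<exists>d\<in>steps. \<forall>y. cmod (f y + g y - d y) \<le> e"
    by (intro bexI[of _ "\<lambda>y. d y + d' y"] allI)
qed

lemma unif_mult:
  assumes f: "f \<in> unif" and g: "g \<in> unif"
  shows "(\<lambda>y. f y * g y) \<in> unif"
proof (rule unifI)
  show "f y * g y = 0" if "y \<notin> N" for y using unif_vanish[OF f that] by simp
  fix e :: real assume e: "0 < e"
  obtain Kf where Kf: "\<forall>y. cmod (f y) \<le> Kf" using unif_bounded[OF f] by blast
  obtain d' where d': "d' \<in> steps" "\<forall>y. cmod (g y - d' y) \<le> e / (2 * (\<bar>Kf\<bar> + 1))"
    using unif_approx[OF g, of "e / (2 * (\<bar>Kf\<bar> + 1))"] e by auto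
  obtain Kd where Kd: "\<forall>y. cmod (d' y) \<le> Kd" using steps_bounded[OF d'(1)] by blast
  obtain d where d: "d \<in> steps" "\<forall>y. cmod (f y - d y) \<le> e / (2 * (\<bar>Kd\<bar> + 1))"
    using unif_approx[OF f, of "e / (2 * (\<bar>Kd\<bar> + 1))"] e by auto
  have "cmod (f y * g y - d y * d' y) \<le> e" for y
  proof -
    have "f y * g y - d y * d' y = f y * (g y - d' y) + (f y - d y) * d' y"
      by (simp add: algebra_simps)
    then have "cmod (f y * g y - d y * d' y) \<le> cmod (f y) * cmod (g y - d' y) + cmod (f y - d y) * cmod (d' y)"
      using norm_triangle_ineq[of "f y * (g y - d' y)" "(f y - d y) * d' y"] by (simp add: norm_mult)
    also have "\<dots> \<le> (\<bar>Kf\<bar> + 1) * (e / (2 * (\<bar>Kf\<bar> + 1))) + (e / (2 * (\<bar>Kd\<bar> + 1))) * (\<bar>Kd\<bar> + 1)"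
    proof (intro add_mono mult_mono)
      show "cmod (f y) \<le> \<bar>Kf\<bar> + 1" using Kf[rule_format, of y] by linarith
      show "cmod (d' y) \<le> \<bar>Kd\<bar> + 1" using Kd[rule_format, of y] by linarith
      show "0 \<le> e / (2 * (\<bar>Kd\<bar> + 1))" using e by (intro divide_nonneg_nonneg) auto
    qed (use d(2) d'(2) in auto)
    also have "\<dots> = e"
    proof -
      have half: "x * (e / (2 * x)) = e / 2" "(e / (2 * x)) * x = e / 2" if "0 < x" for x
        using that by simp_all
      have "0 < \<bar>Kf\<bar> + 1" "0 < \<bar>Kd\<bar> + 1" by linarith+
      then show ?thesis by (simp only: half)
    qed
    finally show ?thesis .
  qed
  moreover have "(\<lambda>y. d y * d' y) \<in> steps"
    using function_algebra.E_mult[OF function_algebra_steps d(1) d'(1)] .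
  ultimately show "\<exists>d\<in>steps. \<forall>y. cmod (f y * g y - d y) \<le> e"
    by (intro bexI[of _ "\<lambda>y. d y * d' y"] allI)
qed

lemma unif_scale:
  assumes f: "f \<in> unif"
  shows "(\<lambda>y. c * f y) \<in> unif"
proof (rule unifI)
  show "c * f y = 0" if "y \<notin> N" for y using unif_vanish[OF f that] by simp
  fix e :: real assume e: "0 < e"
  have c1: "0 < cmod c + 1" by (simp add: add_nonneg_pos)
  obtain d where d: "d \<in> steps" "\<forall>y. cmod (f y - d y) \<le> e / (cmod c + 1)"
    using unif_approx[OF f, of "e / (cmod c + 1)"] e c1 by auto
  have "cmod (c * f y - c * d y) \<le> e" for y
  proof -
    have "cmod (c * f y - c * d y) = cmod c * cmod (f y - d y)"
      by (simp add: right_diff_distrib[symmetric] norm_mult)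
    also have "\<dots> \<le> (cmod c + 1) * (e / (cmod c + 1))"
      by (intro mult_mono) (use d(2) c1 in auto)
    finally show ?thesis using c1 by simp
  qed
  moreover have "(\<lambda>y. c * d y) \<in> steps"
    using function_algebra.E_scale[OF function_algebra_steps d(1)] .
  ultimately show "\<exists>d\<in>steps. \<forall>y. cmod (c * f y - d y) \<le> e"
    by (intro bexI[of _ "\<lambda>y. c * d y"] allI)
qed

lemma unif_cnj:
  assumes f: "f \<in> unif"
  shows "(\<lambda>y. cnj (f y)) \<in> unif"
proof (rule unifI)
  show "cnj (f y) = 0" if "y \<notin> N" for y using unif_vanish[OF f that] by simp
  fix e :: real assume e: "0 < e"
  obtain d where d: "d \<in> steps" "\<forall>y. cmod (f y - d y) \<le> e" using unif_approx[OF f e] by blast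
  have "cmod (cnj (f y) - cnj (d y)) = cmod (f y - d y)" for y
    by (metis complex_cnj_diff complex_mod_cnj)
  then have "\<forall>y. cmod (cnj (f y) - cnj (d y)) \<le> e" using d(2) by simp
  moreover have "(\<lambda>y. cnj (d y)) \<in> steps"
    using function_algebra.E_cnj[OF function_algebra_steps d(1)] .
  ultimately show "\<exists>d\<in>steps. \<forall>y. cmod (cnj (f y) - d y) \<le> e" by (rule rev_bexI[rotated])
qed

lemma unif_translate:
  assumes t: "t \<in> carrier G" and f: "f \<in> unif"
  shows "translate G N (beta G N H) t f \<in> unif"
proof (rule unifI)
  show "y \<notin> N \<Longrightarrow> translate G N (beta G N H) t f y = 0" for y by (simp add: translate_def)
  fix e :: real assume e: "0 < e"
  obtain d where d: "d \<in> steps" "\<forall>y. cmod (f y - d y) \<le> e" using unif_approx[OF f e] by blast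
  have "\<forall>y. cmod (translate G N (beta G N H) t f y - translate G N (beta G N H) t d y) \<le> e"
    using d(2) e by (simp add: translate_def)
  then show "\<exists>d\<in>steps. \<forall>y. cmod (translate G N (beta G N H) t f y - d y) \<le> e"
    using steps_translate[OF t d(1)] by blast
qed

text \<open>Uniform continuity of \<open>s \<mapsto> 1 - \<surd>(1 - s\<^sup>2)\<close> on \<open>[-1, 1]\<close> transports the approximation.\<close>

lemma unif_sqrt:
  fixes h :: "'a \<Rightarrow> real"
  assumes h: "(\<lambda>y. of_real (h y)) \<in> unif" and le: "\<And>y. \<bar>h y\<bar> \<le> 1"
  shows "(\<lambda>y. of_real (1 - sqrt (1 - (h y)\<^sup>2))) \<in> unif"
proof (rule unifI)
  show "complex_of_real (1 - sqrt (1 - (h y)\<^sup>2)) = 0" if "y \<notin> N" for y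
    using unif_vanish[OF h that] by simp
  let ?g = "\<lambda>s::real. 1 - sqrt (1 - s\<^sup>2)"
  have uc: "uniformly_continuous_on {-1..1} ?g"
    by (rule compact_uniformly_continuous) (auto intro!: continuous_intros)
  fix e :: real assume e: "0 < e"
  obtain \<delta> where \<delta>: "0 < \<delta>"
    and close: "\<And>s s'. s \<in> {-1..1} \<Longrightarrow> s' \<in> {-1..1} \<Longrightarrow> dist s' s < \<delta> \<Longrightarrow> dist (?g s') (?g s) < e"
    using uc e unfolding uniformly_continuous_on_def by meson
  obtain d where d: "d \<in> steps" "\<forall>y. cmod (of_real (h y) - d y) \<le> \<delta> / 2"
    using unif_approx[OF h, of "\<delta> / 2"] \<delta> by auto
  \<comment> \<open>clamping the real part to \<open>[-1, 1]\<close> brings it no further from \<open>h\<close>\<close>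
  let ?c = "\<lambda>y. max (-1) (min 1 (Re (d y)))"
  have "cmod (of_real (?g (h y)) - of_real (?g (?c y))) \<le> e" for y
  proof -
    have "\<bar>h y - Re (d y)\<bar> \<le> \<delta> / 2"
      using abs_Re_le_cmod[of "of_real (h y) - d y"] d(2)[rule_format, of y] by simp
    then have "dist (h y) (?c y) < \<delta>"
      using \<delta> le[of y] unfolding dist_real_def by linarith
    then have "dist (?g (h y)) (?g (?c y)) < e"
      using le[of y] by (intro close) (auto simp: abs_le_iff)
    then show ?thesis
      unfolding dist_real_def of_real_diff[symmetric] norm_of_real by simp
  qed
  moreover have "(\<lambda>y. of_real (?g (?c y))) \<in> steps"
    using steps_combine[where \<phi> = "\<lambda>z w. of_real (?g (max (-1) (min 1 (Re z))))", OF d(1) d(1)]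
    by simp
  ultimately show "\<exists>d\<in>steps. \<forall>y. cmod (of_real (?g (h y)) - d y) \<le> e"
    by (intro bexI[of _ "\<lambda>y. of_real (?g (?c y))"]) blast
qed

lemma function_algebra_unif: "function_algebra G N (beta G N H) unif"
  by unfold_locales
    (rule unif_vanish unif_bounded steps_unif[OF steps_zero] unif_add unif_scale unif_mult unif_cnj
      unif_translate unif_sqrt; assumption)+

lemma dense_steps: "dense_function_algebra G N (beta G N H) unif steps"
  by (intro dense_function_algebra.intro function_algebra_pair.intro function_algebra_unif
      function_algebra_steps function_algebra_pair_axioms.intro dense_function_algebra_axioms.intro)
    (blast intro: steps_unif unif_approx)+

lemma linf_carrier: "f \<in> carrier (linf N) \<longleftrightarrow> (\<forall>y. y \<notin> N \<longrightarrow> f y = 0) \<and> (\<exists>K. \<forall>y. cmod (f y) \<le> K)"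
proof -
  have "bounded (f ` N) \<longleftrightarrow> (\<exists>K. \<forall>y. cmod (f y) \<le> K)" if z: "\<forall>y. y \<notin> N \<longrightarrow> f y = 0"
  proof
    assume "bounded (f ` N)"
    then obtain K where "\<forall>y\<in>N. cmod (f y) \<le> K" unfolding bounded_iff by blast
    then have "cmod (f y) \<le> max K 0" for y using z by (cases "y \<in> N") (auto simp: le_max_iff_disj)
    then show "\<exists>K. \<forall>y. cmod (f y) \<le> K" by blast
  next
    assume "\<exists>K. \<forall>y. cmod (f y) \<le> K"
    then show "bounded (f ` N)" unfolding bounded_iff by blast
  qed
  then show ?thesis unfolding linf_def by auto
qed

lemma unif_linf: "f \<in> unif \<Longrightarrow> f \<in> carrier (linf N)"
  unfolding linf_carrier using unif_vanish unif_bounded by blast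

lemma linf_dist: "snorm (linf N) (sdiff (linf N) f g) = (SUP y\<in>N. cmod (f y - g y))"
  by (simp add: sdiff_def)

lemma cstar_subalgebra_unif: "cstar_subalgebra (linf N) unif"
  unfolding cstar_subalgebra_def
proof (intro conjI ballI allI impI)
  show "unif \<noteq> {}" using steps_unif[OF steps_zero] by blast
  show "unif \<subseteq> carrier (linf N)" using unif_linf by blast
  show "sadd (linf N) f g \<in> unif" if "f \<in> unif" "g \<in> unif" for f g using unif_add[OF that] by simp
  show "sscale (linf N) c f \<in> unif" if "f \<in> unif" for c f using unif_scale[OF that] by simp
  show "smult (linf N) f g \<in> unif" if "f \<in> unif" "g \<in> unif" for f g using unif_mult[OF that] by simp
  show "sstar (linf N) f \<in> unif" if "f \<in> unif" for f using unif_cnj[OF that] by simp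
  fix f assume f: "f \<in> carrier (linf N)"
    and approx: "\<forall>e>0. \<exists>g\<in>unif. snorm (linf N) (sdiff (linf N) f g) < e"
  have fz: "y \<notin> N \<Longrightarrow> f y = 0" for y using f unfolding linf_carrier by blast
  show "f \<in> unif"
  proof (rule unifI[OF fz])
    fix e :: real assume e: "0 < e"
    then obtain g where g: "g \<in> unif" "(SUP y\<in>N. cmod (f y - g y)) < e / 2"
      using approx half_gt_zero[OF e] unfolding linf_dist by blast
    obtain Kf Kg where K: "\<forall>y. cmod (f y) \<le> Kf" "\<forall>y. cmod (g y) \<le> Kg"
      using f unif_bounded[OF g(1)] unfolding linf_carrier by blast
    have "bdd_above ((\<lambda>y. cmod (f y - g y)) ` N)"
    proof (rule bdd_aboveI2)
      show "cmod (f y - g y) \<le> Kf + Kg" for y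
        using norm_triangle_ineq4[of "f y" "g y"] K(1)[rule_format, of y] K(2)[rule_format, of y] by linarith
    qed
    then have "cmod (f y - g y) \<le> e / 2" if "y \<in> N" for y
      using cSUP_upper[OF that, of "\<lambda>y. cmod (f y - g y)"] g(2) by linarith
    then have fg: "cmod (f y - g y) \<le> e / 2" for y
      using fz[of y] unif_vanish[OF g(1), of y] e by (cases "y \<in> N") auto
    obtain d where d: "d \<in> steps" "\<forall>y. cmod (g y - d y) \<le> e / 2"
      using unif_approx[OF g(1) half_gt_zero[OF e]] by blast
    have "cmod (f y - d y) \<le> e" for y
      using norm_triangle_ineq[of "f y - g y" "g y - d y"] fg[of y] d(2)[rule_format, of y] by simp
    then show "\<exists>d\<in>steps. \<forall>y. cmod (f y - d y) \<le> e" using d(1) by blast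
  qed
qed

text \<open>The uniform limits of step functions form a closed star-subalgebra, and every closed subalgebra that
  contains the coset indicators contains these limits.\<close>

lemma D_eq_unif: "D_alg G N \<U> = unif"
proof
  have "coset_indicators G N \<U> \<subseteq> unif"
  proof
    fix f assume "f \<in> coset_indicators G N \<U>"
    then have "f \<in> D0_alg G N \<U>" unfolding D0_alg_def by (rule cspan.base)
    then show "f \<in> unif" unfolding D0_eq_steps by (rule steps_unif)
  qed
  then show "D_alg G N \<U> \<subseteq> unif"
    unfolding D_alg_def cstar_generated_def using cstar_subalgebra_unif by blast
  show "unif \<subseteq> D_alg G N \<U>"
    unfolding D_alg_def cstar_generated_def
  proof (intro subsetI InterI)
    fix f C assume f: "f \<in> unif" and "C \<in> {C. cstar_subalgebra (linf N) C \<and> coset_indicators G N \<U> \<subseteq> C}"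
    then have C: "cstar_subalgebra (linf N) C" and ind: "coset_indicators G N \<U> \<subseteq> C" by blast+
    have "d \<in> C" if "d \<in> cspan (linf N) (coset_indicators G N \<U>)" for d
      using that
    proof (induction rule: cspan.induct)
      case (base x)
      then show ?case using ind by blast
    next
      case (add x y)
      then show ?case using C unfolding cstar_subalgebra_def by blast
    next
      case (scale x c)
      then show ?case using C unfolding cstar_subalgebra_def by blast
    qed
    then have steps_C: "steps \<subseteq> C" unfolding D0_eq_steps[symmetric] D0_alg_def by blast
    have "\<exists>g\<in>C. snorm (linf N) (sdiff (linf N) f g) < e" if e: "0 < e" for e
    proof -
      obtain d where d: "d \<in> steps" "\<forall>y. cmod (f y - d y) \<le> e / 2"
        using unif_approx[OF f half_gt_zero[OF e]] by blast
      have "(SUP y\<in>N. cmod (f y - d y)) \<le> e / 2"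
        by (rule cSUP_least) (use d(2) N_closed(3) in blast)+
      then have "snorm (linf N) (sdiff (linf N) f d) < e" unfolding linf_dist using e by linarith
      then show ?thesis using d(1) steps_C by blast
    qed
    then show "f \<in> C" using C unif_linf[OF f] unfolding cstar_subalgebra_def by blast
  qed
qed

subsection \<open>C*-norms dominate the conditional expectation\<close>

text \<open>The coset \<open>zW\<close> is disjoint from its images under the elements \<open>t \<noteq> \<one>\<close> of the support of \<open>f\<close>, and \<open>f \<one>\<close>
  is constant on it. Compressing \<open>f\<close> by the indicator \<open>q\<close> of \<open>zW\<close> leaves \<open>f \<one> y\<close> times \<open>q\<close>, which has
  norm \<open>\<bar>f \<one> y\<bar>\<close> because a nonzero projection has norm \<open>1\<close> in every C*-norm.\<close>

lemma cstar_norm_dominates_expectation: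
  fixes A
  defines "A \<equiv> cc_alg G steps (translate G N (beta G N H))"
  assumes p: "cstar_norm A p" and f: "f \<in> carrier A" and y: "y \<in> N"
  shows "cmod (f \<one> y) \<le> p f"
proof -
  interpret E: function_algebra G N "beta G N H" steps by (rule function_algebra_steps)
  note A = A_def
  have s: "cstar_seminorm E.A p" using p unfolding cstar_norm_def A by (rule conjunct1)
  interpret p: seminormed_star_algebra E.A p by unfold_locales (rule s)
  have fA: "f \<in> carrier E.A" using f unfolding A .
  obtain U S where "step_via U S (f \<one>)" using E.A_E[OF fA, of \<one>] unfolding steps_def by blast
  note f1 = step_viaD[OF this]
  let ?F = "{t. f t \<noteq> (\<lambda>_. 0)} - {\<one>}"
  have fin: "finite {t. f t \<noteq> (\<lambda>_. 0)}" "{t. f t \<noteq> (\<lambda>_. 0)} \<subseteq> carrier G"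
    using fA unfolding E.mem_A by blast+
  then have F: "finite ?F" "?F \<subseteq> carrier G - {\<one>}" by blast+
  obtain z W where z: "z \<in> y <# U" and W: "W \<in> \<U>" "W \<subseteq> U"
    and free: "\<forall>t\<in>?F. \<forall>w\<in>W. \<forall>w'\<in>W. beta G N H t (z \<otimes> w) \<noteq> z \<otimes> w'"
    using moved_coset_finite[OF F y f1(1)] by blast
  obtain u where u: "u \<in> U" "z = y \<otimes> u" using z unfolding mem_l_coset by blast
  have zN: "z \<in> N" using u y U_N[OF f1(1) u(1)] by simp
  define e :: "'a \<Rightarrow> complex" where "e = indicator (z <# W)"
  have e: "e \<in> steps" unfolding e_def steps_def using indicator_step[OF zN W(1)] by blast
  let ?q = "action.single \<one> e"
  have qA: "?q \<in> carrier E.A" by (rule E.single_A[OF one_closed e])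
  have ee: "e v * e v = e v" for v by (simp add: e_def indicator_def)
  have e1: "e v \<noteq> 0 \<Longrightarrow> v \<in> z <# W" for v by (simp add: e_def indicator_def split: if_splits)
  have star_q: "smult E.A (sstar E.A ?q) ?q = ?q"
  proof -
    have "(\<lambda>v. cnj (e v) * e v) = e" by (auto simp: e_def indicator_def)
    then show ?thesis
      using action.star_single_mult_single[OF one_closed, of e] action.tr_one[OF E.E_vanishing[OF e]]
      by (simp add: E.A_mult_eq E.A_star_eq)
  qed
  have "p ?q \<noteq> 0"
  proof
    assume "p ?q = 0"
    then have "?q = sscale E.A 0 ?q" using p qA unfolding cstar_norm_def A by blast
    then have "?q \<one> z = 0" by (metis (no_types, lifting) action.cc_alg_ops(2) mult_zero_left)
    moreover have "z \<in> z <# W"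
      unfolding mem_l_coset using U_one[OF W(1)] zN by (intro bexI[of _ \<one>]) simp_all
    ultimately show False by (simp add: action.single_def e_def)
  qed
  moreover have "(p ?q)\<^sup>2 = p ?q" using p.p_star_mult[OF qA] by (simp only: star_q)
  ultimately have pq: "p ?q = 1" by (simp add: power2_eq_square)
  \<comment> \<open>the corner of \<open>f\<close> cut out by \<open>q\<close> retains only a constant multiple of \<open>q\<close>\<close>
  have corner: "smult E.A (smult E.A ?q f) ?q = sscale E.A (f \<one> y) ?q"
  proof (intro ext)
    fix t v
    have qf: "smult E.A ?q f = (\<lambda>s. if s \<in> carrier G then \<lambda>y. e y * translate G N (beta G N H) \<one> (f (inv \<one> \<otimes> s)) y else (\<lambda>_. 0))"
      unfolding E.A_mult_eq by (rule action.single_mult_apply[OF one_closed E.E_vanishing[OF e]])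
    have qfA: "smult E.A ?q f \<in> carrier E.A" by (intro E.A.mult_closed qA fA)
    show "smult E.A (smult E.A ?q f) ?q t v = sscale E.A (f \<one> y) ?q t v"
    proof (cases "t \<in> carrier G \<and> v \<in> N")
      case False
      then show ?thesis
        using action.mult_outside[OF E.A_CV[OF qfA], of t v steps ?q] E.E_vanish[OF e, of v]
        by (auto simp: action.single_def)
    next
      case True
      then have t: "t \<in> carrier G" and v: "v \<in> N" by auto
      let ?g = "smult E.A ?q f"
      have "smult E.A ?g ?q t v = (\<Sum>s\<in>{s\<in>carrier G. ?g s \<noteq> (\<lambda>_. 0)}. ?g s v * ?q (inv s \<otimes> t) (beta G N H (inv s) v))"
        by (rule action.mult_apply[OF t v])
      also have "\<dots> = (\<Sum>s\<in>{s\<in>carrier G. ?g s \<noteq> (\<lambda>_. 0)}. if s = t then ?g t v * e (beta G N H (inv t) v) else 0)"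
      proof (rule sum.cong[OF refl])
        fix s assume "s \<in> {s\<in>carrier G. ?g s \<noteq> (\<lambda>_. 0)}"
        then have s: "s \<in> carrier G" by simp
        have "inv s \<otimes> t = \<one> \<longleftrightarrow> s = t"
        proof
          assume "inv s \<otimes> t = \<one>"
          then have "s \<otimes> (inv s \<otimes> t) = s" using s by simp
          then show "s = t" using s t by simp
        qed (use s in simp)
        then show "?g s v * ?q (inv s \<otimes> t) (beta G N H (inv s) v) = (if s = t then ?g t v * e (beta G N H (inv t) v) else 0)"
          by (simp add: action.single_def)
      qed
      also have "\<dots> = ?g t v * e (beta G N H (inv t) v)"
        using action.CV_support[OF E.A_CV[OF qfA]] t by (simp add: sum.delta')
      also have "\<dots> = e v * f t v * e (beta G N H (inv t) v)"
        using t v by (simp add: qf translate_def)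
      finally have eq: "smult E.A ?g ?q t v = e v * f t v * e (beta G N H (inv t) v)" .
      show ?thesis
      proof (cases "t = \<one>")
        case True
        have "e v * f \<one> v = e v * f \<one> y"
        proof (cases "e v = 0")
          case False
          then obtain w where w: "w \<in> W" "v = z \<otimes> w" using e1 unfolding mem_l_coset by blast
          have "f \<one> v = f \<one> z" unfolding w(2) using zN w(1) W(2) by (intro f1(5)) auto
          also have "\<dots> = f \<one> y" unfolding u(2) using y u(1) by (rule f1(5))
          finally show ?thesis by simp
        qed simp
        then have "e v * f \<one> v * e v = (e v * f \<one> y) * e v" by (rule arg_cong)
        also have "\<dots> = f \<one> y * (e v * e v)" by (simp only: mult_ac)
        finally have "e v * f \<one> v * e v = f \<one> y * e v" by (simp only: ee)
        then show ?thesis using True eq v by (simp add: action.single_def)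
      next
        case False
        have "e v * f t v * e (beta G N H (inv t) v) = 0"
        proof (rule ccontr)
          assume nz: "e v * f t v * e (beta G N H (inv t) v) \<noteq> 0"
          then have "t \<in> ?F" using False by auto
          obtain w' where w': "w' \<in> W" "v = z \<otimes> w'" using e1[of v] nz unfolding mem_l_coset by auto
          obtain w where w: "w \<in> W" "beta G N H (inv t) v = z \<otimes> w"
            using e1[of "beta G N H (inv t) v"] nz unfolding mem_l_coset by auto
          have "beta G N H t (z \<otimes> w) = z \<otimes> w'"
            unfolding w(2)[symmetric] using t v w'(2) by simp
          then show False using free \<open>t \<in> ?F\<close> w(1) w'(1) by blast
        qed
        then show ?thesis using False eq by (simp add: action.single_def)
      qed
    qed
  qed
  have "cmod (f \<one> y) = p (sscale E.A (f \<one> y) ?q)" using p.p_scale[OF qA] pq by simp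
  also have "\<dots> = p (smult E.A (smult E.A ?q f) ?q)" by (simp only: corner)
  also have "\<dots> \<le> p (smult E.A ?q f) * p ?q" by (intro p.p_mult E.A.mult_closed qA fA)
  also have "\<dots> \<le> (p ?q * p f) * p ?q" by (intro mult_right_mono p.p_mult p.p_nonneg qA fA)
  finally show ?thesis by (simp add: pq)
qed

end

section \<open>Uniqueness of the C*-norm\<close>

theorem corollary4p8:
  fixes G :: "('g, 'm) monoid_scheme" (structure)
    and N H M :: "'g set" and \<U> :: "'g set set"
    and D D0 :: "('g \<Rightarrow> complex) set"
    and \<alpha> :: "'g \<Rightarrow> ('g \<Rightarrow> complex) \<Rightarrow> ('g \<Rightarrow> complex)"
  assumes "group G"
    and "N \<lhd> G" and "subgroup H G" and "N <#> H = carrier G" and "N \<inter> H = {\<one>}"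
    and "M \<lhd> (G\<lparr>carrier := N\<rparr>)" and "M \<noteq> {\<one>}"
    and "\<U> = conj_family G H M"
    and filter_base: "\<forall>U\<in>\<U>. \<forall>V\<in>\<U>. \<exists>W\<in>\<U>. W \<subseteq> U \<inter> V"
    and separating: "\<Inter>\<U> = {\<one>}"
    and finite_quotients: "\<forall>U\<in>\<U>. \<forall>V\<in>\<U>. V \<subseteq> U \<longrightarrow> finite (carrier (G\<lparr>carrier := U\<rparr> Mod V))"
    and effective: "\<forall>a\<in>H. a \<noteq> \<one> \<longrightarrow> (\<exists>s\<in>M. a \<otimes> s \<otimes> inv a \<noteq> s)"
    and "D = D_alg G N \<U>" and "D0 = D0_alg G N \<U>" and "\<alpha> = alpha G N H"
    and regular_iso: "star_iso (full_crossed_product G D \<alpha>) (reduced_crossed_product G N D \<alpha>)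
                        (regular_rep G N \<alpha>)"
  shows "\<exists>!p. p \<in> extensional (carrier (algebraic_crossed_product G D D0 \<alpha>)) \<and>
              cstar_norm (algebraic_crossed_product G D D0 \<alpha>) p"
proof -
  interpret conj_system G N H M \<U>
    by (intro conj_system.intro conj_system_axioms.intro) (fact assms)+
  interpret dense_function_algebra G N "beta G N H" unif steps by (rule dense_steps)
  have eqs: "D = unif" "D0 = steps" "\<alpha> = translate G N (beta G N H)"
    using assms(13-15) by (simp_all only: D_eq_unif D0_eq_steps alpha_eq)
  show ?thesis
    unfolding eqs
  proof (rule unique_cstar_norm)
    show "star_iso (full_crossed_product G unif (translate G N (beta G N H)))
        (reduced_crossed_product G N unif (translate G N (beta G N H)))
        (regular_rep G N (translate G N (beta G N H)))"
      using regular_iso unfolding eqs .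
  qed (rule cstar_norm_dominates_expectation)
qed

end
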